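(* Let $\pi : E \to M$ be a (smooth) vector bundle over a smooth manifold $M$ of dimension $n$, endowed with a (linear) connection $\nabla$. Let $(x_1,\dots,x_n)$ be smooth local coordinates on $M$ centered at a point $p \in M$, and let $\xi_p \in E_p := \pi^{-1}(p)$. Then there exist a neighborhood $U$ of $p$ (contained in the domain of the coordinates) and a smooth section $\xi : U \to E$ such that $\xi(p) = \xi_p$ and $$\nabla_{\frac{\partial}{\partial \rho}} \xi \equiv 0 \quad \text{on } U,$$ where $\frac{\partial}{\partial \rho} := \sum_{j=1}^n x_j \frac{\partial}{\partial x_j}$ is the radial vector field of the coordinates.
   Context: Smooth means $C^\infty$. Vector bundles are smooth and of finite rank, and a connection $\nabla$ on $E$ means a smooth linear connection (covariant derivative) on $E$. Coordinates $(x_1,\dots,x_n)$ are centered at $p$ if $x_j(p)=0$ for all $j=1,\dots,n$. Smoothness of $\xi$ on $U$ includes smoothness at the point $p$ itself, where the radial vector field $\frac{\partial}{\partial \rho}$ vanishes. *)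

theory Defs
  imports "HOL-Analysis.Analysis"
begin

subsection \<open>Smooth functions on open subsets of Euclidean n-space\<close>

text \<open>
  Euclidean n-space is the library's \<^term>\<open>Euclidean_space n\<close>: functions on the naturals that vanish
  from index \<open>n\<close> on. The coordinates are therefore numbered \<open>0, \<dots>, n - 1\<close>, and dimension and
  rank may be \<open>0\<close>.
\<close>

definition partial :: "nat \<Rightarrow> ((nat \<Rightarrow> real) \<Rightarrow> real) \<Rightarrow> (nat \<Rightarrow> real) \<Rightarrow> real" where
  "partial i f x = deriv (\<lambda>t. f (x(i := t))) (x i)"

definition has_partial :: "nat \<Rightarrow> ((nat \<Rightarrow> real) \<Rightarrow> real) \<Rightarrow> (nat \<Rightarrow> real) \<Rightarrow> bool" where
  "has_partial i f x \<longleftrightarrow> (\<lambda>t. f (x(i := t))) differentiable (at (x i))"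

text \<open>
  \<open>Ck_on n k V f\<close>: on the open subset \<open>V\<close> of n-space, all iterated partial derivatives of \<open>f\<close> of
  order at most \<open>k\<close> exist and are continuous.
\<close>

fun Ck_on :: "nat \<Rightarrow> nat \<Rightarrow> (nat \<Rightarrow> real) set \<Rightarrow> ((nat \<Rightarrow> real) \<Rightarrow> real) \<Rightarrow> bool" where
  "Ck_on n 0 V f \<longleftrightarrow> continuous_map (subtopology (Euclidean_space n) V) euclideanreal f"
| "Ck_on n (Suc k) V f \<longleftrightarrow>
     continuous_map (subtopology (Euclidean_space n) V) euclideanreal f \<and>
     (\<forall>i<n. (\<forall>x\<in>V. has_partial i f x) \<and> Ck_on n k V (partial i f))"

definition smooth_real_on :: "nat \<Rightarrow> (nat \<Rightarrow> real) set \<Rightarrow> ((nat \<Rightarrow> real) \<Rightarrow> real) \<Rightarrow> bool" where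
  "smooth_real_on n V f \<longleftrightarrow> (\<forall>k. Ck_on n k V f)"

definition smooth_vec_on ::
  "nat \<Rightarrow> nat \<Rightarrow> (nat \<Rightarrow> real) set \<Rightarrow> ((nat \<Rightarrow> real) \<Rightarrow> (nat \<Rightarrow> real)) \<Rightarrow> bool" where
  "smooth_vec_on n m V f \<longleftrightarrow> (\<forall>i<m. smooth_real_on n V (\<lambda>x. f x i))"

subsection \<open>Smooth manifolds\<close>

text \<open>A chart is a pair of its domain and its coordinate map.\<close>

type_synonym 'm chart = "'m set \<times> ('m \<Rightarrow> nat \<Rightarrow> real)"

record 'm mfd =
  mtop :: "'m topology"
  mdim :: nat
  atlas :: "'m chart set"

abbreviation points :: "'m mfd \<Rightarrow> 'm set" where
  "points M \<equiv> topspace (mtop M)"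

definition topological_chart :: "'m mfd \<Rightarrow> 'm set \<Rightarrow> ('m \<Rightarrow> nat \<Rightarrow> real) \<Rightarrow> bool" where
  "topological_chart M U \<phi> \<longleftrightarrow>
     openin (mtop M) U \<and>
     openin (Euclidean_space (mdim M)) (\<phi> ` U) \<and>
     homeomorphic_map (subtopology (mtop M) U) (subtopology (Euclidean_space (mdim M)) (\<phi> ` U)) \<phi>"

definition smooth_transition ::
  "nat \<Rightarrow> 'm set \<Rightarrow> ('m \<Rightarrow> nat \<Rightarrow> real) \<Rightarrow> 'm set \<Rightarrow> ('m \<Rightarrow> nat \<Rightarrow> real) \<Rightarrow> bool" where
  "smooth_transition n U \<phi> V \<psi> \<longleftrightarrow> smooth_vec_on n n (\<phi> ` (U \<inter> V)) (\<psi> \<circ> inv_into U \<phi>)"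

definition smooth_manifold :: "'m mfd \<Rightarrow> bool" where
  "smooth_manifold M \<longleftrightarrow>
     Hausdorff_space (mtop M) \<and> second_countable (mtop M) \<and>
     (\<forall>(U, \<phi>) \<in> atlas M. topological_chart M U \<phi>) \<and>
     (\<Union>(U, \<phi>) \<in> atlas M. U) = points M \<and>
     (\<forall>(U, \<phi>) \<in> atlas M. \<forall>(V, \<psi>) \<in> atlas M. smooth_transition (mdim M) U \<phi> V \<psi>)"

text \<open>The atlas need not be maximal; \<open>smooth_coordinates\<close> are the charts of the maximal one.\<close>

definition smooth_coordinates :: "'m mfd \<Rightarrow> 'm set \<Rightarrow> ('m \<Rightarrow> nat \<Rightarrow> real) \<Rightarrow> bool" where
  "smooth_coordinates M V x \<longleftrightarrow>
     topological_chart M V x \<and>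
     (\<forall>(U, \<phi>) \<in> atlas M. smooth_transition (mdim M) U \<phi> V x \<and> smooth_transition (mdim M) V x U \<phi>)"

definition smooth_map :: "'m mfd \<Rightarrow> 'k mfd \<Rightarrow> ('m \<Rightarrow> 'k) \<Rightarrow> bool" where
  "smooth_map M N f \<longleftrightarrow>
     continuous_map (mtop M) (mtop N) f \<and>
     (\<forall>(U, \<phi>) \<in> atlas M. \<forall>(V, \<psi>) \<in> atlas N.
        smooth_vec_on (mdim M) (mdim N) (\<phi> ` (U \<inter> f -` V)) (\<psi> \<circ> f \<circ> inv_into U \<phi>))"

definition diffeomorphism :: "'m mfd \<Rightarrow> 'k mfd \<Rightarrow> ('m \<Rightarrow> 'k) \<Rightarrow> bool" where
  "diffeomorphism M N f \<longleftrightarrow>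
     bij_betw f (points M) (points N) \<and>
     smooth_map M N f \<and> smooth_map N M (inv_into (points M) f)"

definition open_submfd :: "'m mfd \<Rightarrow> 'm set \<Rightarrow> 'm mfd" where
  "open_submfd M W =
     \<lparr>mtop = subtopology (mtop M) W, mdim = mdim M, atlas = {(U \<inter> W, \<phi>) | U \<phi>. (U, \<phi>) \<in> atlas M}\<rparr>"

definition euclidean_mfd :: "nat \<Rightarrow> (nat \<Rightarrow> real) mfd" where
  "euclidean_mfd k =
     \<lparr>mtop = Euclidean_space k, mdim = k, atlas = {(topspace (Euclidean_space k), \<lambda>x. x)}\<rparr>"

definition prod_mfd :: "'m mfd \<Rightarrow> 'k mfd \<Rightarrow> ('m \<times> 'k) mfd" where
  "prod_mfd M N =
     \<lparr>mtop = prod_topology (mtop M) (mtop N),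
      mdim = mdim M + mdim N,
      atlas = {(U \<times> V, \<lambda>(a, b) i. if i < mdim M then \<phi> a i else \<psi> b (i - mdim M)) | U \<phi> V \<psi>.
                 (U, \<phi>) \<in> atlas M \<and> (V, \<psi>) \<in> atlas N}\<rparr>"

subsection \<open>Tangent vectors and vector fields\<close>

definition smooth_fun_on :: "'m mfd \<Rightarrow> 'm set \<Rightarrow> ('m \<Rightarrow> real) \<Rightarrow> bool" where
  "smooth_fun_on M W f \<longleftrightarrow>
     (\<forall>(U, \<phi>) \<in> atlas M. smooth_real_on (mdim M) (\<phi> ` (U \<inter> W)) (f \<circ> inv_into U \<phi>))"

abbreviation smooth_fun :: "'m mfd \<Rightarrow> ('m \<Rightarrow> real) \<Rightarrow> bool" where
  "smooth_fun M f \<equiv> smooth_fun_on M (points M) f"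

text \<open>
  Tangent vectors at \<open>q\<close> are derivations at \<open>q\<close> of the algebra of smooth functions on \<open>M\<close>. As
  functions on \<open>M\<close> are represented by functions on the whole type, a derivation must ignore their
  values outside \<open>M\<close>; it is set to \<open>0\<close> on non-smooth functions so that equality of
  tangent vectors is equality of terms.
\<close>

definition tangent_space :: "'m mfd \<Rightarrow> 'm \<Rightarrow> (('m \<Rightarrow> real) \<Rightarrow> real) set" where
  "tangent_space M q = {v.
     (\<forall>f. \<not> smooth_fun M f \<longrightarrow> v f = 0) \<and>
     (\<forall>f g. smooth_fun M f \<and> smooth_fun M g \<and> (\<forall>r \<in> points M. f r = g r) \<longrightarrow> v f = v g) \<and>
     (\<forall>f g. smooth_fun M f \<and> smooth_fun M g \<longrightarrow> v (\<lambda>r. f r + g r) = v f + v g) \<and>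
     (\<forall>c f. smooth_fun M f \<longrightarrow> v (\<lambda>r. c * f r) = c * v f) \<and>
     (\<forall>f g. smooth_fun M f \<and> smooth_fun M g \<longrightarrow> v (\<lambda>r. f r * g r) = f q * v g + v f * g q)}"

type_synonym 'm vfield = "'m \<Rightarrow> ('m \<Rightarrow> real) \<Rightarrow> real"

definition smooth_vector_field :: "'m mfd \<Rightarrow> 'm vfield \<Rightarrow> bool" where
  "smooth_vector_field M X \<longleftrightarrow>
     (\<forall>q \<in> points M. X q \<in> tangent_space M q) \<and>
     (\<forall>f. smooth_fun M f \<longrightarrow> smooth_fun M (\<lambda>q. X q f))"

definition coord_vfield :: "'m mfd \<Rightarrow> 'm set \<Rightarrow> ('m \<Rightarrow> nat \<Rightarrow> real) \<Rightarrow> nat \<Rightarrow> 'm vfield" where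
  "coord_vfield M V x j q f = (if smooth_fun M f then partial j (f \<circ> inv_into V x) (x q) else 0)"

definition radial_vfield :: "'m mfd \<Rightarrow> 'm set \<Rightarrow> ('m \<Rightarrow> nat \<Rightarrow> real) \<Rightarrow> 'm vfield" where
  "radial_vfield M V x q f = (\<Sum>j<mdim M. x q j * coord_vfield M V x j q f)"

subsection \<open>Vector bundles\<close>

definition real_vector_space_on ::
  "'e set \<Rightarrow> ('e \<Rightarrow> 'e \<Rightarrow> 'e) \<Rightarrow> (real \<Rightarrow> 'e \<Rightarrow> 'e) \<Rightarrow> 'e \<Rightarrow> bool" where
  "real_vector_space_on S pl sc z \<longleftrightarrow>
     z \<in> S \<and> (\<forall>u\<in>S. \<forall>v\<in>S. pl u v \<in> S) \<and> (\<forall>c. \<forall>u\<in>S. sc c u \<in> S) \<and>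
     (\<forall>u\<in>S. \<forall>v\<in>S. \<forall>w\<in>S. pl (pl u v) w = pl u (pl v w)) \<and>
     (\<forall>u\<in>S. \<forall>v\<in>S. pl u v = pl v u) \<and>
     (\<forall>u\<in>S. pl z u = u) \<and> (\<forall>u\<in>S. \<exists>v\<in>S. pl u v = z) \<and>
     (\<forall>c. \<forall>u\<in>S. \<forall>v\<in>S. sc c (pl u v) = pl (sc c u) (sc c v)) \<and>
     (\<forall>c d. \<forall>u\<in>S. sc (c + d) u = pl (sc c u) (sc d u)) \<and>
     (\<forall>c d. \<forall>u\<in>S. sc c (sc d u) = sc (c * d) u) \<and>
     (\<forall>u\<in>S. sc 1 u = u)"

text \<open>
  \<open>vadd\<close> and \<open>vscale\<close> are the fibrewise operations (meaningful only for vectors in the same fibre);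
  \<open>vzero q\<close> is the zero vector of the fibre over \<open>q\<close>.
\<close>

record ('e, 'm) vbundle =
  total :: "'e mfd"
  proj :: "'e \<Rightarrow> 'm"
  vadd :: "'e \<Rightarrow> 'e \<Rightarrow> 'e"
  vscale :: "real \<Rightarrow> 'e \<Rightarrow> 'e"
  vzero :: "'m \<Rightarrow> 'e"

definition preimage :: "('e, 'm) vbundle \<Rightarrow> 'm set \<Rightarrow> 'e set" where
  "preimage E U = {e \<in> points (total E). proj E e \<in> U}"

abbreviation fibre :: "('e, 'm) vbundle \<Rightarrow> 'm \<Rightarrow> 'e set" where
  "fibre E q \<equiv> preimage E {q}"

text \<open>
  A local trivialization over \<open>U\<close> is given by its second component \<open>\<Phi>\<close>: the trivialization itself
  is \<open>e \<mapsto> (proj e, \<Phi> e)\<close>, so compatibility with the projections is built in.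
\<close>

definition local_trivialization ::
  "'m mfd \<Rightarrow> nat \<Rightarrow> ('e, 'm) vbundle \<Rightarrow> 'm set \<Rightarrow> ('e \<Rightarrow> nat \<Rightarrow> real) \<Rightarrow> bool" where
  "local_trivialization M k E U \<Phi> \<longleftrightarrow>
     openin (mtop M) U \<and>
     diffeomorphism (open_submfd (total E) (preimage E U)) (prod_mfd (open_submfd M U) (euclidean_mfd k))
       (\<lambda>e. (proj E e, \<Phi> e)) \<and>
     (\<forall>q\<in>U. \<forall>e\<in>fibre E q. \<forall>e'\<in>fibre E q. \<Phi> (vadd E e e') = (\<lambda>i. \<Phi> e i + \<Phi> e' i)) \<and>
     (\<forall>q\<in>U. \<forall>c. \<forall>e\<in>fibre E q. \<Phi> (vscale E c e) = (\<lambda>i. c * \<Phi> e i))"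

definition smooth_vector_bundle :: "'m mfd \<Rightarrow> nat \<Rightarrow> ('e, 'm) vbundle \<Rightarrow> bool" where
  "smooth_vector_bundle M k E \<longleftrightarrow>
     smooth_manifold (total E) \<and>
     smooth_map (total E) M (proj E) \<and> proj E ` points (total E) = points M \<and>
     (\<forall>q \<in> points M. real_vector_space_on (fibre E q) (vadd E) (vscale E) (vzero E q)) \<and>
     (\<forall>q \<in> points M. \<exists>U \<Phi>. q \<in> U \<and> local_trivialization M k E U \<Phi>)"

definition smooth_section :: "'m mfd \<Rightarrow> ('e, 'm) vbundle \<Rightarrow> 'm set \<Rightarrow> ('m \<Rightarrow> 'e) \<Rightarrow> bool" where
  "smooth_section M E U s \<longleftrightarrow>
     smooth_map (open_submfd M U) (total E) s \<and> (\<forall>q\<in>U. s q \<in> fibre E q)"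

subsection \<open>Connections\<close>

text \<open>
  A connection maps a global smooth vector field and a global smooth section to a global smooth
  section. The second clause of the definition says that only the values on \<open>M\<close> of the arguments
  matter.
\<close>

definition connection ::
  "'m mfd \<Rightarrow> ('e, 'm) vbundle \<Rightarrow> ('m vfield \<Rightarrow> ('m \<Rightarrow> 'e) \<Rightarrow> 'm \<Rightarrow> 'e) \<Rightarrow> bool" where
  "connection M E D \<longleftrightarrow>
     (let P = points M; vf = smooth_vector_field M; sec = smooth_section M E P in
      (\<forall>X s. vf X \<and> sec s \<longrightarrow> sec (D X s)) \<and>
      (\<forall>X Y s t. vf X \<and> vf Y \<and> sec s \<and> sec t \<and> (\<forall>q\<in>P. X q = Y q \<and> s q = t q) \<longrightarrow>
         (\<forall>q\<in>P. D X s q = D Y t q)) \<and>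
      (\<forall>X Y s. vf X \<and> vf Y \<and> sec s \<longrightarrow>
         (\<forall>q\<in>P. D (\<lambda>r f. X r f + Y r f) s q = vadd E (D X s q) (D Y s q))) \<and>
      (\<forall>h X s. smooth_fun M h \<and> vf X \<and> sec s \<longrightarrow>
         (\<forall>q\<in>P. D (\<lambda>r f. h r * X r f) s q = vscale E (h q) (D X s q))) \<and>
      (\<forall>X s t. vf X \<and> sec s \<and> sec t \<longrightarrow>
         (\<forall>q\<in>P. D X (\<lambda>r. vadd E (s r) (t r)) q = vadd E (D X s q) (D X t q))) \<and>
      (\<forall>c X s. vf X \<and> sec s \<longrightarrow>
         (\<forall>q\<in>P. D X (\<lambda>r. vscale E c (s r)) q = vscale E c (D X s q))) \<and>
      (\<forall>h X s. smooth_fun M h \<and> vf X \<and> sec s \<longrightarrow>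
         (\<forall>q\<in>P. D X (\<lambda>r. vscale E (h r) (s r)) q =
                  vadd E (vscale E (X q h) (s q)) (vscale E (h q) (D X s q)))))"

text \<open>
  The covariant derivative at \<open>q\<close> of a section \<open>s\<close> along a vector field \<open>X\<close>, both defined only on
  the open set \<open>U\<close>: the common value of \<open>D Y t q\<close> for all global \<open>Y\<close> and \<open>t\<close> that agree with \<open>X\<close>
  and \<open>s\<close> near \<open>q\<close>.
\<close>

definition local_covariant_derivative ::
  "'m mfd \<Rightarrow> ('e, 'm) vbundle \<Rightarrow> ('m vfield \<Rightarrow> ('m \<Rightarrow> 'e) \<Rightarrow> 'm \<Rightarrow> 'e) \<Rightarrow>
     'm set \<Rightarrow> 'm vfield \<Rightarrow> ('m \<Rightarrow> 'e) \<Rightarrow> 'm \<Rightarrow> 'e" where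
  "local_covariant_derivative M E D U X s q =
     (THE v. \<exists>Y t W. smooth_vector_field M Y \<and> smooth_section M E (points M) t \<and>
                openin (mtop M) W \<and> q \<in> W \<and> W \<subseteq> U \<and> (\<forall>r\<in>W. Y r = X r \<and> t r = s r) \<and>
                v = D Y t q)"

end

theory Submission
  imports Defs
begin

text \<open>
  In a local frame the equation reads \<open>\<Sum>\<^sub>j x\<^sub>j (\<partial>\<^sub>j f + \<Gamma>\<^sub>j f) = 0\<close>, a linear ordinary differential
  equation along every ray through the origin, singular there. It is equivalent to the integral equation
  \<open>f(x) = f(0) - \<Sum>\<^sub>j x\<^sub>j \<integral>\<^sub>0\<^sup>1 (\<Gamma>\<^sub>j f)(tx) dt\<close>, which is solved by Picard iteration on a small cube. The
  operators \<open>g \<mapsto> \<integral>\<^sub>0\<^sup>1 t\<^sup>s g(tx) dt\<close> preserve smoothness and are exchanged with \<open>\<partial>\<^sub>i\<close> at the price of raising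
  \<open>s\<close>, so the Picard series converges together with all its derivatives, and its sum is smooth at the
  origin as well. Cut-off functions turn the local frame, the coordinate fields and the solution into
  global objects, to which the connection applies, and show that the connection is a local operator.
\<close>

subsection \<open>Calculus on Euclidean n-space\<close>

text \<open>Solving along each ray separately would leave open the smoothness at the origin, where
  all rays meet and the radial field vanishes. The integral form avoids this: the operator
  \<open>T f = - \<Sum>j x_j * mean (\<Gamma>_j f)\<close> maps smooth functions to smooth functions
  across the origin, and the radial operator \<open>\<Sum>i x_i \<partial>_i\<close> sends
  \<open>T f\<close> to \<open>- \<Sum>j x_j \<Gamma>_j f\<close>. The danger is that the cube of
  convergence shrinks as the order of differentiation grows, so that no neighbourhood remains. It
  does not: derivatives of top order keep the factor \<open>x_j\<close>, which provides the
  contraction, and the weights satisfy \<open>t^s \<le> 1\<close>; a derivative that falls on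
  \<open>x_j\<close> or \<open>\<Gamma>_j\<close> leaves only terms of lower order, already known to
  be summable. As the connection acts on global objects only, cutting off happens twice: for the
  frame and the fields before the coefficients \<open>\<Gamma>\<close> can be defined, and for the
  solution and the coordinate functions once the radius of existence is known.\<close>

text \<open>Cubes instead of Euclidean balls: coordinate slices are intervals, scaling by
  \<open>t\<close> in \<open>[0,1]\<close> preserves a cube about the origin, and a bump function is
  a product over the coordinates.\<close>

definition cube :: "nat \<Rightarrow> (nat \<Rightarrow> real) \<Rightarrow> real \<Rightarrow> (nat \<Rightarrow> real) set" where
  "cube n c r = {y. (\<forall>i<n. \<bar>y i - c i\<bar> < r) \<and> (\<forall>i\<ge>n. y i = 0)}"

definition closed_cube :: "nat \<Rightarrow> (nat \<Rightarrow> real) \<Rightarrow> real \<Rightarrow> (nat \<Rightarrow> real) set" where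
  "closed_cube n c r = {y. (\<forall>i<n. \<bar>y i - c i\<bar> \<le> r) \<and> (\<forall>i\<ge>n. y i = 0)}"

lemma Euclidean_space_eq_top_of_set: "Euclidean_space n = top_of_set {x. \<forall>i\<ge>n. x i = 0}"
  by (simp add: Euclidean_space_def euclidean_product_topology)

lemma openin_Euclidean_subset: "openin (Euclidean_space n) V \<Longrightarrow> y \<in> V \<Longrightarrow> i \<ge> n \<Longrightarrow> y i = 0"
  using openin_subset topspace_Euclidean_space by fastforce

lemma subtopology_Euclidean_space:
  assumes "V \<subseteq> topspace (Euclidean_space n)"
  shows "subtopology (Euclidean_space n) V = top_of_set V"
proof -
  have "{x. \<forall>i\<ge>n. x i = 0} \<inter> V = V"
    using assms by (auto simp: topspace_Euclidean_space)
  then show ?thesis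
    by (simp add: Euclidean_space_eq_top_of_set subtopology_subtopology)
qed

lemma continuous_map_Euclidean_subset:
  assumes "openin (Euclidean_space n) V"
  shows "continuous_map (subtopology (Euclidean_space n) V) euclideanreal f \<longleftrightarrow> continuous_on V f"
  using subtopology_Euclidean_space[OF openin_subset[OF assms]] by simp

lemma continuous_on_coordinate: "continuous_on S (\<lambda>y. y i :: real)"
  by (rule continuous_on_subset[OF continuous_on_product_coordinates]) simp

lemma openin_cube: "openin (Euclidean_space n) (cube n c r)"
proof -
  have "open (\<Inter>i\<in>{..<n}. {y. \<bar>y i - c i\<bar> < r})"
    by (intro open_INT ballI finite_lessThan open_Collect_less continuous_intros
        continuous_on_coordinate)
  moreover have "cube n c r = {x. \<forall>i\<ge>n. x i = 0} \<inter> (\<Inter>i\<in>{..<n}. {y. \<bar>y i - c i\<bar> < r})"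
    by (auto simp: cube_def)
  ultimately show ?thesis
    by (simp add: Euclidean_space_eq_top_of_set openin_open_Int)
qed

text \<open>In the product topology a basic neighbourhood prescribes an open set in each coordinate.
  A common radius is taken over the \<open>n\<close> coordinates that can vary; from index
  \<open>n\<close> on all points of n-space agree with \<open>c\<close>.\<close>

lemma openin_imp_cube_subset:
  assumes "openin (Euclidean_space n) V" "c \<in> V"
  obtains e where "e > 0" "cube n c e \<subseteq> V"
proof -
  obtain T where T: "open T" "V = {x. \<forall>i\<ge>n. x i = 0} \<inter> T"
    using assms(1) by (auto simp: Euclidean_space_eq_top_of_set openin_open)
  have "openin (product_topology (\<lambda>i. euclidean) UNIV) T"
    using T(1) by (simp add: euclidean_product_topology)
  moreover have "c \<in> T" using assms(2) T(2) by blast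
  ultimately have "\<exists>U. (\<forall>i\<in>UNIV. openin euclidean (U i)) \<and> c \<in> Pi\<^sub>E UNIV U \<and> Pi\<^sub>E UNIV U \<subseteq> T"
    using iffD1[OF openin_product_topology_alt] by fast
  then obtain U where U: "c \<in> Pi\<^sub>E UNIV U" "\<And>i. open (U i)" "Pi\<^sub>E UNIV U \<subseteq> T"
    by auto
  have "\<exists>d>0. ball (c i) d \<subseteq> U i" for i
    using U(1,2) by (metis PiE_mem UNIV_I openE)
  then obtain d where d: "\<And>i. d i > 0" "\<And>i. ball (c i) (d i) \<subseteq> U i"
    by metis
  \<comment> \<open>The extra element \<open>1\<close> keeps the set nonempty when
    \<open>n = 0\<close>.\<close>
  define e where "e = Min (insert 1 (d ` {..<n}))"
  have "e > 0" "\<And>i. i < n \<Longrightarrow> e \<le> d i"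
    using d(1) by (auto simp: e_def)
  moreover have "cube n c e \<subseteq> V"
  proof
    fix y assume y: "y \<in> cube n c e"
    have c0: "\<forall>i\<ge>n. c i = 0" using assms(2) T(2) by auto
    have "y i \<in> U i" for i
    proof (cases "i < n")
      case True
      then have "\<bar>y i - c i\<bar> < d i"
        using y \<open>\<And>i. i < n \<Longrightarrow> e \<le> d i\<close>[of i] by (force simp: cube_def)
      then show ?thesis
        using d(2)[of i] by (auto simp: dist_real_def abs_minus_commute subset_iff)
    next
      case False
      then have "y i = c i" using y c0 by (auto simp: cube_def)
      then show ?thesis using U(1) by auto
    qed
    then have "y \<in> T" using U(3) by auto
    then show "y \<in> V" using T(2) y by (auto simp: cube_def)
  qed
  ultimately show ?thesis using that by blast
qed

lemma cube_mono: "r \<le> s \<Longrightarrow> cube n c r \<subseteq> cube n c s"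
  by (force simp: cube_def)

lemma closed_cube_subset_cube: "r < s \<Longrightarrow> closed_cube n c r \<subseteq> cube n c s"
  by (force simp: cube_def closed_cube_def)

lemma cube_subset_closed_cube: "cube n c r \<subseteq> closed_cube n c r"
  by (force simp: cube_def closed_cube_def)

text \<open>A product of intervals and of singletons \<open>{0}\<close>, compact by
  Tychonoff.\<close>

lemma compact_closed_cube: "compact (closed_cube n c r)"
proof -
  have eq: "closed_cube n c r = Pi\<^sub>E UNIV (\<lambda>i. if i < n then {c i - r..c i + r} else {0})"
    (is "_ = Pi\<^sub>E UNIV ?S")
  proof -
    have "y \<in> closed_cube n c r \<longleftrightarrow> (\<forall>i. y i \<in> ?S i)" for y
      unfolding closed_cube_def mem_Collect_eq
      by (smt (verit) atLeastAtMost_iff insert_iff empty_iff leI not_le)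
    then show ?thesis by (auto simp: PiE_iff)
  qed
  have "compactin (product_topology (\<lambda>i. euclidean) UNIV) (closed_cube n c r)"
    unfolding eq compactin_PiE by auto
  then show ?thesis
    by (simp add: euclidean_product_topology)
qed

section \<open>Partial derivatives along slices and functions of class C^k\<close>

lemma has_partial_iff_DERIV:
  "has_partial i f x \<longleftrightarrow> ((\<lambda>t. f (x(i := t))) has_real_derivative partial i f x) (at (x i))"
  unfolding has_partial_def partial_def
  by (metis DERIV_imp_deriv real_differentiable_def)

lemma DERIV_imp_partial:
  assumes "((\<lambda>t. f (x(i := t))) has_real_derivative d) (at (x i))"
  shows "has_partial i f x" "partial i f x = d"
  using assms DERIV_imp_deriv by (auto simp: has_partial_def partial_def real_differentiable_def)

lemma cube_upd:
  assumes "x \<in> cube n c r" "i < n" "\<bar>t - c i\<bar> < r"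
  shows "x(i := t) \<in> cube n c r"
  using assms by (auto simp: cube_def)

lemma slice_open:
  assumes "openin (Euclidean_space n) V" "x \<in> V" "i < n"
  obtains d where "d > 0" "\<And>t. \<bar>t - x i\<bar> < d \<Longrightarrow> x(i := t) \<in> V"
proof -
  obtain e where e: "e > 0" "cube n x e \<subseteq> V"
    using openin_imp_cube_subset[OF assms(1,2)] .
  have x0: "\<forall>i\<ge>n. x i = 0"
    using assms openin_Euclidean_subset by blast
  have "x(i := t) \<in> V" if "\<bar>t - x i\<bar> < e" for t
  proof -
    have "x(i := t) \<in> cube n x e" using that assms(3) x0 e(1) by (auto simp: cube_def)
    then show ?thesis using e(2) by blast
  qed
  then show ?thesis using that e(1) by blast
qed

text \<open>A point of an open set can be moved a little in each coordinate direction without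
  leaving it. This frees the rules below from the arbitrary values that functions take outside
  \<open>V\<close>.\<close>

lemma DERIV_slice_cong:
  assumes "openin (Euclidean_space n) V" "x \<in> V" "i < n" "\<And>y. y \<in> V \<Longrightarrow> f y = g y"
  shows "((\<lambda>t. f (x(i := t))) has_real_derivative d) (at (x i)) \<longleftrightarrow>
         ((\<lambda>t. g (x(i := t))) has_real_derivative d) (at (x i))"
proof -
  obtain e where e: "e > 0" "\<And>t. \<bar>t - x i\<bar> < e \<Longrightarrow> x(i := t) \<in> V"
    using slice_open[OF assms(1-3)] by blast
  have "\<forall>\<^sub>F t in nhds (x i). f (x(i := t)) = g (x(i := t))"
    unfolding eventually_nhds_metric
    by (rule exI[of _ e]) (use e assms(4) in \<open>auto simp: dist_real_def\<close>)
  then show ?thesis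
    by (intro DERIV_cong_ev) auto
qed

lemma partial_cong:
  assumes "openin (Euclidean_space n) V" "x \<in> V" "i < n" "\<And>y. y \<in> V \<Longrightarrow> f y = g y"
  shows "partial i f x = partial i g x"
  unfolding partial_def deriv_def using DERIV_slice_cong[of n V x i f g] assms by simp

lemma has_partial_cong:
  assumes "openin (Euclidean_space n) V" "x \<in> V" "i < n" "\<And>y. y \<in> V \<Longrightarrow> f y = g y"
  shows "has_partial i f x \<longleftrightarrow> has_partial i g x"
  unfolding has_partial_def real_differentiable_def using DERIV_slice_cong[of n V x i f g] assms by simp

lemma Ck_on_imp_continuous_on:
  "openin (Euclidean_space n) V \<Longrightarrow> Ck_on n k V f \<Longrightarrow> continuous_on V f"
  by (cases k) (simp_all add: continuous_map_Euclidean_subset)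

lemma Ck_on_cong_imp:
  assumes "openin (Euclidean_space n) V" "\<And>y. y \<in> V \<Longrightarrow> f y = g y" "Ck_on n k V f"
  shows "Ck_on n k V g"
  using assms(2,3)
proof (induction k arbitrary: f g)
  case 0
  then show ?case
    by (metis Ck_on.simps(1) assms(1) continuous_map_Euclidean_subset continuous_on_cong)
next
  case (Suc k)
  have "continuous_on V g"
    using Suc.prems by (metis Ck_on_imp_continuous_on assms(1) continuous_on_cong)
  moreover have "has_partial i g y" if "i < n" "y \<in> V" for i y
    using Suc.prems has_partial_cong[OF assms(1) that(2,1)] that by (metis Ck_on.simps(2))
  moreover have "Ck_on n k V (partial i g)" if "i < n" for i
    using Suc.IH[of "partial i f"] partial_cong[OF assms(1) _ that, of _ f g] Suc.prems that by simp
  ultimately show ?case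
    by (simp add: continuous_map_Euclidean_subset assms(1))
qed

text \<open>Lets the derivatives be given by a formula \<open>g i\<close> that is correct on
  \<open>V\<close> only; \<open>Ck_on\<close> itself asks for \<open>partial i f\<close>, which may
  differ elsewhere.\<close>

lemma Ck_on_SucI:
  assumes "openin (Euclidean_space n) V" "continuous_on V f"
    and "\<And>i y. i < n \<Longrightarrow> y \<in> V \<Longrightarrow> ((\<lambda>t. f (y(i := t))) has_real_derivative g i y) (at (y i))"
    and "\<And>i. i < n \<Longrightarrow> Ck_on n k V (g i)"
  shows "Ck_on n (Suc k) V f"
proof -
  have "has_partial i f y" "partial i f y = g i y" if "i < n" "y \<in> V" for i y
    using DERIV_imp_partial[OF assms(3)[OF that]] by auto
  moreover from this have "Ck_on n k V (partial i f)" if "i < n" for i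
    using Ck_on_cong_imp[OF assms(1) _ assms(4)[OF that]] that by simp
  ultimately show ?thesis
    using assms(2) by (simp add: continuous_map_Euclidean_subset assms(1))
qed

lemma Ck_on_SucD:
  assumes "openin (Euclidean_space n) V" "Ck_on n (Suc k) V f"
  shows "continuous_on V f"
    and "\<And>i y. i < n \<Longrightarrow> y \<in> V \<Longrightarrow>
           ((\<lambda>t. f (y(i := t))) has_real_derivative partial i f y) (at (y i))"
    and "\<And>i. i < n \<Longrightarrow> Ck_on n k V (partial i f)"
  using assms by (auto simp: continuous_map_Euclidean_subset has_partial_iff_DERIV)

lemma Ck_on_Suc_imp: "Ck_on n (Suc k) V f \<Longrightarrow> Ck_on n k V f"
  by (induction k arbitrary: f) auto

lemma Ck_on_subset: "W \<subseteq> V \<Longrightarrow> Ck_on n k V f \<Longrightarrow> Ck_on n k W f"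
  by (induction k arbitrary: f) (auto intro: continuous_map_from_subtopology_mono)

text \<open>Derivatives are local by definition, and for continuity the filter at \<open>y\<close>
  within \<open>V\<close> coincides with that within \<open>V \<inter> W\<close>. The rule allows a
  different chart to be used near each point.\<close>

lemma Ck_on_local:
  assumes "openin (Euclidean_space n) V"
    and "\<And>y. y \<in> V \<Longrightarrow> \<exists>W. openin (Euclidean_space n) W \<and> y \<in> W \<and> Ck_on n k (V \<inter> W) f"
  shows "Ck_on n k V f"
  using assms(2)
proof (induction k arbitrary: f)
  case (0 f)
  have "continuous_on V f"
    unfolding continuous_on_eq_continuous_within
  proof
    fix y assume y: "y \<in> V"
    obtain W where W: "openin (Euclidean_space n) W" "y \<in> W" "Ck_on n 0 (V \<inter> W) f"
      using 0[OF y] by blast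
    have VW: "openin (Euclidean_space n) (V \<inter> W)" using assms(1) W(1) by blast
    then have "continuous_on (V \<inter> W) f" using W(3) by (simp add: continuous_map_Euclidean_subset)
    then have "continuous (at y within (V \<inter> W)) f"
      using y W(2) by (simp add: continuous_on_eq_continuous_within)
    moreover obtain T where "open T" "V \<inter> W = {x. \<forall>i\<ge>n. x i = 0} \<inter> T"
      using VW by (auto simp: Euclidean_space_eq_top_of_set openin_open)
    then have "V \<inter> T = V \<inter> W" "y \<in> T"
      using y W(2) openin_Euclidean_subset[OF assms(1)] by auto
    then have "at y within V = at y within (V \<inter> W)"
      using \<open>open T\<close> by (intro at_within_nhd[of y T]) auto
    ultimately show "continuous (at y within V) f" by simp
  qed
  then show ?case by (simp add: continuous_map_Euclidean_subset assms(1))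
next
  case (Suc k f)
  have op: "openin (Euclidean_space n) (V \<inter> W)" if "openin (Euclidean_space n) W" for W
    using assms(1) that by blast
  have "Ck_on n k V f"
  proof (rule Suc.IH)
    show "\<exists>W. openin (Euclidean_space n) W \<and> y \<in> W \<and> Ck_on n k (V \<inter> W) f" if "y \<in> V" for y
      using Suc.prems[OF that] Ck_on_Suc_imp by metis
  qed
  then have "continuous_on V f"
    using assms(1) Ck_on_imp_continuous_on by blast
  moreover have "((\<lambda>t. f (y(i := t))) has_real_derivative partial i f y) (at (y i))"
    if "i < n" "y \<in> V" for i y
  proof -
    obtain W where W: "openin (Euclidean_space n) W" "y \<in> W" "Ck_on n (Suc k) (V \<inter> W) f"
      using Suc.prems[OF \<open>y \<in> V\<close>] by blast
    show ?thesis
      using Ck_on_SucD(2)[OF op[OF W(1)] W(3) \<open>i < n\<close>] W(2) that(2) by simp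
  qed
  moreover have "Ck_on n k V (partial i f)" if "i < n" for i
  proof (rule Suc.IH)
    show "\<exists>W. openin (Euclidean_space n) W \<and> y \<in> W \<and> Ck_on n k (V \<inter> W) (partial i f)"
      if "y \<in> V" for y
      using Suc.prems[OF that] Ck_on_SucD(3)[OF op _ \<open>i < n\<close>] by metis
  qed
  ultimately show ?case
    by (rule Ck_on_SucI[OF assms(1)])
qed

lemma Ck_on_const: "openin (Euclidean_space n) V \<Longrightarrow> Ck_on n k V (\<lambda>x. c)"
proof (induction k arbitrary: c)
  case (Suc k)
  then show ?case
    by (intro Ck_on_SucI[where g="\<lambda>i x. 0"]) (auto intro!: derivative_eq_intros)
qed auto

lemma Ck_on_coordinate: "openin (Euclidean_space n) V \<Longrightarrow> Ck_on n k V (\<lambda>x. x j)"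
proof (cases k)
  case 0
  assume "openin (Euclidean_space n) V"
  then show ?thesis using 0 by (simp add: continuous_map_Euclidean_subset continuous_on_coordinate)
next
  case (Suc l)
  assume V: "openin (Euclidean_space n) V"
  show ?thesis unfolding Suc
  proof (rule Ck_on_SucI[where g="\<lambda>i x. if i = j then 1 else 0"])
    show "((\<lambda>t. (y(i := t)) j) has_real_derivative (if i = j then 1 else 0)) (at (y i))" for i y
      by (cases "i = j") (auto intro!: derivative_eq_intros)
  qed (auto intro: Ck_on_const continuous_on_coordinate V)
qed

lemma Ck_on_add:
  assumes "openin (Euclidean_space n) V" "Ck_on n k V f" "Ck_on n k V g"
  shows "Ck_on n k V (\<lambda>x. f x + g x)"
  using assms(2,3)
proof (induction k arbitrary: f g)
  case 0
  then show ?case by (auto simp: continuous_map_Euclidean_subset assms(1) intro: continuous_on_add)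
next
  case (Suc k)
  note f = Ck_on_SucD[OF assms(1) Suc.prems(1)] and g = Ck_on_SucD[OF assms(1) Suc.prems(2)]
  show ?case
    by (intro Ck_on_SucI[OF assms(1), where g="\<lambda>i x. partial i f x + partial i g x"]
      Suc.IH f g continuous_on_add DERIV_add)
qed

lemma Ck_on_mult:
  assumes "openin (Euclidean_space n) V" "Ck_on n k V f" "Ck_on n k V g"
  shows "Ck_on n k V (\<lambda>x. f x * g x)"
  using assms(2,3)
proof (induction k arbitrary: f g)
  case 0
  then show ?case by (auto simp: continuous_map_Euclidean_subset assms(1) intro: continuous_on_mult)
next
  case (Suc k)
  note f = Ck_on_SucD[OF assms(1) Suc.prems(1)] and g = Ck_on_SucD[OF assms(1) Suc.prems(2)]
  have "((\<lambda>t. f (y(i := t)) * g (y(i := t))) has_real_derivative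
          partial i f y * g y + f y * partial i g y) (at (y i))" if "i < n" "y \<in> V" for i y
    by (rule DERIV_cong[OF DERIV_mult[OF f(2)[OF that] g(2)[OF that]]]) (simp add: algebra_simps)
  then show ?case
    by (intro Ck_on_SucI[OF assms(1), where g="\<lambda>i x. partial i f x * g x + f x * partial i g x"]
        Ck_on_add assms(1) Suc.IH f g continuous_on_mult Suc.prems[THEN Ck_on_Suc_imp])
qed

text \<open>The derivative is a product of \<open>partial i f\<close> with factors
  \<open>inverse (f x)\<close>, and these are covered by the induction hypothesis.\<close>

lemma Ck_on_inverse:
  assumes "openin (Euclidean_space n) V" "\<And>y. y \<in> V \<Longrightarrow> f y \<noteq> 0" "Ck_on n k V f"
  shows "Ck_on n k V (\<lambda>x. inverse (f x))"
  using assms(3)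
proof (induction k)
  case 0
  then show ?case using assms(2)
    by (auto simp: continuous_map_Euclidean_subset assms(1) intro: continuous_on_inverse)
next
  case (Suc k)
  note f = Ck_on_SucD[OF assms(1) Suc.prems(1)]
  have "((\<lambda>t. inverse (f (y(i := t)))) has_real_derivative
          - 1 * (partial i f y * (inverse (f y) * inverse (f y)))) (at (y i))" if "i < n" "y \<in> V" for i y
    by (rule DERIV_cong[OF DERIV_inverse_fun[OF f(2)[OF that]]])
      (use assms(2)[OF that(2)] in \<open>simp_all add: algebra_simps power2_eq_square\<close>)
  then show ?case
    by (intro Ck_on_SucI[OF assms(1),
          where g="\<lambda>i x. - 1 * (partial i f x * (inverse (f x) * inverse (f x)))"]
        Ck_on_mult Ck_on_const assms(1) Suc.IH f continuous_on_inverse Suc.prems[THEN Ck_on_Suc_imp])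
      (use assms(2) in blast)+
qed

lemma Ck_on_sum:
  assumes "openin (Euclidean_space n) V" "\<And>a. a \<in> A \<Longrightarrow> Ck_on n k V (f a)"
  shows "Ck_on n k V (\<lambda>x. \<Sum>a\<in>A. f a x)"
  using assms(2)
  by (induction A rule: infinite_finite_induct) (auto intro: Ck_on_const Ck_on_add assms(1))

section \<open>The chain rule\<close>

text \<open>With the intermediate point located by its distance from \<open>a\<close>, the order of
  \<open>a\<close> and \<open>b\<close> is immaterial, and the point stays in any interval centred
  at \<open>a\<close> that contains \<open>b\<close>.\<close>

lemma mvt_abs:
  fixes g :: "real \<Rightarrow> real"
  assumes "\<And>s. \<bar>s - a\<bar> \<le> \<bar>b - a\<bar> \<Longrightarrow> (g has_real_derivative g' s) (at s)"
  shows "\<exists>s. \<bar>s - a\<bar> \<le> \<bar>b - a\<bar> \<and> g b - g a = g' s * (b - a)"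
proof (cases a b rule: linorder_cases)
  case less
  then obtain z where "a < z" "z < b" "g b - g a = (b - a) * g' z"
    using MVT2[of a b g g'] assms by auto
  then show ?thesis by (intro exI[of _ z]) (auto simp: algebra_simps)
next
  case greater
  then obtain z where "b < z" "z < a" "g a - g b = (a - b) * g' z"
    using MVT2[of b a g g'] assms by auto
  then show ?thesis by (intro exI[of _ z]) (auto simp: algebra_simps)
qed auto

text \<open>Continuity of the partial derivatives replaces total differentiability: the increment of
  \<open>f\<close> along the curve is split into \<open>m\<close> increments in a single coordinate
  each, and the mean value theorem turns each of them into a value of one partial derivative near
  \<open>\<gamma> t0\<close>.\<close>

lemma DERIV_chain_partial:
  assumes V: "openin (Euclidean_space m) V"
    and f: "\<And>j y. j < m \<Longrightarrow> y \<in> V \<Longrightarrow> has_partial j f y"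
           "\<And>j. j < m \<Longrightarrow> continuous_on V (partial j f)"
    and \<gamma>: "\<gamma> t0 \<in> V" "\<And>t i. i \<ge> m \<Longrightarrow> \<gamma> t i = 0"
           "\<And>j. j < m \<Longrightarrow> ((\<lambda>t. \<gamma> t j) has_real_derivative \<gamma>' j) (at t0)"
  shows "((\<lambda>t. f (\<gamma> t)) has_real_derivative (\<Sum>j<m. partial j f (\<gamma> t0) * \<gamma>' j)) (at t0)"
proof -
  define c where "c = \<gamma> t0"
  \<comment> \<open>Interpolates between the base point and the curve: the first \<open>l\<close>
    coordinates have moved, the others are still at \<open>c\<close>.\<close>
  define z where "z l t = (\<lambda>i. if i < l then \<gamma> t i else c i)" for l t
  \<comment> \<open>The difference quotient in coordinate \<open>l\<close>, filled in by the
    derivative where the quotient would be \<open>0 / 0\<close>.\<close>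
  define \<phi> where "\<phi> l t = (if \<gamma> t l = c l then partial l f c
      else (f (z (Suc l) t) - f (z l t)) / (\<gamma> t l - c l))" for l t
  have z0: "z 0 t = c" for t by (simp add: z_def)
  have zm: "z m t = \<gamma> t" for t
    using \<gamma>(2) by (auto simp: z_def c_def fun_eq_iff)
  have upd1: "(z l t)(l := \<gamma> t l) = z (Suc l) t" and upd2: "(z l t)(l := c l) = z l t" for l t
    by (auto simp: z_def fun_eq_iff)
  have \<phi>: "f (z (Suc l) t) - f (z l t) = \<phi> l t * (\<gamma> t l - c l)" for l t
  proof (cases "\<gamma> t l = c l")
    case True
    then have "z (Suc l) t = z l t" using upd1[of l t] upd2[of l t] by simp
    then show ?thesis using True by simp
  qed (simp add: \<phi>_def)
  have tel: "f (\<gamma> t) - f c = (\<Sum>l<m. \<phi> l t * (\<gamma> t l - c l))" for t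
    using sum_lessThan_telescope[of "\<lambda>l. f (z l t)" m] by (simp add: z0 zm \<phi>)
  have lim\<phi>: "((\<phi> l) \<longlongrightarrow> partial l f c) (at t0)" if l: "l < m" for l
  proof (rule tendstoI)
    fix e :: real assume "e > 0"
    \<comment> \<open>By continuity \<open>partial l f\<close> stays within \<open>e\<close> of its
      value at \<open>c\<close> on a whole cube about \<open>c\<close>; the cube will contain every
      intermediate point.\<close>
    have "openin (top_of_set V) {y \<in> V. partial l f y \<in> ball (partial l f c) e}"
      using continuous_openin_preimage_gen[OF f(2)[OF l], of "ball (partial l f c) e"]
      by (simp add: vimage_def Int_def)
    then have "openin (Euclidean_space m) {y \<in> V. partial l f y \<in> ball (partial l f c) e}"
      using openin_trans_full[OF _ V] subtopology_Euclidean_space[OF openin_subset[OF V]] by simp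
    then obtain d where d: "d > 0" "cube m c d \<subseteq> {y \<in> V. partial l f y \<in> ball (partial l f c) e}"
    proof (rule openin_imp_cube_subset)
      show "c \<in> {y \<in> V. partial l f y \<in> ball (partial l f c) e}"
        using \<gamma>(1) \<open>e > 0\<close> by (simp add: c_def)
    qed
    have "((\<lambda>t. \<gamma> t j) \<longlongrightarrow> c j) (at t0)" if "j < m" for j
      using DERIV_isCont[OF \<gamma>(3)[OF that]] by (simp add: c_def isCont_def)
    then have "\<forall>\<^sub>F t in at t0. dist (\<gamma> t j) (c j) < d" if "j < m" for j
      using that d(1) tendstoD by blast
    then have "\<forall>\<^sub>F t in at t0. \<forall>j\<in>{..<m}. \<bar>\<gamma> t j - c j\<bar> < d"
      by (intro eventually_ball_finite) (auto simp: dist_real_def)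
    then show "\<forall>\<^sub>F t in at t0. dist (\<phi> l t) (partial l f c) < e"
    proof eventually_elim
      case (elim t)
      have in_cube: "(z l t)(l := s) \<in> cube m c d" if "\<bar>s - c l\<bar> \<le> \<bar>\<gamma> t l - c l\<bar>" for s
      proof -
        have "\<forall>i\<ge>m. c i = 0" using openin_Euclidean_subset[OF V \<gamma>(1)] by (simp add: c_def)
        moreover have "\<bar>s - c l\<bar> < d" using that elim l by force
        ultimately show ?thesis using elim l d(1) by (auto simp: cube_def z_def)
      qed
      have "\<exists>s. \<bar>s - c l\<bar> \<le> \<bar>\<gamma> t l - c l\<bar> \<and> f ((z l t)(l := \<gamma> t l)) - f ((z l t)(l := c l)) =
          partial l f ((z l t)(l := s)) * (\<gamma> t l - c l)"
      proof (rule mvt_abs)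
        fix s assume "\<bar>s - c l\<bar> \<le> \<bar>\<gamma> t l - c l\<bar>"
        then have "(z l t)(l := s) \<in> V" using in_cube d(2) by blast
        then show "((\<lambda>s. f ((z l t)(l := s))) has_real_derivative partial l f ((z l t)(l := s))) (at s)"
          using f(1)[OF l] unfolding has_partial_iff_DERIV by fastforce
      qed
      then obtain s where s: "\<bar>s - c l\<bar> \<le> \<bar>\<gamma> t l - c l\<bar>"
        "f (z (Suc l) t) - f (z l t) = partial l f ((z l t)(l := s)) * (\<gamma> t l - c l)"
        by (auto simp: upd1 upd2)
      show ?case
      proof (cases "\<gamma> t l = c l")
        case False
        then have "\<phi> l t = partial l f ((z l t)(l := s))"
          using s(2) by (simp add: \<phi>_def)
        then show ?thesis using in_cube[OF s(1)] d(2) by (auto simp: dist_commute)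
      qed (simp add: \<phi>_def \<open>e > 0\<close>)
    qed
  qed
  have "((\<lambda>t. \<Sum>l<m. \<phi> l t * ((\<gamma> t l - \<gamma> t0 l) / (t - t0))) \<longlongrightarrow>
          (\<Sum>l<m. partial l f c * \<gamma>' l)) (at t0)"
    using \<gamma>(3) by (intro tendsto_sum tendsto_mult lim\<phi>) (auto simp: has_field_derivative_iff)
  then show ?thesis
    unfolding has_field_derivative_iff c_def[symmetric] tel sum_divide_distrib
    by (simp add: c_def)
qed

text \<open>By the chain rule the derivatives are sums of products of \<open>partial j f\<close>
  after \<open>g\<close> with derivatives of the components of \<open>g\<close>. So the induction
  keeps \<open>g\<close> fixed and ranges over all \<open>f\<close>.\<close>

lemma Ck_on_compose:
  assumes V: "openin (Euclidean_space m) V" and W: "openin (Euclidean_space n) W"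
    and "Ck_on m k V f" "\<And>j. j < m \<Longrightarrow> Ck_on n k W (\<lambda>x. g x j)" "\<And>x. x \<in> W \<Longrightarrow> g x \<in> V"
    and g0: "\<And>x j. j \<ge> m \<Longrightarrow> g x j = 0"
  shows "Ck_on n k W (\<lambda>x. f (g x))"
  using assms(3,4)
proof (induction k arbitrary: f)
  case (0 f)
  have "continuous_on W g"
  proof (rule continuous_on_coordinatewise_then_product)
    show "continuous_on W (\<lambda>x. g x j)" for j
    proof (cases "j < m")
      case True
      then show ?thesis using 0(2) by (simp add: W continuous_map_Euclidean_subset)
    next
      case False
      then show ?thesis using g0 by simp
    qed
  qed
  moreover have "continuous_on V f" using 0 by (simp add: V continuous_map_Euclidean_subset)
  ultimately have "continuous_on W (\<lambda>x. f (g x))"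
    using continuous_on_compose2[of V f W g] assms(5) by blast
  then show ?case by (simp add: W continuous_map_Euclidean_subset)
next
  case (Suc k f)
  note f = Ck_on_SucD[OF V Suc.prems(1)]
  note g = Ck_on_SucD[OF W Suc.prems(2)]
  have g': "Ck_on n k W (\<lambda>x. g x j)" if "j < m" for j
    using Ck_on_Suc_imp Suc.prems(2) that by blast
  show ?case
  proof (rule Ck_on_SucI[OF W])
    show "continuous_on W (\<lambda>x. f (g x))"
      using Ck_on_imp_continuous_on[OF W] Suc.IH[OF _ g'] Ck_on_Suc_imp[OF Suc.prems(1)] by blast
    show "((\<lambda>t. f (g (y(i := t)))) has_real_derivative
        (\<Sum>j<m. partial j f (g y) * partial i (\<lambda>x. g x j) y)) (at (y i))"
      if "i < n" "y \<in> W" for i y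
    proof -
      have "((\<lambda>t. f (g (y(i := t)))) has_real_derivative
        (\<Sum>j<m. partial j f (g (y(i := y i))) * partial i (\<lambda>x. g x j) y)) (at (y i))"
      proof (rule DERIV_chain_partial[OF V])
        show "((\<lambda>t. g (y(i := t)) j) has_real_derivative partial i (\<lambda>x. g x j) y) (at (y i))"
          if "j < m" for j
          using g(2)[OF that \<open>i < n\<close> \<open>y \<in> W\<close>] .
        show "has_partial j f y" if "j < m" "y \<in> V" for j y
          unfolding has_partial_iff_DERIV using f(2)[OF that] .
        show "continuous_on V (partial j f)" if "j < m" for j
          using Ck_on_imp_continuous_on[OF V f(3)[OF that]] .
      qed (use that assms(5) g0 in auto)
      then show ?thesis by simp
    qed
    show "Ck_on n k W (\<lambda>x. \<Sum>j<m. partial j f (g x) * partial i (\<lambda>x. g x j) x)" if "i < n" for i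
    proof (rule Ck_on_sum[OF W])
      fix j assume "j \<in> {..<m}"
      then have "j < m" by simp
      show "Ck_on n k W (\<lambda>x. partial j f (g x) * partial i (\<lambda>x. g x j) x)"
        by (rule Ck_on_mult[OF W Suc.IH[OF f(3)[OF \<open>j < m\<close>] g'] g(3)[OF \<open>j < m\<close> that]])
    qed
  qed
qed

section \<open>Smooth functions on open subsets of n-space\<close>

lemma smooth_imp_continuous_on:
  "openin (Euclidean_space n) V \<Longrightarrow> smooth_real_on n V f \<Longrightarrow> continuous_on V f"
  by (meson Ck_on_imp_continuous_on smooth_real_on_def)

lemma smooth_imp_DERIV:
  "openin (Euclidean_space n) V \<Longrightarrow> smooth_real_on n V f \<Longrightarrow> i < n \<Longrightarrow> y \<in> V \<Longrightarrow>
     ((\<lambda>t. f (y(i := t))) has_real_derivative partial i f y) (at (y i))"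
  using Ck_on_SucD(2)[of n V 0 f i y] unfolding smooth_real_on_def by blast

lemma smooth_real_on_partial: "smooth_real_on n V f \<Longrightarrow> i < n \<Longrightarrow> smooth_real_on n V (partial i f)"
  unfolding smooth_real_on_def by (metis Ck_on.simps(2))

lemma smooth_real_on_cong_imp:
  "openin (Euclidean_space n) V \<Longrightarrow> (\<And>y. y \<in> V \<Longrightarrow> f y = g y) \<Longrightarrow> smooth_real_on n V f \<Longrightarrow>
     smooth_real_on n V g"
  unfolding smooth_real_on_def using Ck_on_cong_imp by blast

lemma smooth_real_on_subset: "W \<subseteq> V \<Longrightarrow> smooth_real_on n V f \<Longrightarrow> smooth_real_on n W f"
  unfolding smooth_real_on_def using Ck_on_subset by blast

lemma smooth_real_on_local:
  assumes "openin (Euclidean_space n) V"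
    and "\<And>y. y \<in> V \<Longrightarrow> \<exists>W. openin (Euclidean_space n) W \<and> y \<in> W \<and> smooth_real_on n (V \<inter> W) f"
  shows "smooth_real_on n V f"
  unfolding smooth_real_on_def
proof
  fix k show "Ck_on n k V f"
  proof (rule Ck_on_local[OF assms(1)])
    show "\<exists>W. openin (Euclidean_space n) W \<and> y \<in> W \<and> Ck_on n k (V \<inter> W) f" if "y \<in> V" for y
      using assms(2)[OF that] unfolding smooth_real_on_def by blast
  qed
qed

lemma smooth_real_on_const: "openin (Euclidean_space n) V \<Longrightarrow> smooth_real_on n V (\<lambda>x. c)"
  and smooth_real_on_coordinate: "openin (Euclidean_space n) V \<Longrightarrow> smooth_real_on n V (\<lambda>x. x j)"
  by (simp_all add: smooth_real_on_def Ck_on_const Ck_on_coordinate)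

lemma smooth_real_on_add: "openin (Euclidean_space n) V \<Longrightarrow> smooth_real_on n V f \<Longrightarrow>
      smooth_real_on n V g \<Longrightarrow> smooth_real_on n V (\<lambda>x. f x + g x)"
  and smooth_real_on_mult: "openin (Euclidean_space n) V \<Longrightarrow> smooth_real_on n V f \<Longrightarrow>
      smooth_real_on n V g \<Longrightarrow> smooth_real_on n V (\<lambda>x. f x * g x)"
  by (simp_all add: smooth_real_on_def Ck_on_add Ck_on_mult)

lemma smooth_real_on_inverse: "openin (Euclidean_space n) V \<Longrightarrow> (\<And>y. y \<in> V \<Longrightarrow> f y \<noteq> 0) \<Longrightarrow>
    smooth_real_on n V f \<Longrightarrow> smooth_real_on n V (\<lambda>x. inverse (f x))"
  by (simp add: smooth_real_on_def Ck_on_inverse)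

lemma smooth_real_on_sum: "openin (Euclidean_space n) V \<Longrightarrow> (\<And>a. a \<in> A \<Longrightarrow> smooth_real_on n V (f a)) \<Longrightarrow>
    smooth_real_on n V (\<lambda>x. \<Sum>a\<in>A. f a x)"
  by (simp add: smooth_real_on_def Ck_on_sum)

lemma smooth_real_on_prod: "openin (Euclidean_space n) V \<Longrightarrow> (\<And>a. a \<in> A \<Longrightarrow> smooth_real_on n V (f a)) \<Longrightarrow>
    smooth_real_on n V (\<lambda>x. \<Prod>a\<in>A. f a x)"
  by (induction A rule: infinite_finite_induct)
    (auto intro: smooth_real_on_const smooth_real_on_mult)

lemma smooth_real_on_compose:
  assumes "openin (Euclidean_space m) V" "openin (Euclidean_space n) W"
    and "smooth_real_on m V f" "\<And>j. j < m \<Longrightarrow> smooth_real_on n W (\<lambda>x. g x j)"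
    and "\<And>x. x \<in> W \<Longrightarrow> g x \<in> V"
  shows "smooth_real_on n W (\<lambda>x. f (g x))"
proof -
  \<comment> \<open>On \<open>W\<close> this changes nothing. It secures zero entries from index
    \<open>m\<close> on also outside \<open>W\<close>, where \<open>g\<close> is arbitrary, as the
    chain rule demands for every parameter of the slice.\<close>
  define h where "h x = (\<lambda>j. if j < m then g x j else 0)" for x
  have hg: "h x = g x" if "x \<in> W" for x
    using openin_Euclidean_subset[OF assms(1) assms(5)[OF that]] by (auto simp: h_def fun_eq_iff)
  have "smooth_real_on n W (\<lambda>x. f (h x))"
    unfolding smooth_real_on_def
  proof
    fix k show "Ck_on n k W (\<lambda>x. f (h x))"
    proof (rule Ck_on_compose[OF assms(1,2), where f=f and g=h])
      show "Ck_on n k W (\<lambda>x. h x j)" if "j < m" for j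
        using assms(4)[OF that] that by (simp add: h_def smooth_real_on_def)
      show "h x \<in> V" if "x \<in> W" for x
        using assms(5)[OF that] hg[OF that] by simp
    qed (use assms(3) in \<open>auto simp: h_def smooth_real_on_def\<close>)
  qed
  then show ?thesis
    by (rule smooth_real_on_cong_imp[OF assms(2), rotated]) (simp add: hg)
qed

subsection \<open>Bump functions\<close>

text \<open>For \<open>m = 0\<close> this is the standard function all of whose derivatives vanish
  at the origin; the powers of \<open>inverse t\<close> close the family under
  differentiation.\<close>

definition flat :: "nat \<Rightarrow> real \<Rightarrow> real" where
  "flat m t = (if t > 0 then inverse t ^ m * exp (- inverse t) else 0)"

lemma flat_nonneg: "flat m t \<ge> 0"
  by (simp add: flat_def)

text \<open>In the variable \<open>u = inverse t\<close> this is the decay of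
  \<open>u ^ m / exp u\<close> at infinity.\<close>

lemma flat_tendsto_0: "(flat m \<longlongrightarrow> 0) (at 0)"
proof -
  have "((\<lambda>t. inverse t ^ m / exp (inverse t)) \<longlongrightarrow> (0::real)) (at_right 0)"
    by (rule filterlim_compose[OF tendsto_power_div_exp_0 filterlim_inverse_at_top_right])
  then have "(flat m \<longlongrightarrow> 0) (at_right 0)"
    by (rule Lim_transform_eventually)
      (auto simp: eventually_at_right_field flat_def exp_minus field_simps intro!: exI[of _ 1])
  moreover have "(flat m \<longlongrightarrow> 0) (at_left 0)"
    by (rule tendsto_eventually)
      (auto simp: eventually_at_left_field flat_def intro!: exI[of _ "-1"])
  ultimately show ?thesis
    by (simp add: filterlim_at_split)
qed

lemma DERIV_flat: "(flat m has_real_derivative flat (m + 2) t - m * flat (m + 1) t) (at t)"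
proof (cases t "0::real" rule: linorder_cases)
  case less
  have "((\<lambda>_. 0) has_real_derivative 0) (at t)" by simp
  moreover have "\<forall>\<^sub>F s in nhds t. 0 = flat m s"
    using eventually_nhds_in_open[of "{..<0}" t] less by (auto simp: flat_def elim!: eventually_mono)
  ultimately have "(flat m has_real_derivative 0) (at t)"
    by (subst DERIV_cong_ev[of t t "flat m" "\<lambda>_. 0" 0 0]) (auto elim: eventually_mono)
  then show ?thesis using less by (simp add: flat_def)
next
  case equal
  \<comment> \<open>The difference quotient at \<open>0\<close> is \<open>flat (m + 1)\<close>
    itself.\<close>
  have "((\<lambda>s. (flat m s - flat m 0) / (s - 0)) \<longlongrightarrow> 0) (at 0)"
    using flat_tendsto_0[of "m + 1"]
    by (rule Lim_transform_eventually)
      (auto simp: eventually_at_filter flat_def divide_simps)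
  then show ?thesis
    using equal by (simp add: has_field_derivative_iff flat_def)
next
  case greater
  have ev: "\<forall>\<^sub>F s in nhds t. flat m s = inverse s ^ m * exp (- inverse s)"
    using eventually_nhds_in_open[of "{0<..}" t] greater by (auto simp: flat_def elim!: eventually_mono)
  have "((\<lambda>s. inverse s ^ m) has_real_derivative - m * inverse t ^ (m + 1)) (at t)"
  proof (induction m)
    case (Suc m)
    have "((\<lambda>s. inverse s * inverse s ^ m) has_real_derivative - Suc m * inverse t ^ (Suc m + 1)) (at t)"
      by (rule DERIV_cong[OF DERIV_mult[OF DERIV_inverse Suc]])
        (use greater in \<open>simp_all add: algebra_simps power2_eq_square\<close>)
    then show ?case by simp
  qed simp
  moreover have "((\<lambda>s. exp (- inverse s)) has_real_derivative exp (- inverse t) * inverse t ^ 2) (at t)"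
    using greater by (auto intro!: derivative_eq_intros simp: power2_eq_square)
  ultimately have "((\<lambda>s. inverse s ^ m * exp (- inverse s)) has_real_derivative
     flat (m + 2) t - m * flat (m + 1) t) (at t)"
    by (rule DERIV_cong[OF DERIV_mult]) (use greater in \<open>simp add: flat_def algebra_simps power2_eq_square\<close>)
  then show ?thesis
    using DERIV_cong_ev[OF refl ev refl] by blast
qed

lemma continuous_on_flat: "continuous_on S (flat m)"
  by (intro continuous_at_imp_continuous_on ballI DERIV_isCont[OF DERIV_flat])

lemma Ck_on_flat:
  assumes "openin (Euclidean_space n) V" "Ck_on n k V f"
  shows "Ck_on n k V (\<lambda>x. flat m (f x))"
  using assms(2)
proof (induction k arbitrary: m)
  case 0
  have "continuous_on V (\<lambda>x. flat m (f x))"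
    by (rule continuous_on_compose2[OF continuous_on_flat[of UNIV]])
      (use 0 in \<open>auto simp: continuous_map_Euclidean_subset assms(1)\<close>)
  then show ?case by (simp add: continuous_map_Euclidean_subset assms(1))
next
  case (Suc k)
  note f = Ck_on_SucD[OF assms(1) Suc.prems]
  have "((\<lambda>t. flat m (f (y(i := t)))) has_real_derivative
     (flat (m + 2) (f y) + (- real m) * flat (m + 1) (f y)) * partial i f y) (at (y i))"
    if "i < n" "y \<in> V" for i y
    by (rule DERIV_cong[OF DERIV_chain2[OF DERIV_flat f(2)[OF that]]]) simp
  moreover have "continuous_on V (\<lambda>x. flat m (f x))"
    by (rule continuous_on_compose2[OF continuous_on_flat[of UNIV] f(1)]) simp
  moreover have "Ck_on n k V (\<lambda>x. (flat (m + 2) (f x) + (- real m) * flat (m + 1) (f x)) * partial i f x)"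
    if "i < n" for i
    by (intro Ck_on_mult Ck_on_add Ck_on_const assms(1) Suc.IH f(3) that Suc.prems[THEN Ck_on_Suc_imp])
  ultimately show ?case
    by (intro Ck_on_SucI[OF assms(1), where
          g="\<lambda>i x. (flat (m + 2) (f x) + (- real m) * flat (m + 1) (f x)) * partial i f x"])
qed

text \<open>Each factor is \<open>a / (a + b)\<close>, where for \<open>r > 0\<close> the term
  \<open>a\<close> is positive exactly when \<open>\<bar>y i - c i\<bar> < r\<close> and
  \<open>b\<close> exactly when \<open>\<bar>y i - c i\<bar> > r / 2\<close>. One of the two always
  holds, so the denominator never vanishes. Squares stand in for absolute values to keep the
  arguments smooth.\<close>

definition bump :: "nat \<Rightarrow> (nat \<Rightarrow> real) \<Rightarrow> real \<Rightarrow> (nat \<Rightarrow> real) \<Rightarrow> real" where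
  "bump n c r y = (\<Prod>i<n. flat 0 (r\<^sup>2 - (y i - c i)\<^sup>2) *
     inverse (flat 0 (r\<^sup>2 - (y i - c i)\<^sup>2) + flat 0 ((y i - c i)\<^sup>2 - (r / 2)\<^sup>2)))"

lemma flat_sum_pos: "r > 0 \<Longrightarrow> flat 0 (r\<^sup>2 - s\<^sup>2) + flat 0 (s\<^sup>2 - (r / 2)\<^sup>2) > 0"
proof -
  assume "r > 0"
  then have "r\<^sup>2 > (r / 2)\<^sup>2" by (simp add: power_divide)
  then have "r\<^sup>2 - s\<^sup>2 > 0 \<or> s\<^sup>2 - (r / 2)\<^sup>2 > 0" by linarith
  then show ?thesis using flat_nonneg[of 0 "r\<^sup>2 - s\<^sup>2"] flat_nonneg[of 0 "s\<^sup>2 - (r / 2)\<^sup>2"]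
    by (auto simp: flat_def add_pos_nonneg add_nonneg_pos)
qed

lemma smooth_bump:
  assumes "openin (Euclidean_space n) V" "r > 0"
  shows "smooth_real_on n V (bump n c r)"
proof -
  have fl: "smooth_real_on n V (\<lambda>x. flat 0 (f x))" if "smooth_real_on n V f" for f
    using that by (simp add: smooth_real_on_def Ck_on_flat assms(1))
  \<comment> \<open>Differences and squares are spelled out as sums and products, the operations
    that have a smoothness rule.\<close>
  have "smooth_real_on n V (\<lambda>y. flat 0 (r * r + (- 1) * ((y i + (- c i)) * (y i + (- c i)))) *
     inverse (flat 0 (r * r + (- 1) * ((y i + (- c i)) * (y i + (- c i)))) +
       flat 0 ((y i + (- c i)) * (y i + (- c i)) + - (r / 2)\<^sup>2)))" for i
    by (intro smooth_real_on_mult smooth_real_on_inverse smooth_real_on_add fl smooth_real_on_const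
        smooth_real_on_coordinate assms(1))
      (use flat_sum_pos[OF assms(2), of "_ i - c i"] in
        \<open>auto simp: power2_eq_square less_le algebra_simps\<close>)
  then show ?thesis
    unfolding bump_def by (intro smooth_real_on_prod assms(1)) (simp add: power2_eq_square)
qed

lemma bump_eq_1: "r > 0 \<Longrightarrow> y \<in> cube n c (r / 2) \<Longrightarrow> bump n c r y = 1"
proof -
  assume r: "r > 0" and y: "y \<in> cube n c (r / 2)"
  have "flat 0 ((y i - c i)\<^sup>2 - (r / 2)\<^sup>2) = 0" if "i < n" for i
  proof -
    have "\<bar>y i - c i\<bar> \<le> r / 2" using y that by (auto simp: cube_def)
    then have "(y i - c i)\<^sup>2 \<le> (r / 2)\<^sup>2" using abs_le_square_iff[of "y i - c i" "r / 2"] r by simp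
    then show ?thesis by (simp add: flat_def)
  qed
  moreover have "flat 0 (r\<^sup>2 - (y i - c i)\<^sup>2) + flat 0 ((y i - c i)\<^sup>2 - (r / 2)\<^sup>2) \<noteq> 0" for i
    using flat_sum_pos[OF r, of "y i - c i"] by simp
  ultimately show ?thesis
    unfolding bump_def by (intro prod.neutral ballI) (metis add.right_neutral lessThan_iff right_inverse)
qed

lemma bump_eq_0: "r > 0 \<Longrightarrow> \<forall>i\<ge>n. y i = 0 \<Longrightarrow> y \<notin> cube n c r \<Longrightarrow> bump n c r y = 0"
proof -
  assume r: "r > 0" and "\<forall>i\<ge>n. y i = 0" "y \<notin> cube n c r"
  then obtain i where i: "i < n" "\<bar>y i - c i\<bar> \<ge> r" by (auto simp: cube_def not_less)
  then have "(y i - c i)\<^sup>2 \<ge> r\<^sup>2" using abs_le_square_iff[of r "y i - c i"] r by simp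
  then have "flat 0 (r\<^sup>2 - (y i - c i)\<^sup>2) = 0" by (simp add: flat_def)
  then show ?thesis unfolding bump_def using i(1) by (intro prod_zero) auto
qed

subsection \<open>Weighted means along rays\<close>

abbreviation cube0 :: "nat \<Rightarrow> real \<Rightarrow> (nat \<Rightarrow> real) set" where
  "cube0 n r \<equiv> cube n (\<lambda>_. 0) r"

text \<open>The exponent \<open>s\<close> records how many derivatives have been taken: each
  differentiation of \<open>g (t x)\<close> in \<open>x\<close> brings out one factor
  \<open>t\<close>.\<close>

definition ray_mean :: "nat \<Rightarrow> ((nat \<Rightarrow> real) \<Rightarrow> real) \<Rightarrow> (nat \<Rightarrow> real) \<Rightarrow> real" where
  "ray_mean s g x = integral {0..1} (\<lambda>t. t ^ s * g (\<lambda>i. t * x i))"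

lemma cube0_scale:
  assumes "x \<in> cube0 n r" "t \<in> {0..1}"
  shows "(\<lambda>i. t * x i) \<in> cube0 n r"
proof -
  have "\<bar>t * x i\<bar> \<le> 1 * \<bar>x i\<bar>" for i
    unfolding abs_mult using assms(2) by (intro mult_right_mono) auto
  then have "\<bar>t * x i\<bar> < r" if "\<bar>x i\<bar> < r" for i
    using that le_less_trans[of "\<bar>t * x i\<bar>" "\<bar>x i\<bar>" r] by simp
  then show ?thesis using assms(1) by (auto simp: cube_def)
qed

lemma continuous_on_ray:
  assumes "continuous_on (cube0 n r) g" "continuous_on T \<tau>" "continuous_on T \<eta>"
    and "\<And>a. a \<in> T \<Longrightarrow> \<tau> a \<in> {0..1}" "\<And>a. a \<in> T \<Longrightarrow> \<eta> a \<in> cube0 n r"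
  shows "continuous_on T (\<lambda>a. \<tau> a ^ s * g (\<lambda>i. \<tau> a * \<eta> a i))"
proof -
  have "continuous_on T (\<lambda>a. \<eta> a i)" for i
    by (rule continuous_on_compose2[OF continuous_on_coordinate assms(3)]) auto
  then have "continuous_on T (\<lambda>a i. \<tau> a * \<eta> a i)"
    by (intro continuous_on_coordinatewise_then_product continuous_on_mult assms(2))
  then have "continuous_on T (\<lambda>a. g (\<lambda>i. \<tau> a * \<eta> a i))"
    by (rule continuous_on_compose2[OF assms(1)]) (use cube0_scale assms(4,5) in blast)
  then show ?thesis
    by (intro continuous_on_mult continuous_on_power assms(2))
qed

lemma ray_integrable:
  assumes "continuous_on (cube0 n r) g" "x \<in> cube0 n r"
  shows "(\<lambda>t. t ^ s * g (\<lambda>i. t * x i)) integrable_on {0..1}"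
  by (intro integrable_continuous_real continuous_on_ray[OF assms(1)] continuous_on_id
      continuous_on_const) (use assms(2) in auto)

lemma ray_mean_cong:
  assumes "\<And>y. y \<in> cube0 n r \<Longrightarrow> g y = h y" "x \<in> cube0 n r"
  shows "ray_mean s g x = ray_mean s h x"
  unfolding ray_mean_def using assms cube0_scale by (intro integral_cong) auto

lemma ray_mean_add:
  assumes "continuous_on (cube0 n r) g" "continuous_on (cube0 n r) h" "x \<in> cube0 n r"
  shows "ray_mean s (\<lambda>y. g y + h y) x = ray_mean s g x + ray_mean s h x"
  unfolding ray_mean_def
  using integral_add[OF ray_integrable[OF assms(1,3), of s] ray_integrable[OF assms(2,3), of s]]
  by (simp add: algebra_simps)

text \<open>The weight is at most \<open>1\<close> on an interval of length \<open>1\<close>. That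
  the bound is independent of \<open>s\<close> keeps the contraction constant the same at every
  order of differentiation.\<close>

lemma abs_ray_mean_le:
  assumes "continuous_on (cube0 n r) g" "x \<in> cube0 n r" "\<And>y. y \<in> cube0 n r \<Longrightarrow> \<bar>g y\<bar> \<le> B"
  shows "\<bar>ray_mean s g x\<bar> \<le> B"
proof -
  have "\<bar>t ^ s * g (\<lambda>i. t * x i)\<bar> \<le> 1 * B" if "t \<in> {0..1}" for t
    unfolding abs_mult using that assms(3)[OF cube0_scale[OF assms(2) that]]
    by (intro mult_mono) (auto simp: power_le_one)
  then have "norm (integral {0..1} (\<lambda>t. t ^ s * g (\<lambda>i. t * x i))) \<le> integral {0..1::real} (\<lambda>t. B)"
    by (intro integral_norm_bound_integral ray_integrable[OF assms(1,2)]) auto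
  then show ?thesis by (simp add: ray_mean_def)
qed

lemma continuous_on_ray_mean:
  assumes "continuous_on (cube0 n r) g"
  shows "continuous_on (cube0 n r) (ray_mean s g)"
proof -
  have "continuous_on (cube0 n r \<times> cbox 0 1) (\<lambda>p. snd p ^ s * g (\<lambda>i. snd p * fst p i))"
    by (rule continuous_on_ray[OF assms])
      (auto intro!: continuous_on_fst continuous_on_snd continuous_on_id)
  then have "continuous_on (cube0 n r \<times> cbox 0 1) (\<lambda>(x, t). t ^ s * g (\<lambda>i. t * x i))"
    by (simp add: case_prod_beta)
  from integral_continuous_on_param[OF this] show ?thesis
    by (simp add: ray_mean_def[abs_def])
qed

text \<open>Differentiation under the integral sign, legitimate since the derivative of the
  integrand is jointly continuous in the parameter and in \<open>t\<close>.\<close>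

lemma DERIV_ray_mean:
  assumes "smooth_real_on n (cube0 n r) g" "x \<in> cube0 n r" "i < n"
  shows "((\<lambda>u. ray_mean s g (x(i := u))) has_real_derivative ray_mean (Suc s) (partial i g) x) (at (x i))"
proof -
  define U where "U = {-r<..<r}"
  note C = openin_cube[of n "\<lambda>_. 0" r]
  have cg: "continuous_on (cube0 n r) g" using smooth_imp_continuous_on[OF C assms(1)] .
  have cp: "continuous_on (cube0 n r) (partial i g)"
    using smooth_imp_continuous_on[OF C smooth_real_on_partial[OF assms(1,3)]] .
  have xi: "x i \<in> U" using assms(2,3) by (auto simp: cube_def U_def)
  have xu: "x(i := u) \<in> cube0 n r" if "u \<in> U" for u
    using cube_upd[OF assms(2,3)] that by (auto simp: U_def)
  \<comment> \<open>Setting coordinate \<open>i\<close> of \<open>x\<close> to \<open>u\<close> sets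
    that of the scaled point to \<open>t * u\<close>; this is the source of the raised
    weight.\<close>
  have sc: "(\<lambda>j. t * (x(i := u)) j) = (\<lambda>j. t * x j)(i := t * u)" for t u by auto
  have "((\<lambda>u. integral (cbox 0 1) (\<lambda>t. t ^ s * g (\<lambda>j. t * (x(i := u)) j))) has_field_derivative
      integral (cbox 0 1) (\<lambda>t. t ^ Suc s * partial i g (\<lambda>j. t * (x(i := x i)) j))) (at (x i) within U)"
  proof (rule leibniz_rule_field_derivative)
    show "((\<lambda>u. t ^ s * g (\<lambda>j. t * (x(i := u)) j)) has_field_derivative
        t ^ Suc s * partial i g (\<lambda>j. t * (x(i := u)) j)) (at u within U)"
      if "u \<in> U" "t \<in> cbox 0 1" for u t
    proof -
      have "(\<lambda>j. t * (x(i := u)) j) \<in> cube0 n r"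
        using cube0_scale[OF xu[OF that(1)]] that(2) by simp
      from smooth_imp_DERIV[OF C assms(1,3) this]
      have "((\<lambda>v. g ((\<lambda>j. t * x j)(i := v))) has_real_derivative
              partial i g (\<lambda>j. t * (x(i := u)) j)) (at (t * u))"
        unfolding sc fun_upd_upd by simp
      moreover have "((\<lambda>u. t * u) has_real_derivative t) (at u)"
        by (auto intro!: derivative_eq_intros)
      ultimately have "((\<lambda>u. g ((\<lambda>j. t * x j)(i := t * u))) has_real_derivative
              partial i g (\<lambda>j. t * (x(i := u)) j) * t) (at u)"
        by (rule DERIV_chain2)
      then show ?thesis
        unfolding sc
        by - (rule has_field_derivative_at_within, rule DERIV_cong[OF DERIV_cmult], assumption, simp)
    qed
    show "(\<lambda>t. t ^ s * g (\<lambda>j. t * (x(i := u)) j)) integrable_on cbox 0 1" if "u \<in> U" for u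
      using ray_integrable[OF cg xu[OF that]] by simp
    have "continuous_on (U \<times> cbox 0 1) (\<lambda>p j. (x(i := fst p)) j)"
    proof (rule continuous_on_coordinatewise_then_product)
      show "continuous_on (U \<times> cbox 0 1) (\<lambda>p. (x(i := fst p)) j)" for j
        by (cases "j = i") (auto intro!: continuous_intros)
    qed
    then have "continuous_on (U \<times> cbox 0 1)
        (\<lambda>p. snd p ^ Suc s * partial i g (\<lambda>j. snd p * (x(i := fst p)) j))"
      by (rule continuous_on_ray[OF cp continuous_on_snd[OF continuous_on_id]])
        (use xu in \<open>auto simp del: fun_upd_apply\<close>)
    then show "continuous_on (U \<times> cbox 0 1) (\<lambda>(u, t). t ^ Suc s * partial i g (\<lambda>j. t * (x(i := u)) j))"
      by (simp add: case_prod_beta)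
  qed (use xi in \<open>auto simp: U_def\<close>)
  moreover have "at (x i) within U = at (x i)"
    using xi by (intro at_within_open) (auto simp: U_def)
  ultimately show ?thesis
    by (simp add: ray_mean_def)
qed

text \<open>The derivative is again a weighted mean of a smooth function, so the induction runs over
  all weights and all integrands at once.\<close>

lemma smooth_ray_mean:
  assumes "smooth_real_on n (cube0 n r) g"
  shows "smooth_real_on n (cube0 n r) (ray_mean s g)"
proof -
  note C = openin_cube[of n "\<lambda>_. 0" r]
  have "Ck_on n k (cube0 n r) (ray_mean s g)" for k
    using assms
  proof (induction k arbitrary: s g)
    case 0
    then show ?case
      using continuous_on_ray_mean smooth_imp_continuous_on[OF C]
      by (simp add: continuous_map_Euclidean_subset C)
  next
    case (Suc k)
    show ?case
    proof (rule Ck_on_SucI[OF C _ DERIV_ray_mean[OF Suc.prems]])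
      show "continuous_on (cube0 n r) (ray_mean s g)"
        by (rule continuous_on_ray_mean[OF smooth_imp_continuous_on[OF C Suc.prems]])
      show "Ck_on n k (cube0 n r) (ray_mean (Suc s) (partial i g))" if "i < n" for i
        by (rule Suc.IH[OF smooth_real_on_partial[OF Suc.prems that]])
    qed
  qed
  then show ?thesis by (simp add: smooth_real_on_def)
qed

lemma partial_ray_mean:
  "smooth_real_on n (cube0 n r) g \<Longrightarrow> x \<in> cube0 n r \<Longrightarrow> i < n \<Longrightarrow>
     partial i (ray_mean s g) x = ray_mean (Suc s) (partial i g) x"
  by (rule DERIV_imp_partial(2)[OF DERIV_ray_mean])

text \<open>The mean along the ray inverts \<open>1 + \<Sum>\<^sub>i x\<^sub>i \<partial>\<^sub>i\<close>, by the fundamental theorem of calculus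
  applied to \<open>t \<mapsto> t g(tx)\<close>.\<close>

lemma radial_derivative_ray_mean:
  assumes g: "smooth_real_on n (cube0 n r) g" and x: "x \<in> cube0 n r"
  shows "ray_mean 0 g x + (\<Sum>i<n. x i * partial i (ray_mean 0 g) x) = g x"
proof -
  note C = openin_cube[of n "\<lambda>_. 0" r]
  have cp: "continuous_on (cube0 n r) (partial i g)" if "i < n" for i
    using smooth_imp_continuous_on[OF C smooth_real_on_partial[OF g that]] .
  define F where "F t = g (\<lambda>i. t * x i) + (\<Sum>i<n. x i * (t * partial i g (\<lambda>i. t * x i)))" for t
  have "(F has_integral (1 * g (\<lambda>i. 1 * x i) - 0 * g (\<lambda>i. 0 * x i))) {0..1}"
  proof (rule fundamental_theorem_of_calculus)
    fix t :: real assume t: "t \<in> {0..1}"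
    have "((\<lambda>t. g (\<lambda>i. t * x i)) has_real_derivative (\<Sum>i<n. partial i g (\<lambda>i. t * x i) * x i)) (at t)"
    proof (rule DERIV_chain_partial[OF C])
      show "(\<lambda>i. t * x i) \<in> cube0 n r" by (rule cube0_scale[OF x t])
      show "has_partial j g y" if "j < n" "y \<in> cube0 n r" for j y
        unfolding has_partial_iff_DERIV using smooth_imp_DERIV[OF C g that] .
      show "((\<lambda>t. t * x j) has_real_derivative x j) (at t)" for j
        by (auto intro!: derivative_eq_intros)
    qed (use x cp in \<open>auto simp: cube_def\<close>)
    from DERIV_mult[OF DERIV_ident this]
    have "((\<lambda>t. t * g (\<lambda>i. t * x i)) has_real_derivative F t) (at t)"
      by (rule DERIV_cong) (simp add: F_def sum_distrib_left mult_ac)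
    then show "((\<lambda>t. t * g (\<lambda>i. t * x i)) has_vector_derivative F t) (at t within {0..1})"
      by (simp add: has_real_derivative_iff_has_vector_derivative has_vector_derivative_at_within)
  qed simp
  moreover have "(F has_integral (ray_mean 0 g x + (\<Sum>i<n. x i * ray_mean 1 (partial i g) x))) {0..1}"
    unfolding F_def
  proof (intro has_integral_add has_integral_sum has_integral_mult_right finite_lessThan)
    show "((\<lambda>t. g (\<lambda>i. t * x i)) has_integral ray_mean 0 g x) {0..1}"
      using integrable_integral[OF ray_integrable[OF smooth_imp_continuous_on[OF C g] x, of 0]]
      by (simp add: ray_mean_def)
    show "((\<lambda>t. t * partial i g (\<lambda>i. t * x i)) has_integral ray_mean 1 (partial i g) x) {0..1}"
      if "i \<in> {..<n}" for i
      using integrable_integral[OF ray_integrable[OF cp x, of i 1]] that by (simp add: ray_mean_def)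
  qed
  ultimately have "1 * g (\<lambda>i. 1 * x i) - 0 * g (\<lambda>i. 0 * x i) =
      ray_mean 0 g x + (\<Sum>i<n. x i * ray_mean 1 (partial i g) x)"
    by (rule has_integral_unique)
  then show ?thesis
    using partial_ray_mean[OF g x, of _ 0] by simp
qed

subsection \<open>Series of smooth functions\<close>

fun Ck_bounded :: "nat \<Rightarrow> nat \<Rightarrow> (nat \<Rightarrow> real) set \<Rightarrow> ((nat \<Rightarrow> real) \<Rightarrow> real) \<Rightarrow> bool" where
  "Ck_bounded n 0 V f \<longleftrightarrow> (\<exists>B. \<forall>y\<in>V. \<bar>f y\<bar> \<le> B)"
| "Ck_bounded n (Suc k) V f \<longleftrightarrow> (\<exists>B. \<forall>y\<in>V. \<bar>f y\<bar> \<le> B) \<and> (\<forall>i<n. Ck_bounded n k V (partial i f))"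

text \<open>The hypothesis of the Weierstrass test for the series and for all its termwise
  derivatives up to order \<open>k\<close>, with a separate majorant for each of them.\<close>

fun Ck_summable :: "nat \<Rightarrow> nat \<Rightarrow> (nat \<Rightarrow> real) set \<Rightarrow> (nat \<Rightarrow> (nat \<Rightarrow> real) \<Rightarrow> real) \<Rightarrow> bool" where
  "Ck_summable n 0 V f \<longleftrightarrow> (\<exists>B. summable B \<and> (\<forall>m. \<forall>y\<in>V. \<bar>f m y\<bar> \<le> B m))"
| "Ck_summable n (Suc k) V f \<longleftrightarrow> (\<exists>B. summable B \<and> (\<forall>m. \<forall>y\<in>V. \<bar>f m y\<bar> \<le> B m)) \<and>
     (\<forall>i<n. Ck_summable n k V (\<lambda>m. partial i (f m)))"

lemma Ck_bounded_0: "Ck_bounded n k V f \<Longrightarrow> \<exists>B. \<forall>y\<in>V. \<bar>f y\<bar> \<le> B"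
  by (cases k) auto

lemma Ck_summable_0: "Ck_summable n k V f \<Longrightarrow> \<exists>B. summable B \<and> (\<forall>m. \<forall>y\<in>V. \<bar>f m y\<bar> \<le> B m)"
  by (cases k) auto

lemma Ck_bounded_Suc_imp: "Ck_bounded n (Suc k) V f \<Longrightarrow> Ck_bounded n k V f"
  by (induction k arbitrary: f) auto

lemma Ck_summable_Suc_imp: "Ck_summable n (Suc k) V f \<Longrightarrow> Ck_summable n k V f"
  by (induction k arbitrary: f) auto

lemma Ck_summable_cong_imp:
  assumes "openin (Euclidean_space n) V" "\<And>m y. y \<in> V \<Longrightarrow> f m y = g m y" "Ck_summable n k V f"
  shows "Ck_summable n k V g"
  using assms(2,3)
proof (induction k arbitrary: f g)
  case (Suc k)
  have "Ck_summable n k V (\<lambda>m. partial i (g m))" if "i < n" for i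
    using Suc.IH[of "\<lambda>m. partial i (f m)"] partial_cong[OF assms(1) _ that, of _ "f _" "g _"]
      Suc.prems that by simp
  then show ?case using Suc.prems by simp
qed simp

text \<open>Compactness of the closed cube, which the strict inequality \<open>r < R\<close> places
  inside the domain of smoothness.\<close>

lemma smooth_imp_Ck_bounded:
  assumes "smooth_real_on n (cube0 n R) f" "r < R"
  shows "Ck_bounded n k (cube0 n r) f"
  using assms(1)
proof (induction k arbitrary: f)
  case (0 f)
  have "continuous_on (closed_cube n (\<lambda>_. 0) r) f"
    using smooth_imp_continuous_on[OF openin_cube 0] closed_cube_subset_cube[OF assms(2)]
    by (rule continuous_on_subset)
  then have "bounded (f ` closed_cube n (\<lambda>_. 0) r)"
    using compact_continuous_image compact_closed_cube compact_imp_bounded by blast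
  then show ?case
    using cube_subset_closed_cube[of n "\<lambda>_. 0" r] by (fastforce simp: bounded_iff)
next
  case (Suc k f)
  have "Ck_bounded n k (cube0 n r) f" using Suc by blast
  then have "\<exists>B. \<forall>y\<in>cube0 n r. \<bar>f y\<bar> \<le> B" by (rule Ck_bounded_0)
  then show ?case using Suc smooth_real_on_partial by simp
qed

lemma Ck_summable_add:
  assumes V: "openin (Euclidean_space n) V"
    and f: "\<And>m. smooth_real_on n V (f m)" "Ck_summable n k V f"
    and g: "\<And>m. smooth_real_on n V (g m)" "Ck_summable n k V g"
  shows "Ck_summable n k V (\<lambda>m y. f m y + g m y)"
  using f g
proof (induction k arbitrary: f g)
  case (0 f g)
  then obtain A B where "summable A" "\<And>m y. y \<in> V \<Longrightarrow> \<bar>f m y\<bar> \<le> A m"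
      "summable B" "\<And>m y. y \<in> V \<Longrightarrow> \<bar>g m y\<bar> \<le> B m" by auto
  then show ?case
    by (auto intro!: exI[of _ "\<lambda>m. A m + B m"] summable_add abs_triangle_ineq[THEN order_trans] add_mono)
next
  case (Suc k f g)
  have "Ck_summable n k V (\<lambda>m y. f m y + g m y)"
    using Suc.IH Suc.prems Ck_summable_Suc_imp by blast
  moreover have "Ck_summable n k V (\<lambda>m. partial i (\<lambda>y. f m y + g m y))" if "i < n" for i
  proof (rule Ck_summable_cong_imp[OF V])
    show "Ck_summable n k V (\<lambda>m y. partial i (f m) y + partial i (g m) y)"
      using Suc.IH[of "\<lambda>m. partial i (f m)" "\<lambda>m. partial i (g m)"] Suc.prems that
      by (simp add: smooth_real_on_partial)
    show "partial i (f m) y + partial i (g m) y = partial i (\<lambda>y. f m y + g m y) y" if "y \<in> V" for m y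
      using DERIV_imp_partial(2)[OF DERIV_add[OF smooth_imp_DERIV[OF V Suc.prems(1) \<open>i < n\<close> that]
            smooth_imp_DERIV[OF V Suc.prems(3) \<open>i < n\<close> that]]] by simp
  qed
  ultimately show ?case using Ck_summable_0 by auto
qed

lemma Ck_summable_sum:
  assumes V: "openin (Euclidean_space n) V" and "finite A"
    and f: "\<And>a m. a \<in> A \<Longrightarrow> smooth_real_on n V (f a m)" "\<And>a. a \<in> A \<Longrightarrow> Ck_summable n k V (f a)"
  shows "Ck_summable n k V (\<lambda>m y. \<Sum>a\<in>A. f a m y)"
  using assms(2-4)
proof (induction A rule: finite_induct)
  case empty
  have "partial i (\<lambda>x. 0) = (\<lambda>x. 0)" for i by (simp add: partial_def fun_eq_iff)
  then have "Ck_summable n k V (\<lambda>m y. 0)"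
    by (induction k) (auto intro!: exI[of _ "\<lambda>_. 0"])
  then show ?case by simp
next
  case (insert a A)
  have "Ck_summable n k V (\<lambda>m y. f a m y + (\<Sum>a\<in>A. f a m y))"
  proof (rule Ck_summable_add[OF V])
    show "smooth_real_on n V (\<lambda>y. \<Sum>a\<in>A. f a m y)" for m
      using insert.prems(1) by (intro smooth_real_on_sum V) simp
  qed (use insert in auto)
  then show ?case using insert.hyps by simp
qed

text \<open>Product rule; the fixed factor \<open>h\<close> and its derivatives enlarge the
  majorants only by constant factors.\<close>

lemma Ck_summable_mult:
  assumes V: "openin (Euclidean_space n) V"
    and h: "smooth_real_on n V h" "Ck_bounded n k V h"
    and f: "\<And>m. smooth_real_on n V (f m)" "Ck_summable n k V f"
  shows "Ck_summable n k V (\<lambda>m y. h y * f m y)"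
  using h f
proof (induction k arbitrary: h f)
  case (0 h f)
  obtain A where A: "\<And>y. y \<in> V \<Longrightarrow> \<bar>h y\<bar> \<le> A" using 0(2) by auto
  obtain B where B: "summable B" "\<And>m y. y \<in> V \<Longrightarrow> \<bar>f m y\<bar> \<le> B m" using 0(4) by auto
  have "\<bar>h y * f m y\<bar> \<le> A * B m" if "y \<in> V" for m y
    unfolding abs_mult using A[OF that] B(2)[OF that] by (intro mult_mono) auto
  then show ?case
    using summable_mult[OF B(1)] by (auto intro!: exI[of _ "\<lambda>m. A * B m"])
next
  case (Suc k h f)
  have "Ck_summable n k V (\<lambda>m y. h y * f m y)"
    using Suc.IH Suc.prems Ck_summable_Suc_imp Ck_bounded_Suc_imp by blast
  moreover have "Ck_summable n k V (\<lambda>m. partial i (\<lambda>y. h y * f m y))" if "i < n" for i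
  proof (rule Ck_summable_cong_imp[OF V])
    have "Ck_summable n k V (\<lambda>m y. partial i h y * f m y)"
      using Suc.IH[of "partial i h" f] Suc.prems that Ck_summable_Suc_imp[OF Suc.prems(4)]
      by (simp add: smooth_real_on_partial)
    moreover have "Ck_summable n k V (\<lambda>m y. h y * partial i (f m) y)"
      using Suc.IH[of h "\<lambda>m. partial i (f m)"] Suc.prems that Ck_bounded_Suc_imp[OF Suc.prems(2)]
      by (simp add: smooth_real_on_partial)
    ultimately show "Ck_summable n k V (\<lambda>m y. partial i h y * f m y + h y * partial i (f m) y)"
      using Suc.prems that by (intro Ck_summable_add V smooth_real_on_mult smooth_real_on_partial)
    show "partial i h y * f m y + h y * partial i (f m) y = partial i (\<lambda>y. h y * f m y) y" if "y \<in> V" for m y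
      using DERIV_imp_partial(2)[OF DERIV_mult[OF smooth_imp_DERIV[OF V Suc.prems(1) \<open>i < n\<close> that]
            smooth_imp_DERIV[OF V Suc.prems(3) \<open>i < n\<close> that]]] by (simp add: mult.commute)
  qed
  ultimately show ?case using Ck_summable_0 by auto
qed

text \<open>The mean does not increase suprema, so every majorant of \<open>f m\<close> serves
  again; derivatives merely raise \<open>s\<close>, hence the induction over all
  \<open>s\<close>.\<close>

lemma Ck_summable_ray_mean:
  assumes "\<And>m. smooth_real_on n (cube0 n r) (f m)" "Ck_summable n k (cube0 n r) f"
  shows "Ck_summable n k (cube0 n r) (\<lambda>m. ray_mean s (f m))"
  using assms
proof (induction k arbitrary: s f)
  case (0 s f)
  then obtain B where "summable B" "\<And>m y. y \<in> cube0 n r \<Longrightarrow> \<bar>f m y\<bar> \<le> B m" by auto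
  then show ?case
    using abs_ray_mean_le[OF smooth_imp_continuous_on[OF openin_cube 0(1)]] by auto
next
  case (Suc k s f)
  have "Ck_summable n k (cube0 n r) (\<lambda>m. ray_mean s (f m))"
    using Suc.IH Suc.prems Ck_summable_Suc_imp by blast
  moreover have "Ck_summable n k (cube0 n r) (\<lambda>m. partial i (ray_mean s (f m)))" if "i < n" for i
  proof (rule Ck_summable_cong_imp[OF openin_cube])
    show "Ck_summable n k (cube0 n r) (\<lambda>m. ray_mean (Suc s) (partial i (f m)))"
      using Suc.IH[of "\<lambda>m. partial i (f m)"] Suc.prems that by (simp add: smooth_real_on_partial)
  qed (use partial_ray_mean[OF Suc.prems(1) _ that] in simp)
  ultimately show ?case using Ck_summable_0 by auto
qed

text \<open>On a slice through \<open>x\<close> this is termwise differentiation of a series in one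
  variable, where the Weierstrass test makes the series of derivatives converge uniformly.\<close>

lemma DERIV_suminf:
  assumes V: "openin (Euclidean_space n) V"
    and f: "\<And>m. smooth_real_on n V (f m)" "Ck_summable n (Suc 0) V f" and i: "i < n" "x \<in> V"
  shows "((\<lambda>t. \<Sum>m. f m (x(i := t))) has_real_derivative (\<Sum>m. partial i (f m) x)) (at (x i))"
proof -
  obtain B0 where B0: "summable B0" "\<And>m y. y \<in> V \<Longrightarrow> \<bar>f m y\<bar> \<le> B0 m"
    using f(2) by auto
  obtain B1 where B1: "summable B1" "\<And>m y. y \<in> V \<Longrightarrow> \<bar>partial i (f m) y\<bar> \<le> B1 m"
    using f(2) i(1) by auto
  obtain d where d: "d > 0" "\<And>t. \<bar>t - x i\<bar> < d \<Longrightarrow> x(i := t) \<in> V"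
    using slice_open[OF V i(2,1)] by blast
  have dV: "x(i := t) \<in> V" if "t \<in> ball (x i) d" for t
    using d(2)[of t] that by (simp add: dist_real_def abs_minus_commute)
  have "((\<lambda>t. \<Sum>m. f m (x(i := t))) has_real_derivative (\<Sum>m. partial i (f m) (x(i := x i)))) (at (x i))"
  proof (rule has_field_derivative_series'(2)[of "ball (x i) d" _ "\<lambda>m t. partial i (f m) (x(i := t))" "x i"])
    show "((\<lambda>t. f m (x(i := t))) has_field_derivative partial i (f m) (x(i := t))) (at t within ball (x i) d)"
      if "t \<in> ball (x i) d" for m t
      using smooth_imp_DERIV[OF V f(1) i(1) dV[OF that], of m]
      by (simp add: has_field_derivative_at_within)
    show "uniformly_convergent_on (ball (x i) d) (\<lambda>m t. \<Sum>l<m. partial i (f l) (x(i := t)))"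
      by (rule Weierstrass_m_test'_ev[OF always_eventually B1(1)]) (use B1(2) dV in auto)
    show "summable (\<lambda>m. f m (x(i := x i)))"
      by (rule summable_comparison_test'[OF B0(1)]) (use B0(2)[OF i(2)] in simp)
  qed (use d(1) in auto)
  then show ?thesis by simp
qed

lemma smooth_suminf:
  assumes V: "openin (Euclidean_space n) V"
    and f: "\<And>m. smooth_real_on n V (f m)" "\<And>k. Ck_summable n k V f"
  shows "smooth_real_on n V (\<lambda>x. \<Sum>m. f m x)"
proof -
  have "Ck_on n k V (\<lambda>x. \<Sum>m. f m x)" for k
    using f
  proof (induction k arbitrary: f)
    case (0 f)
    obtain B where B: "summable B" "\<And>m y. y \<in> V \<Longrightarrow> \<bar>f m y\<bar> \<le> B m"
      using 0(2)[of 0] by auto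
    have "uniform_limit V (\<lambda>n x. \<Sum>i<n. f i x) (\<lambda>x. suminf (\<lambda>i. f i x)) sequentially"
      by (rule Weierstrass_m_test[OF _ B(1)]) (use B(2) in auto)
    then have "continuous_on V (\<lambda>x. \<Sum>m. f m x)"
    proof (rule uniform_limit_theorem[rotated])
      show "\<forall>\<^sub>F m in sequentially. continuous_on V (\<lambda>x. \<Sum>l<m. f l x)"
        by (intro always_eventually allI continuous_on_sum smooth_imp_continuous_on[OF V] 0)
    qed simp
    then show ?case by (simp add: continuous_map_Euclidean_subset V)
  next
    case (Suc k f)
    have *: "Ck_summable n l V (\<lambda>m. partial i (f m))" if "i < n" for i l
      using Suc.prems(2)[of "Suc l"] that by simp
    show ?case
    proof (rule Ck_on_SucI[OF V _ DERIV_suminf[OF V Suc.prems]])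
      show "continuous_on V (\<lambda>x. \<Sum>m. f m x)"
        by (rule Ck_on_imp_continuous_on[OF V Suc.IH[OF Suc.prems]])
      show "Ck_on n k V (\<lambda>x. \<Sum>m. partial i (f m) x)" if "i < n" for i
        by (rule Suc.IH[OF smooth_real_on_partial[OF Suc.prems(1) that] *[OF that]])
    qed
  qed
  then show ?thesis by (simp add: smooth_real_on_def)
qed

subsection \<open>The radial differential equation\<close>

lemma DERIV_coordinate_mult:
  assumes "openin (Euclidean_space n) V" "smooth_real_on n V h" "i < n" "x \<in> V"
  shows "((\<lambda>t. (x(i := t)) j * h (x(i := t))) has_real_derivative
     (if i = j then h x else 0) + x j * partial i h x) (at (x i))"
proof -
  have "((\<lambda>t. (x(i := t)) j) has_real_derivative (if i = j then 1 else 0)) (at (x i))"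
    by (cases "i = j") (auto intro!: derivative_eq_intros)
  from DERIV_mult[OF this smooth_imp_DERIV[OF assms]] show ?thesis
    by (rule DERIV_cong) simp
qed

text \<open>Splits off the terms in which the derivative consumes the factor \<open>x j\<close>. In
  the recurrence below these are of lower order, while the remaining ones keep \<open>x j\<close>
  and with it the smallness.\<close>

lemma DERIV_sum_coordinate_mult:
  assumes V: "openin (Euclidean_space n) V"
    and h: "\<And>j a. j < n \<Longrightarrow> a < (K::nat) \<Longrightarrow> smooth_real_on n V (h j a)" and "i < n" "x \<in> V"
  shows "((\<lambda>t. \<Sum>j<n. \<Sum>a<K. (x(i := t)) j * h j a (x(i := t))) has_real_derivative
     (\<Sum>a<K. h i a x) + (\<Sum>j<n. \<Sum>a<K. x j * partial i (h j a) x)) (at (x i))"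
proof -
  have "((\<lambda>t. \<Sum>j<n. \<Sum>a<K. (x(i := t)) j * h j a (x(i := t))) has_real_derivative
     (\<Sum>j<n. \<Sum>a<K. (if i = j then h j a x else 0) + x j * partial i (h j a) x)) (at (x i))"
    by (intro DERIV_sum DERIV_coordinate_mult[OF V] h assms) auto
  moreover have "(\<Sum>j<n. \<Sum>a<K. if i = j then h j a x else 0) = (\<Sum>a<K. h i a x)"
    using \<open>i < n\<close> by (subst sum.swap) simp
  ultimately show ?thesis
    by (simp add: sum.distrib)
qed

section \<open>Majorants for the Picard series\<close>

text \<open>A partial sum \<open>s\<close> of \<open>w\<close> satisfies
  \<open>s \<le> w 0 + suminf c + s / 2\<close> and is therefore at most
  \<open>2 * (w 0 + suminf c)\<close>.\<close>

lemma summable_linear_recurrence: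
  fixes w c :: "nat \<Rightarrow> real"
  assumes "\<And>m. w (Suc m) = c m + w m / 2" "\<And>m. c m \<ge> 0" "w 0 \<ge> 0" "summable c"
  shows "summable w"
proof -
  have w: "w m \<ge> 0" for m
    by (induction m) (use assms in auto)
  have le: "(\<Sum>m<N. w m) \<le> w 0 + suminf c + (\<Sum>m<N. w m) / 2" for N
  proof (cases N)
    case 0
    then show ?thesis using w suminf_nonneg[OF assms(4,2)] by simp
  next
    case (Suc N')
    have "(\<Sum>m<N. w m) = w 0 + (\<Sum>m<N'. c m) + (\<Sum>m<N'. w m) / 2"
      unfolding Suc sum.lessThan_Suc_shift
      by (simp add: assms(1) sum.distrib sum_divide_distrib del: sum.lessThan_Suc)
    moreover have "(\<Sum>m<N'. c m) \<le> suminf c"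
      by (rule sum_le_suminf) (use assms in auto)
    moreover have "(\<Sum>m<N'. w m) \<le> (\<Sum>m<N. w m)" by (rule sum_mono2) (use w Suc in auto)
    ultimately show ?thesis by linarith
  qed
  have "s \<le> 2 * (a + b)" if "s \<le> a + b + s / 2" for s a b :: real
    using that by (simp add: field_simps)
  from this[OF le] have "(\<Sum>m<N. w m) \<le> 2 * (w 0 + suminf c)" for N .
  then show ?thesis
    using w by (intro summableI_nonneg_bounded) auto
qed

text \<open>Differentiating the recurrence gives a recurrence of the same shape, with the weight \<open>s\<close>
  raised by one and an inhomogeneity that involves only derivatives of lower order. All orders are
  therefore controlled on one and the same cube, fixed by the contraction estimate of order \<open>0\<close>.\<close>

lemma Ck_summable_recurrence:
  fixes G :: "nat \<Rightarrow> nat \<Rightarrow> nat \<Rightarrow> (nat \<Rightarrow> real) \<Rightarrow> real" and K :: nat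
  assumes r: "r > 0"
    and G: "\<And>j a b. j < n \<Longrightarrow> a < K \<Longrightarrow> b < K \<Longrightarrow> smooth_real_on n (cube0 n r) (G j a b)"
      "\<And>j a b k. j < n \<Longrightarrow> a < K \<Longrightarrow> b < K \<Longrightarrow> Ck_bounded n k (cube0 n r) (G j a b)"
      "\<And>j a b x. j < n \<Longrightarrow> a < K \<Longrightarrow> b < K \<Longrightarrow> x \<in> cube0 n r \<Longrightarrow> \<bar>G j a b x\<bar> \<le> B j a b"
      "\<And>b. b < K \<Longrightarrow> (\<Sum>j<n. \<Sum>a<K. r * B j a b) \<le> 1 / 2"
    and u: "\<And>m b. b < K \<Longrightarrow> smooth_real_on n (cube0 n r) (u m b)"
      "\<And>b. b < K \<Longrightarrow> Ck_bounded n k (cube0 n r) (u 0 b)"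
    and c: "\<And>m b. b < K \<Longrightarrow> smooth_real_on n (cube0 n r) (c m b)"
      "\<And>b. b < K \<Longrightarrow> Ck_summable n k (cube0 n r) (\<lambda>m. c m b)"
    and rec: "\<And>m b x. b < K \<Longrightarrow> x \<in> cube0 n r \<Longrightarrow>
      u (Suc m) b x = c m b x + (\<Sum>j<n. \<Sum>a<K. x j * ray_mean s (\<lambda>y. G j a b y * u m a y) x)"
    and "b < K"
  shows "Ck_summable n k (cube0 n r) (\<lambda>m. u m b)"
  using u c rec \<open>b < K\<close>
proof (induction k arbitrary: s u c b)
  case (0 s u c b)
  have "\<forall>b. \<exists>C. b < K \<longrightarrow> (\<forall>y\<in>cube0 n r. \<bar>u 0 b y\<bar> \<le> C)" using 0(2) by auto
  then obtain U where U: "\<And>b y. b < K \<Longrightarrow> y \<in> cube0 n r \<Longrightarrow> \<bar>u 0 b y\<bar> \<le> U b" by metis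
  have "\<forall>b. \<exists>C. b < K \<longrightarrow> summable C \<and> (\<forall>m. \<forall>y\<in>cube0 n r. \<bar>c m b y\<bar> \<le> C m)" using 0(4) by auto
  then obtain C where C: "\<And>b. b < K \<Longrightarrow> summable (C b)"
      "\<And>b m y. b < K \<Longrightarrow> y \<in> cube0 n r \<Longrightarrow> \<bar>c m b y\<bar> \<le> C b m" by metis
  \<comment> \<open>The centre of the cube: evaluation there shows that the bounds \<open>U\<close>,
    \<open>C\<close> and \<open>B\<close> are nonnegative.\<close>
  define z :: "nat \<Rightarrow> real" where "z = (\<lambda>_. 0)"
  have z: "z \<in> cube0 n r" using r by (simp add: cube_def z_def)
  have U0: "U b \<ge> 0" if "b < K" for b using U[OF that z] by linarith
  have C0: "C b m \<ge> 0" if "b < K" for b m using C(2)[OF that z, of m] by linarith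
  have B0: "B j a b \<ge> 0" if "j < n" "a < K" "b < K" for j a b using G(3)[OF that z] by linarith
  \<comment> \<open>One scalar majorant for all components at once. The recursion copies the
    estimate of the recurrence, in which \<open>G(4)\<close> yields the factor
    \<open>1 / 2\<close>.\<close>
  define w where "w = rec_nat (\<Sum>b<K. U b) (\<lambda>m v. (\<Sum>b<K. C b m) + v / 2)"
  have w: "w 0 = (\<Sum>b<K. U b)" "w (Suc m) = (\<Sum>b<K. C b m) + w m / 2" for m
    by (simp_all add: w_def)
  have wpos: "w m \<ge> 0" for m
    by (induction m) (auto simp: w intro!: add_nonneg_nonneg sum_nonneg U0 C0)
  have "summable w"
    by (rule summable_linear_recurrence[where c="\<lambda>m. \<Sum>b<K. C b m"])
      (auto simp: w intro!: sum_nonneg U0 C0 summable_sum C(1))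
  moreover have "\<bar>u m b y\<bar> \<le> w m" if "b < K" "y \<in> cube0 n r" for m b y
    using that
  proof (induction m arbitrary: b y)
    case 0
    have "U b \<le> (\<Sum>b<K. U b)" using U0 0 by (intro member_le_sum) auto
    then show ?case using U[OF 0] by (simp add: w)
  next
    case (Suc m)
    have "\<bar>y j * ray_mean s (\<lambda>y. G j a b y * u m a y) y\<bar> \<le> r * (B j a b * w m)" if "j < n" "a < K" for j a
      unfolding abs_mult
    proof (rule mult_mono)
      show "\<bar>y j\<bar> \<le> r" using Suc.prems(2) that(1) by (force simp: cube_def)
      show "\<bar>ray_mean s (\<lambda>y. G j a b y * u m a y) y\<bar> \<le> B j a b * w m"
      proof (rule abs_ray_mean_le[OF smooth_imp_continuous_on[OF openin_cube] Suc.prems(2)])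
        show "smooth_real_on n (cube0 n r) (\<lambda>y. G j a b y * u m a y)"
          using that Suc.prems(1) by (intro smooth_real_on_mult openin_cube G(1) "0.prems"(1))
        show "\<bar>G j a b y * u m a y\<bar> \<le> B j a b * w m" if "y \<in> cube0 n r" for y
          unfolding abs_mult using G(3) Suc.IH B0 \<open>j < n\<close> \<open>a < K\<close> Suc.prems(1) that
          by (intro mult_mono) auto
      qed
    qed (use r in auto)
    then have "\<bar>\<Sum>j<n. \<Sum>a<K. y j * ray_mean s (\<lambda>y. G j a b y * u m a y) y\<bar> \<le>
        (\<Sum>j<n. \<Sum>a<K. r * (B j a b * w m))"
      by (intro order_trans[OF sum_abs] sum_mono) auto
    also have "\<dots> = (\<Sum>j<n. \<Sum>a<K. r * B j a b) * w m"
      by (simp add: sum_distrib_left sum_distrib_right mult_ac)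
    also have "\<dots> \<le> 1 / 2 * w m"
      using G(4)[OF Suc.prems(1)] wpos by (rule mult_right_mono)
    finally have "\<bar>u (Suc m) b y\<bar> \<le> C b m + w m / 2"
      using "0.prems"(5)[OF Suc.prems, of m] C(2)[OF Suc.prems, of m] by linarith
    also have "C b m \<le> (\<Sum>b<K. C b m)" using C0 Suc.prems by (intro member_le_sum) auto
    finally show ?case by (simp add: w)
  qed
  ultimately show ?case using "0.prems"(6) by auto
next
  case (Suc k s u c b)
  note C = openin_cube[of n "\<lambda>_. 0" r]
  \<comment> \<open>The orders up to \<open>k\<close> of \<open>u\<close> itself come first, because
    \<open>u\<close> enters the inhomogeneity of the differentiated recurrence.\<close>
  have u: "Ck_summable n k (cube0 n r) (\<lambda>m. u m b)" if "b < K" for b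
    by (rule Suc.IH[of u c]) (use Suc.prems that Ck_summable_Suc_imp Ck_bounded_Suc_imp in blast)+
  have Gu: "smooth_real_on n (cube0 n r) (\<lambda>y. G j a b y * u m a y)"
    if "j < n" "a < K" "b < K" for j a b m
    by (intro smooth_real_on_mult C G(1) Suc.prems(1) that)
  have "Ck_summable n k (cube0 n r) (\<lambda>m. partial i (u m b))" if i: "i < n" for i
  proof -
    \<comment> \<open>All terms of the differentiated recurrence except those in which the
      derivative falls on \<open>u m a\<close>: it falls on \<open>c\<close>, on a coordinate
      \<open>x j\<close>, or on a coefficient \<open>G j a b\<close>.\<close>
    define c' where "c' m b x = partial i (c m b) x +
      ((\<Sum>a<K. ray_mean s (\<lambda>y. G i a b y * u m a y) x) +
       (\<Sum>j<n. \<Sum>a<K. x j * ray_mean (Suc s) (\<lambda>y. partial i (G j a b) y * u m a y) x))" for m b x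
    have G': "smooth_real_on n (cube0 n r) (\<lambda>y. partial i (G j a b) y * u m a y)"
      if "j < n" "a < K" "b < K" for j a b m
      by (intro smooth_real_on_mult smooth_real_on_partial C G(1) Suc.prems(1) that i)
    \<comment> \<open>The coordinate functions are smooth on all of n-space, so any larger cube
      serves for the compactness bound.\<close>
    have bd: "Ck_bounded n k (cube0 n r) (\<lambda>x. x j)" for j
      by (rule smooth_imp_Ck_bounded[of n "r + 1"]) (auto intro: smooth_real_on_coordinate openin_cube)
    show ?thesis
    proof (rule Suc.IH[of "\<lambda>m b. partial i (u m b)" c' "Suc s"])
      show "smooth_real_on n (cube0 n r) (c' m b)" if "b < K" for m b
        unfolding c'_def using that
        by (intro smooth_real_on_add smooth_real_on_sum smooth_real_on_mult[OF C] smooth_ray_mean Gu G'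
            smooth_real_on_partial[OF Suc.prems(3)] smooth_real_on_coordinate C i) auto
      show "Ck_summable n k (cube0 n r) (\<lambda>m. c' m b)" if "b < K" for b
      proof -
        have 1: "Ck_summable n k (cube0 n r) (\<lambda>m. ray_mean s (\<lambda>y. G i a b y * u m a y))" if "a < K" for a
          using that \<open>b < K\<close>
          by (intro Ck_summable_ray_mean Ck_summable_mult C G u Suc.prems(1) Gu i)
        have "Ck_summable n k (cube0 n r) (\<lambda>m. ray_mean (Suc s) (\<lambda>y. partial i (G j a b) y * u m a y))"
          if "j < n" "a < K" for j a
          using that \<open>b < K\<close> G(2)[of j a b "Suc k"] i
          by (intro Ck_summable_ray_mean Ck_summable_mult C smooth_real_on_partial G(1) u Suc.prems(1) G') auto
        then have 2: "Ck_summable n k (cube0 n r)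
             (\<lambda>m x. x j * ray_mean (Suc s) (\<lambda>y. partial i (G j a b) y * u m a y) x)"
          if "j < n" "a < K" for j a
          using that \<open>b < K\<close>
          by (intro Ck_summable_mult C smooth_real_on_coordinate bd smooth_ray_mean G') auto
        have "Ck_summable n k (cube0 n r) (\<lambda>m. partial i (c m b))"
          using Suc.prems(4)[OF \<open>b < K\<close>] i by simp
        then show ?thesis
          unfolding c'_def using \<open>b < K\<close> 1 2
          by (intro Ck_summable_add Ck_summable_sum C smooth_real_on_add smooth_real_on_sum
              smooth_real_on_mult[OF C] smooth_ray_mean Gu G' finite_lessThan
              smooth_real_on_partial[OF Suc.prems(3)] smooth_real_on_coordinate i) auto
      qed
      show "partial i (u (Suc m) b) x = c' m b x +
          (\<Sum>j<n. \<Sum>a<K. x j * ray_mean (Suc s) (\<lambda>y. G j a b y * partial i (u m a) y) x)"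
        if b: "b < K" and x: "x \<in> cube0 n r" for m b x
      proof -
        have pGu: "partial i (\<lambda>y. G j a b y * u m a y) y =
            partial i (G j a b) y * u m a y + G j a b y * partial i (u m a) y"
          if "j < n" "a < K" "y \<in> cube0 n r" for j a y
          using DERIV_imp_partial(2)[OF DERIV_mult[OF smooth_imp_DERIV[OF C G(1)[OF that(1,2) b] i that(3)]
                smooth_imp_DERIV[OF C Suc.prems(1)[OF that(2)] i that(3)]]] by (simp add: mult.commute)
        have rm: "partial i (ray_mean s (\<lambda>y. G j a b y * u m a y)) x =
            ray_mean (Suc s) (\<lambda>y. partial i (G j a b) y * u m a y) x +
            ray_mean (Suc s) (\<lambda>y. G j a b y * partial i (u m a) y) x" if "j < n" "a < K" for j a
        proof -
          have "partial i (ray_mean s (\<lambda>y. G j a b y * u m a y)) x =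
              ray_mean (Suc s) (partial i (\<lambda>y. G j a b y * u m a y)) x"
            by (rule partial_ray_mean[OF Gu[OF that b] x i])
          also have "\<dots> = ray_mean (Suc s) (\<lambda>y. partial i (G j a b) y * u m a y + G j a b y * partial i (u m a) y) x"
            by (rule ray_mean_cong[OF pGu[OF that] x])
          also have "\<dots> = ray_mean (Suc s) (\<lambda>y. partial i (G j a b) y * u m a y) x +
              ray_mean (Suc s) (\<lambda>y. G j a b y * partial i (u m a) y) x"
            using that b
            by (intro ray_mean_add[OF _ _ x] smooth_imp_continuous_on[OF C] G'
                smooth_real_on_mult[OF C] G(1) smooth_real_on_partial i Suc.prems(1)) auto
          finally show ?thesis .
        qed
        have "partial i (u (Suc m) b) x = partial i (\<lambda>x. c m b x +
            (\<Sum>j<n. \<Sum>a<K. x j * ray_mean s (\<lambda>y. G j a b y * u m a y) x)) x"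
          by (rule partial_cong[OF C x i]) (rule Suc.prems(5)[OF b])
        also have "\<dots> = partial i (c m b) x + ((\<Sum>a<K. ray_mean s (\<lambda>y. G i a b y * u m a y) x) +
            (\<Sum>j<n. \<Sum>a<K. x j * partial i (ray_mean s (\<lambda>y. G j a b y * u m a y)) x))"
          by (rule DERIV_imp_partial(2)[OF DERIV_add[OF smooth_imp_DERIV[OF C Suc.prems(3)[OF b] i x]
                DERIV_sum_coordinate_mult[OF C smooth_ray_mean[OF Gu[OF _ _ b]] i x]]])
        also have "(\<Sum>j<n. \<Sum>a<K. x j * partial i (ray_mean s (\<lambda>y. G j a b y * u m a y)) x) =
            (\<Sum>j<n. \<Sum>a<K. x j * ray_mean (Suc s) (\<lambda>y. partial i (G j a b) y * u m a y) x) +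
            (\<Sum>j<n. \<Sum>a<K. x j * ray_mean (Suc s) (\<lambda>y. G j a b y * partial i (u m a) y) x)"
          unfolding sum.distrib[symmetric]
          by (intro sum.cong refl) (simp add: rm distrib_left)
        finally show ?thesis by (simp add: c'_def)
      qed
      show "Ck_bounded n k (cube0 n r) (partial i (u 0 b))" if "b < K" for b
        using Suc.prems(2)[OF that] i by simp
    qed (use Suc.prems smooth_real_on_partial i in auto)
  qed
  then show ?case
    using Ck_summable_0[OF u[OF Suc.prems(6)]] by simp
qed

section \<open>Solution of the radial equation on a cube\<close>

text \<open>The terms of the Neumann series, not its partial sums: each is the integral operator
  applied to the preceding one, and the term of index \<open>0\<close> is the initial value.\<close>

primrec ray_picard ::
  "nat \<Rightarrow> nat \<Rightarrow> (nat \<Rightarrow> nat \<Rightarrow> nat \<Rightarrow> (nat \<Rightarrow> real) \<Rightarrow> real) \<Rightarrow> (nat \<Rightarrow> real) \<Rightarrow> nat \<Rightarrow> nat \<Rightarrow> (nat \<Rightarrow> real) \<Rightarrow> real"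
where
  "ray_picard n K G \<xi> 0 = (\<lambda>b x. \<xi> b)"
| "ray_picard n K G \<xi> (Suc m) =
     (\<lambda>b x. \<Sum>j<n. \<Sum>a<K. x j * ray_mean 0 (\<lambda>y. G j a b y * ray_picard n K G \<xi> m a y) x)"

text \<open>The radial operator \<open>\<Sum>i x_i \<partial>_i\<close>, applied term by term, turns
  term \<open>m + 1\<close> of the series into the coefficient expression in term \<open>m\<close>;
  summing over \<open>m\<close> gives the differential equation.\<close>

lemma radial_ode:
  fixes \<Gamma> :: "nat \<Rightarrow> nat \<Rightarrow> nat \<Rightarrow> (nat \<Rightarrow> real) \<Rightarrow> real" and K :: nat
  assumes R: "R > 0"
    and \<Gamma>: "\<And>j a b. j < n \<Longrightarrow> a < K \<Longrightarrow> b < K \<Longrightarrow> smooth_real_on n (cube0 n R) (\<Gamma> j a b)"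
  shows "\<exists>r f. 0 < r \<and> r \<le> R \<and> (\<forall>b<K. smooth_real_on n (cube0 n r) (f b)) \<and>
    (\<forall>b<K. f b (\<lambda>_. 0) = \<xi> b) \<and>
    (\<forall>b<K. \<forall>x\<in>cube0 n r.
       (\<Sum>j<n. x j * partial j (f b) x) + (\<Sum>j<n. \<Sum>a<K. x j * (\<Gamma> j a b x * f a x)) = 0)"
proof -
  \<comment> \<open>The sign moves the coefficients to the right-hand side, where the iteration
    takes place.\<close>
  define G where "G j a b x = (- 1) * \<Gamma> j a b x" for j a b x
  have GR: "smooth_real_on n (cube0 n R) (G j a b)" if "j < n" "a < K" "b < K" for j a b
    unfolding G_def by (intro smooth_real_on_mult smooth_real_on_const openin_cube \<Gamma> that)
  have "\<exists>B. \<forall>x\<in>cube0 n (R / 2). \<bar>G j a b x\<bar> \<le> B" if "j < n" "a < K" "b < K" for j a b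
    using smooth_imp_Ck_bounded[OF GR[OF that], of "R / 2" 0] R by simp
  then have "\<forall>j a b. \<exists>B. j < n \<longrightarrow> a < K \<longrightarrow> b < K \<longrightarrow> (\<forall>x\<in>cube0 n (R / 2). \<bar>G j a b x\<bar> \<le> B)"
    by blast
  then obtain B where B: "\<And>j a b x. j < n \<Longrightarrow> a < K \<Longrightarrow> b < K \<Longrightarrow> x \<in> cube0 n (R / 2) \<Longrightarrow> \<bar>G j a b x\<bar> \<le> B j a b"
    by metis
  have B0: "B j a b \<ge> 0" if "j < n" "a < K" "b < K" for j a b
    using B[OF that, of "\<lambda>_. 0"] R by (force simp: cube_def)
  define S where "S = (\<Sum>b<K. \<Sum>j<n. \<Sum>a<K. B j a b)"
  have S0: "S \<ge> 0" by (auto simp: S_def intro!: sum_nonneg B0)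
  \<comment> \<open>\<open>R / 2\<close> leaves room below \<open>R\<close> for the compactness
    bounds. The second entry gives \<open>r * S \<le> 1 / 2\<close>, with \<open>S + 1\<close> to
    avoid division by zero; \<open>S\<close> sums over \<open>b\<close> as well and so dominates the
    sum for each single component.\<close>
  define r where "r = min (R / 2) (1 / (2 * (S + 1)))"
  have r: "r > 0" "r \<le> R / 2" "r < R" using R S0 by (auto simp: r_def)
  have rS: "r * S \<le> 1 / 2"
  proof -
    have "r * S \<le> 1 / (2 * (S + 1)) * S" using S0 by (intro mult_right_mono) (auto simp: r_def)
    also have "\<dots> \<le> 1 / 2" using S0 by (simp add: field_simps)
    finally show ?thesis .
  qed
  note C = openin_cube[of n "\<lambda>_. 0" r]
  have G: "smooth_real_on n (cube0 n r) (G j a b)" if "j < n" "a < K" "b < K" for j a b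
    by (rule smooth_real_on_subset[OF cube_mono GR[OF that]]) (use r in simp)
  define u where "u = ray_picard n K G \<xi>"
  have u0: "u 0 b = (\<lambda>x. \<xi> b)" and uSuc: "u (Suc m) b =
      (\<lambda>x. \<Sum>j<n. \<Sum>a<K. x j * ray_mean 0 (\<lambda>y. G j a b y * u m a y) x)" for m b
    by (simp_all add: u_def)
  have u: "smooth_real_on n (cube0 n r) (u m b)" if "b < K" for m b
    using that
  proof (induction m arbitrary: b)
    case 0
    then show ?case by (simp add: u0 smooth_real_on_const C)
  next
    case (Suc m)
    then show ?case unfolding uSuc
      by (intro smooth_real_on_sum smooth_real_on_mult smooth_ray_mean smooth_real_on_coordinate C G) auto
  qed
  have Gu: "smooth_real_on n (cube0 n r) (\<lambda>y. G j a b y * u m a y)"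
    if "j < n" "a < K" "b < K" for j a b m
    by (intro smooth_real_on_mult C G u that)
  have summ: "Ck_summable n k (cube0 n r) (\<lambda>m. u m b)" if "b < K" for k b
  proof (rule Ck_summable_recurrence[OF r(1), where c="\<lambda>m b x. 0" and s=0 and G=G and B=B and K=K])
    show "Ck_bounded n k (cube0 n r) (G j a b)" if "j < n" "a < K" "b < K" for j a b k
      by (rule smooth_imp_Ck_bounded[OF GR[OF that] r(3)])
    show "\<bar>G j a b x\<bar> \<le> B j a b" if "j < n" "a < K" "b < K" "x \<in> cube0 n r" for j a b x
      using B[OF that(1-3)] cube_mono[OF r(2)] that(4) by blast
    show "(\<Sum>j<n. \<Sum>a<K. r * B j a b) \<le> 1 / 2" if "b < K" for b
    proof -
      have "(\<Sum>j<n. \<Sum>a<K. B j a b) \<le> S"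
        unfolding S_def using that
        by (intro member_le_sum[of b "{..<K}" "\<lambda>b. \<Sum>j<n. \<Sum>a<K. B j a b"]) (auto intro!: sum_nonneg B0)
      then have "r * (\<Sum>j<n. \<Sum>a<K. B j a b) \<le> r * S" using r(1) by simp
      then show ?thesis using rS by (simp add: sum_distrib_left)
    qed
    show "Ck_bounded n k (cube0 n r) (u 0 b)" for b
      unfolding u0 by (rule smooth_imp_Ck_bounded[OF smooth_real_on_const[OF openin_cube] r(3)])
    show "Ck_summable n k (cube0 n r) (\<lambda>m x. 0)"
      using Ck_summable_sum[OF C, of "{}" "\<lambda>_ _ _. 0" k] by simp
  qed (use u G that in \<open>auto simp: uSuc smooth_real_on_const C\<close>)
  define f where "f b x = (\<Sum>m. u m b x)" for b x
  have usum: "(\<lambda>m. u m b x) sums f b x" if bx: "b < K" "x \<in> cube0 n r" for b x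
  proof -
    obtain A where "summable A" "\<And>m. \<bar>u m b x\<bar> \<le> A m"
      using Ck_summable_0[OF summ[OF bx(1), of 0]] bx(2) by blast
    then show ?thesis
      unfolding f_def by (auto intro: summable_sums[OF summable_comparison_test'[of A 0]])
  qed
  have dsum: "(\<lambda>m. partial i (u m b) x) sums partial i (f b) x" if bx: "b < K" "x \<in> cube0 n r" "i < n" for b x i
  proof -
    obtain A where "summable A" "\<And>m. \<bar>partial i (u m b) x\<bar> \<le> A m"
      using summ[OF bx(1), of "Suc 0"] bx(2,3) by auto
    then have "(\<lambda>m. partial i (u m b) x) sums (\<Sum>m. partial i (u m b) x)"
      by (auto intro: summable_sums[OF summable_comparison_test'[of A 0]])
    moreover have "partial i (f b) x = (\<Sum>m. partial i (u m b) x)"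
      unfolding f_def
      by (rule DERIV_imp_partial(2)[OF DERIV_suminf[OF C u[OF bx(1)] summ[OF bx(1)] bx(3,2)]])
    ultimately show ?thesis by simp
  qed
  \<comment> \<open>The radial operator maps \<open>x j * ray_mean 0 h\<close> to
    \<open>x j * h\<close>: differentiating the factor \<open>x j\<close> supplies the summand
    \<open>ray_mean 0 h\<close> that \<open>radial_derivative_ray_mean\<close> asks for.\<close>
  have radial: "(\<Sum>i<n. x i * partial i (u (Suc m) b) x) = (\<Sum>j<n. \<Sum>a<K. x j * (G j a b x * u m a x))"
    if b: "b < K" and x: "x \<in> cube0 n r" for b x m
  proof -
    let ?h = "\<lambda>j a y. G j a b y * u m a y"
    have p: "partial i (u (Suc m) b) x = (\<Sum>a<K. ray_mean 0 (?h i a) x) +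
        (\<Sum>j<n. \<Sum>a<K. x j * partial i (ray_mean 0 (?h j a)) x)" if "i < n" for i
      unfolding uSuc
      by (rule DERIV_imp_partial(2)[OF DERIV_sum_coordinate_mult[OF C smooth_ray_mean[OF Gu[OF _ _ b]] that x]])
    have swap: "(\<Sum>i<n. \<Sum>j<n. \<Sum>a<K. T i j a) = (\<Sum>j<n. \<Sum>a<K. \<Sum>i<n. T i j a)"
      for T :: "nat \<Rightarrow> nat \<Rightarrow> nat \<Rightarrow> real"
      by (subst sum.swap) (intro sum.cong refl sum.swap)
    have "(\<Sum>i<n. x i * partial i (u (Suc m) b) x) =
        (\<Sum>j<n. \<Sum>a<K. x j * ray_mean 0 (?h j a) x) +
        (\<Sum>i<n. \<Sum>j<n. \<Sum>a<K. x i * (x j * partial i (ray_mean 0 (?h j a)) x))"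
      by (simp add: p distrib_left sum.distrib sum_distrib_left)
    also have "(\<Sum>i<n. \<Sum>j<n. \<Sum>a<K. x i * (x j * partial i (ray_mean 0 (?h j a)) x)) =
        (\<Sum>j<n. \<Sum>a<K. \<Sum>i<n. x j * (x i * partial i (ray_mean 0 (?h j a)) x))"
      unfolding swap by (intro sum.cong refl) simp
    also have "(\<Sum>j<n. \<Sum>a<K. x j * ray_mean 0 (?h j a) x) + \<dots> =
        (\<Sum>j<n. \<Sum>a<K. x j * (ray_mean 0 (?h j a) x + (\<Sum>i<n. x i * partial i (ray_mean 0 (?h j a)) x)))"
      by (simp add: distrib_left sum.distrib sum_distrib_left)
    also have "\<dots> = (\<Sum>j<n. \<Sum>a<K. x j * (G j a b x * u m a x))"
      using radial_derivative_ray_mean[OF Gu[OF _ _ b] x] by (intro sum.cong refl) simp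
    finally show ?thesis .
  qed
  show ?thesis
  proof (intro exI[of _ r] exI[of _ f] conjI allI impI ballI)
    show "smooth_real_on n (cube0 n r) (f b)" if "b < K" for b
      unfolding f_def using smooth_suminf[OF C u[OF that] summ[OF that]] .
    show "f b (\<lambda>_. 0) = \<xi> b" if "b < K" for b
    proof -
      \<comment> \<open>All terms after the first carry a factor \<open>x j\<close> and vanish at
        the origin.\<close>
      have "u m b (\<lambda>_. 0) = (if m = 0 then \<xi> b else 0)" for m
        by (cases m) (simp_all add: u0 uSuc)
      then have "(\<lambda>m. u m b (\<lambda>_. 0)) sums \<xi> b"
        using sums_single[of 0 "\<lambda>_. \<xi> b"] by simp
      then show ?thesis unfolding f_def by (rule sums_unique[symmetric])
    qed
    show "(\<Sum>j<n. x j * partial j (f b) x) + (\<Sum>j<n. \<Sum>a<K. x j * (\<Gamma> j a b x * f a x)) = 0"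
      if "b < K" "x \<in> cube0 n r" for b x
    proof -
      have "(\<lambda>m. \<Sum>j<n. \<Sum>a<K. x j * (G j a b x * u m a x)) sums (\<Sum>j<n. \<Sum>a<K. x j * (G j a b x * f a x))"
        by (intro sums_sum sums_mult usum that) auto
      then have "(\<lambda>m. \<Sum>i<n. x i * partial i (u (Suc m) b) x) sums (\<Sum>j<n. \<Sum>a<K. x j * (G j a b x * f a x))"
        by (simp only: radial[OF that])
      \<comment> \<open>Term \<open>0\<close> is constant, so its radial derivative is zero and the
        index can be shifted.\<close>
      from sums_Suc[OF this]
      have "(\<lambda>m. \<Sum>i<n. x i * partial i (u m b) x) sums (\<Sum>j<n. \<Sum>a<K. x j * (G j a b x * f a x))"
        by (simp add: u0 partial_def)
      moreover have "(\<lambda>m. \<Sum>i<n. x i * partial i (u m b) x) sums (\<Sum>i<n. x i * partial i (f b) x)"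
        by (intro sums_sum sums_mult dsum that) auto
      ultimately have "(\<Sum>i<n. x i * partial i (f b) x) = (\<Sum>j<n. \<Sum>a<K. x j * (G j a b x * f a x))"
        using sums_unique2 by blast
      then show ?thesis by (simp add: G_def sum_negf)
    qed
  qed (use r in auto)
qed

subsection \<open>Smooth functions on manifolds\<close>

text \<open>Smoothness is expressed with \<open>inv_into U \<phi>\<close>. On the image it agrees
  with the inverse that the homeomorphism provides, and so inherits its continuity.\<close>

lemma topological_chartD:
  assumes "topological_chart M U \<phi>"
  shows "openin (mtop M) U" "U \<subseteq> points M" "openin (Euclidean_space (mdim M)) (\<phi> ` U)" "inj_on \<phi> U"
    "continuous_map (subtopology (mtop M) U) (subtopology (Euclidean_space (mdim M)) (\<phi> ` U)) \<phi>"
    "continuous_map (subtopology (Euclidean_space (mdim M)) (\<phi> ` U)) (subtopology (mtop M) U) (inv_into U \<phi>)"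
proof -
  let ?X = "subtopology (mtop M) U" and ?Y = "subtopology (Euclidean_space (mdim M)) (\<phi> ` U)"
  show op: "openin (mtop M) U" "openin (Euclidean_space (mdim M)) (\<phi> ` U)"
    using assms by (auto simp: topological_chart_def)
  show "U \<subseteq> points M" using openin_subset[OF op(1)] .
  have h: "homeomorphic_map ?X ?Y \<phi>"
    using assms by (auto simp: topological_chart_def)
  have tX: "topspace ?X = U" using \<open>U \<subseteq> points M\<close> by auto
  have tY: "topspace ?Y = \<phi> ` U" using openin_subset[OF op(2)] by auto
  show inj: "inj_on \<phi> U" using homeomorphic_imp_injective_map[OF h] tX by simp
  show "continuous_map ?X ?Y \<phi>" using homeomorphic_imp_continuous_map[OF h] .
  obtain g where g: "homeomorphic_maps ?X ?Y \<phi> g"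
    using h homeomorphic_map_maps by blast
  have "g y = inv_into U \<phi> y" if "y \<in> \<phi> ` U" for y
  proof -
    have "g (\<phi> q) = q" if "q \<in> U" for q
      using g that tX by (auto simp: homeomorphic_maps_def)
    then show ?thesis using that inj by auto
  qed
  moreover have "continuous_map ?Y ?X g" using g by (simp add: homeomorphic_maps_def)
  ultimately show "continuous_map ?Y ?X (inv_into U \<phi>)"
    using tY continuous_map_eq by metis
qed

lemma chart_image_open:
  assumes "topological_chart M U \<phi>" "openin (mtop M) W" "W \<subseteq> U"
  shows "openin (Euclidean_space (mdim M)) (\<phi> ` W)"
proof -
  have "homeomorphic_map (subtopology (mtop M) U) (subtopology (Euclidean_space (mdim M)) (\<phi> ` U)) \<phi>"
    using assms by (auto simp: topological_chart_def)
  moreover have "openin (subtopology (mtop M) U) W"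
    using assms(2,3) by (simp add: openin_open_subtopology topological_chartD(1)[OF assms(1)])
  ultimately have "openin (subtopology (Euclidean_space (mdim M)) (\<phi> ` U)) (\<phi> ` W)"
    using homeomorphic_imp_open_map open_map_def by blast
  then show ?thesis
    using openin_trans_full topological_chartD(3)[OF assms(1)] by blast
qed

lemma chart_preimage_open:
  assumes "topological_chart M U \<phi>" "openin (Euclidean_space (mdim M)) T"
  shows "openin (mtop M) {q \<in> U. \<phi> q \<in> T}"
proof -
  have "openin (subtopology (mtop M) U) {q \<in> topspace (subtopology (mtop M) U). \<phi> q \<in> T \<inter> \<phi> ` U}"
    by (rule openin_continuous_map_preimage[OF topological_chartD(5)[OF assms(1)]])
      (use assms(2) in \<open>auto simp: openin_subtopology\<close>)
  moreover have "{q \<in> topspace (subtopology (mtop M) U). \<phi> q \<in> T \<inter> \<phi> ` U} = {q \<in> U. \<phi> q \<in> T}"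
    using topological_chartD(2)[OF assms(1)] by auto
  ultimately show ?thesis
    using openin_trans_full topological_chartD(1)[OF assms(1)] by metis
qed

text \<open>The expression of \<open>f\<close> in the chart \<open>\<psi>\<close> is its expression
  in \<open>\<phi>\<close> composed with the transition map from \<open>\<psi>\<close> to
  \<open>\<phi>\<close>.\<close>

lemma smooth_real_on_transition:
  assumes U: "topological_chart M U \<phi>" and V: "topological_chart M V \<psi>"
    and tr: "smooth_transition (mdim M) V \<psi> U \<phi>"
    and W: "openin (mtop M) W" "W \<subseteq> U" "W \<subseteq> V"
    and f: "smooth_real_on (mdim M) (\<phi> ` W) (f \<circ> inv_into U \<phi>)"
  shows "smooth_real_on (mdim M) (\<psi> ` W) (f \<circ> inv_into V \<psi>)"
proof -
  note oU = chart_image_open[OF U W(1,2)] and oV = chart_image_open[OF V W(1,3)]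
  have inv: "inv_into V \<psi> (\<psi> q) = q" "inv_into U \<phi> (\<phi> q) = q" if "q \<in> W" for q
    using that W topological_chartD(4)[OF U] topological_chartD(4)[OF V] by (auto simp: subset_iff)
  have "smooth_real_on (mdim M) (\<psi> ` W) (\<lambda>y. (f \<circ> inv_into U \<phi>) (\<phi> (inv_into V \<psi> y)))"
  proof (rule smooth_real_on_compose[OF oU oV f])
    show "smooth_real_on (mdim M) (\<psi> ` W) (\<lambda>y. \<phi> (inv_into V \<psi> y) j)" if "j < mdim M" for j
    proof (rule smooth_real_on_subset)
      show "smooth_real_on (mdim M) (\<psi> ` (V \<inter> U)) (\<lambda>y. \<phi> (inv_into V \<psi> y) j)"
        using tr that by (simp add: smooth_transition_def smooth_vec_on_def)
    qed (use W in auto)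
  qed (auto simp: inv)
  then show ?thesis
    by (rule smooth_real_on_cong_imp[OF oV, rotated]) (auto simp: inv)
qed

lemma continuous_map_local:
  assumes "\<And>q. q \<in> topspace X \<Longrightarrow> \<exists>W. openin X W \<and> q \<in> W \<and> continuous_map (subtopology X W) Y f"
  shows "continuous_map X Y f"
  unfolding continuous_map_def
proof (intro conjI funcsetI allI impI)
  show "f q \<in> topspace Y" if "q \<in> topspace X" for q
    using assms[OF that] that by (auto simp: continuous_map_def Pi_iff)
  fix V assume V: "openin Y V"
  show "openin X {q \<in> topspace X. f q \<in> V}"
  proof (subst openin_subopen, intro ballI)
    fix q assume q: "q \<in> {q \<in> topspace X. f q \<in> V}"
    then obtain W where W: "openin X W" "q \<in> W" "continuous_map (subtopology X W) Y f"
      using assms by blast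
    have "openin (subtopology X W) {q \<in> topspace (subtopology X W). f q \<in> V}"
      using openin_continuous_map_preimage[OF W(3) V] .
    then have "openin X {q \<in> topspace (subtopology X W). f q \<in> V}"
      using openin_trans_full W(1) by blast
    then show "\<exists>T. openin X T \<and> q \<in> T \<and> T \<subseteq> {q \<in> topspace X. f q \<in> V}"
      using q W(2) by (intro exI[of _ "{q \<in> topspace (subtopology X W). f q \<in> V}"]) auto
  qed
qed

lemma smooth_fun_onD:
  "smooth_fun_on M W f \<Longrightarrow> (U, \<phi>) \<in> atlas M \<Longrightarrow>
     smooth_real_on (mdim M) (\<phi> ` (U \<inter> W)) (f \<circ> inv_into U \<phi>)"
  by (auto simp: smooth_fun_on_def)

lemma smooth_fun_on_cong_imp:
  assumes "smooth_fun_on M W f" "\<And>q. q \<in> W \<Longrightarrow> f q = g q" "openin (mtop M) W"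
    "smooth_manifold M"
  shows "smooth_fun_on M W g"
  unfolding smooth_fun_on_def
proof clarify
  fix U \<phi> assume U: "(U, \<phi>) \<in> atlas M"
  have ch: "topological_chart M U \<phi>" using assms(4) U by (auto simp: smooth_manifold_def)
  have op: "openin (Euclidean_space (mdim M)) (\<phi> ` (U \<inter> W))"
    using chart_image_open[OF ch] topological_chartD(1)[OF ch] assms(3) by blast
  have "smooth_real_on (mdim M) (\<phi> ` (U \<inter> W)) (f \<circ> inv_into U \<phi>)"
    using assms(1) U by (auto simp: smooth_fun_on_def)
  then show "smooth_real_on (mdim M) (\<phi> ` (U \<inter> W)) (g \<circ> inv_into U \<phi>)"
    by (rule smooth_real_on_cong_imp[OF op, rotated])
      (use topological_chartD(4)[OF ch] assms(2) in auto)
qed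

section \<open>Smooth functions in arbitrary coordinates\<close>

locale smooth_mfd =
  fixes M :: "'m mfd"
  assumes mfd: "smooth_manifold M"
begin

lemma atlas_coordinates:
  assumes "(U, \<phi>) \<in> atlas M"
  shows "smooth_coordinates M U \<phi>"
proof -
  have charts: "\<forall>(U, \<phi>) \<in> atlas M. topological_chart M U \<phi>"
    and trans: "\<forall>(U, \<phi>) \<in> atlas M. \<forall>(V, \<psi>) \<in> atlas M. smooth_transition (mdim M) U \<phi> V \<psi>"
    using mfd by (simp_all add: smooth_manifold_def)
  have tr: "smooth_transition (mdim M) A \<alpha> B \<beta>" if "(A, \<alpha>) \<in> atlas M" "(B, \<beta>) \<in> atlas M" for A \<alpha> B \<beta>
    using bspec[OF trans that(1)] that(2) by auto
  show ?thesis
    unfolding smooth_coordinates_def using bspec[OF charts assms] tr assms by auto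
qed

lemma coordinates_chart: "smooth_coordinates M V x \<Longrightarrow> topological_chart M V x"
  by (simp add: smooth_coordinates_def)

lemma atlas_chart: "(U, \<phi>) \<in> atlas M \<Longrightarrow> topological_chart M U \<phi>"
  using atlas_coordinates coordinates_chart by blast

lemma atlas_cover:
  assumes "q \<in> points M" obtains U \<phi> where "(U, \<phi>) \<in> atlas M" "q \<in> U"
proof -
  have "(\<Union>(U, \<phi>) \<in> atlas M. U) = points M" using mfd by (simp add: smooth_manifold_def)
  then show ?thesis using assms that by blast
qed

text \<open>\<open>smooth_fun_on\<close> tests the charts of the given atlas. Around each point one
  of them can be compared with the coordinates \<open>x\<close> through the transition map, and
  smoothness is local.\<close>

lemma smooth_fun_on_coordinates:
  assumes V: "smooth_coordinates M V x" and W: "openin (mtop M) W" and f: "smooth_fun_on M W f"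
  shows "smooth_real_on (mdim M) (x ` (V \<inter> W)) (f \<circ> inv_into V x)"
proof (rule smooth_real_on_local)
  note chV = coordinates_chart[OF V]
  have VW: "openin (mtop M) (V \<inter> W)" using W topological_chartD(1)[OF chV] by blast
  show "openin (Euclidean_space (mdim M)) (x ` (V \<inter> W))"
    by (rule chart_image_open[OF chV VW]) auto
  fix y assume "y \<in> x ` (V \<inter> W)"
  then obtain q where q: "q \<in> V" "q \<in> W" "y = x q" by auto
  then obtain U \<phi> where U: "(U, \<phi>) \<in> atlas M" "q \<in> U"
    using atlas_cover topological_chartD(2)[OF chV] by blast
  note chU = atlas_chart[OF U(1)]
  have op: "openin (mtop M) (U \<inter> V \<inter> W)" using VW topological_chartD(1)[OF chU] by (simp add: Int_assoc openin_Int)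
  have "smooth_real_on (mdim M) (\<phi> ` (U \<inter> W)) (f \<circ> inv_into U \<phi>)"
    using f U(1) by (auto simp: smooth_fun_on_def)
  then have "smooth_real_on (mdim M) (\<phi> ` (U \<inter> V \<inter> W)) (f \<circ> inv_into U \<phi>)"
    by (rule smooth_real_on_subset[rotated]) auto
  moreover have "smooth_transition (mdim M) V x U \<phi>"
    using V U(1) by (auto simp: smooth_coordinates_def)
  ultimately have sm: "smooth_real_on (mdim M) (x ` (U \<inter> V \<inter> W)) (f \<circ> inv_into V x)"
    using smooth_real_on_transition[OF chU chV _ op] by auto
  show "\<exists>T. openin (Euclidean_space (mdim M)) T \<and> y \<in> T \<and>
      smooth_real_on (mdim M) (x ` (V \<inter> W) \<inter> T) (f \<circ> inv_into V x)"
  proof (intro exI conjI)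
    show "openin (Euclidean_space (mdim M)) (x ` (U \<inter> V \<inter> W))"
      by (rule chart_image_open[OF chV op]) auto
    show "smooth_real_on (mdim M) (x ` (V \<inter> W) \<inter> x ` (U \<inter> V \<inter> W)) (f \<circ> inv_into V x)"
      by (rule smooth_real_on_subset[OF _ sm]) auto
  qed (use q U in auto)
qed

text \<open>Here the transition maps are used in the opposite direction: a single coordinate
  expression on \<open>W\<close> controls the expressions in all charts of the atlas.\<close>

lemma smooth_fun_onI_coordinates:
  assumes V: "smooth_coordinates M V x" and W: "openin (mtop M) W" "W \<subseteq> V"
    and f: "smooth_real_on (mdim M) (x ` W) (f \<circ> inv_into V x)"
  shows "smooth_fun_on M W f"
  unfolding smooth_fun_on_def
proof clarify
  fix U \<phi> assume U: "(U, \<phi>) \<in> atlas M"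
  note chU = atlas_chart[OF U] and chV = coordinates_chart[OF V]
  have op: "openin (mtop M) (U \<inter> W)" using W topological_chartD(1)[OF chU] by blast
  have "smooth_transition (mdim M) U \<phi> V x"
    using V U by (auto simp: smooth_coordinates_def)
  then show "smooth_real_on (mdim M) (\<phi> ` (U \<inter> W)) (f \<circ> inv_into U \<phi>)"
    using smooth_real_on_transition[OF chV chU _ op] W(2) smooth_real_on_subset[OF _ f, of "x ` (U \<inter> W)"]
    by blast
qed

lemma smooth_fun_on_local:
  assumes W: "openin (mtop M) W"
    and loc: "\<And>q. q \<in> W \<Longrightarrow> \<exists>W'. openin (mtop M) W' \<and> q \<in> W' \<and> smooth_fun_on M W' f"
  shows "smooth_fun_on M W f"
  unfolding smooth_fun_on_def
proof clarify
  fix U \<phi> assume U: "(U, \<phi>) \<in> atlas M"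
  note ch = atlas_chart[OF U]
  have op: "openin (Euclidean_space (mdim M)) (\<phi> ` (U \<inter> W))" if "openin (mtop M) W" for W
    using chart_image_open[OF ch] topological_chartD(1)[OF ch] that by blast
  show "smooth_real_on (mdim M) (\<phi> ` (U \<inter> W)) (f \<circ> inv_into U \<phi>)"
  proof (rule smooth_real_on_local[OF op[OF W]])
    fix y assume "y \<in> \<phi> ` (U \<inter> W)"
    then obtain q where q: "q \<in> U" "q \<in> W" "y = \<phi> q" by auto
    then obtain W' where W': "openin (mtop M) W'" "q \<in> W'" "smooth_fun_on M W' f"
      using loc by blast
    have "smooth_real_on (mdim M) (\<phi> ` (U \<inter> W')) (f \<circ> inv_into U \<phi>)"
      using W'(3) U by (auto simp: smooth_fun_on_def)
    then have "smooth_real_on (mdim M) (\<phi> ` (U \<inter> W) \<inter> \<phi> ` (U \<inter> W')) (f \<circ> inv_into U \<phi>)"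
      by (rule smooth_real_on_subset[rotated]) auto
    then show "\<exists>T. openin (Euclidean_space (mdim M)) T \<and> y \<in> T \<and>
        smooth_real_on (mdim M) (\<phi> ` (U \<inter> W) \<inter> T) (f \<circ> inv_into U \<phi>)"
      using op[OF W'(1)] q W'(2) by blast
  qed
qed

lemma smooth_fun_on_subset:
  assumes "smooth_fun_on M W f" "W' \<subseteq> W"
  shows "smooth_fun_on M W' f"
  unfolding smooth_fun_on_def
proof clarify
  fix U \<phi> assume "(U, \<phi>) \<in> atlas M"
  then have "smooth_real_on (mdim M) (\<phi> ` (U \<inter> W)) (f \<circ> inv_into U \<phi>)"
    using assms(1) by (auto simp: smooth_fun_on_def)
  then show "smooth_real_on (mdim M) (\<phi> ` (U \<inter> W')) (f \<circ> inv_into U \<phi>)"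
    by (rule smooth_real_on_subset[rotated]) (use assms(2) in auto)
qed

lemma chart_Int_open: "(U, \<phi>) \<in> atlas M \<Longrightarrow> openin (mtop M) W \<Longrightarrow> openin (Euclidean_space (mdim M)) (\<phi> ` (U \<inter> W))"
  using chart_image_open[OF atlas_chart] topological_chartD(1)[OF atlas_chart] by blast

lemma smooth_fun_on_const: "openin (mtop M) W \<Longrightarrow> smooth_fun_on M W (\<lambda>_. c)"
  by (auto simp: smooth_fun_on_def comp_def intro!: smooth_real_on_const chart_Int_open)

lemma smooth_fun_on_add:
  "openin (mtop M) W \<Longrightarrow> smooth_fun_on M W f \<Longrightarrow> smooth_fun_on M W g \<Longrightarrow> smooth_fun_on M W (\<lambda>q. f q + g q)"
  by (auto simp: smooth_fun_on_def comp_def intro!: smooth_real_on_add chart_Int_open)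

lemma smooth_fun_on_mult:
  "openin (mtop M) W \<Longrightarrow> smooth_fun_on M W f \<Longrightarrow> smooth_fun_on M W g \<Longrightarrow> smooth_fun_on M W (\<lambda>q. f q * g q)"
  by (auto simp: smooth_fun_on_def comp_def intro!: smooth_real_on_mult chart_Int_open)

lemma openin_points: "openin (mtop M) (points M)"
  by simp

lemmas smooth_fun_const = smooth_fun_on_const[OF openin_points]
  and smooth_fun_add = smooth_fun_on_add[OF openin_points]
  and smooth_fun_mult = smooth_fun_on_mult[OF openin_points]

lemma smooth_fun_on_imp_continuous_map:
  assumes W: "openin (mtop M) W" and f: "smooth_fun_on M W f"
  shows "continuous_map (subtopology (mtop M) W) euclideanreal f"
proof (rule continuous_map_local)
  fix q assume "q \<in> topspace (subtopology (mtop M) W)"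
  then have q: "q \<in> points M" "q \<in> W" by auto
  then obtain U \<phi> where U: "(U, \<phi>) \<in> atlas M" "q \<in> U" using atlas_cover by blast
  note ch = atlas_chart[OF U(1)]
  have op: "openin (Euclidean_space (mdim M)) (\<phi> ` (U \<inter> W))" using chart_Int_open[OF U(1) W] .
  have "continuous_map (subtopology (Euclidean_space (mdim M)) (\<phi> ` (U \<inter> W))) euclideanreal (f \<circ> inv_into U \<phi>)"
    unfolding continuous_map_Euclidean_subset[OF op]
    by (rule smooth_imp_continuous_on[OF op smooth_fun_onD[OF f U(1)]])
  moreover have "continuous_map (subtopology (mtop M) (U \<inter> W))
      (subtopology (Euclidean_space (mdim M)) (\<phi> ` (U \<inter> W))) \<phi>"
    using topological_chartD(5)[OF ch]
    by (auto simp: continuous_map_in_subtopology intro: continuous_map_from_subtopology_mono)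
  ultimately have "continuous_map (subtopology (mtop M) (U \<inter> W)) euclideanreal (f \<circ> inv_into U \<phi> \<circ> \<phi>)"
    by (rule continuous_map_compose[rotated])
  then have "continuous_map (subtopology (mtop M) (U \<inter> W)) euclideanreal f"
    by (rule continuous_map_eq) (use topological_chartD(4)[OF ch] in auto)
  moreover have "openin (subtopology (mtop M) W) (U \<inter> W)"
    using topological_chartD(1)[OF ch] by (auto simp: openin_subtopology)
  moreover have "subtopology (subtopology (mtop M) W) (U \<inter> W) = subtopology (mtop M) (U \<inter> W)"
    by (simp add: subtopology_subtopology inf.absorb2)
  ultimately show "\<exists>T. openin (subtopology (mtop M) W) T \<and> q \<in> T \<and>
      continuous_map (subtopology (subtopology (mtop M) W) T) euclideanreal f"
    using q U(2) by (intro exI[of _ "U \<inter> W"]) auto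
qed

section \<open>Continuation by zero and cut-off functions\<close>

text \<open>\<open>A\<close> and the complement of \<open>K\<close> form an open cover, and on the
  complement the function is zero.\<close>

lemma smooth_fun_extend:
  assumes A: "openin (mtop M) A" and K: "closedin (mtop M) K" "K \<subseteq> A"
    and f: "smooth_fun_on M A f" "\<And>q. q \<in> points M \<Longrightarrow> q \<notin> K \<Longrightarrow> f q = 0"
  shows "smooth_fun M f"
proof (rule smooth_fun_on_local[OF openin_points])
  fix q assume q: "q \<in> points M"
  have op: "openin (mtop M) (points M - K)" using K(1) by blast
  have "smooth_fun_on M (points M - K) f"
    by (rule smooth_fun_on_cong_imp[OF smooth_fun_on_const[OF op] _ op mfd]) (use f(2) in auto)
  then show "\<exists>W'. openin (mtop M) W' \<and> q \<in> W' \<and> smooth_fun_on M W' f"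
    using A f(1) op q K(2) by blast
qed

text \<open>\<open>K\<close> corresponds to a closed cube in the coordinates, is therefore compact
  in \<open>M\<close>, and is closed because \<open>M\<close> is Hausdorff. This closedness is what
  permits continuation by zero.\<close>

lemma cutoff:
  assumes V: "smooth_coordinates M V x" and W: "openin (mtop M) W" and q: "q \<in> V" "q \<in> W"
  obtains \<theta> K N where "smooth_fun M \<theta>" "closedin (mtop M) K" "K \<subseteq> W" "\<And>r. r \<notin> K \<Longrightarrow> \<theta> r = 0"
    "openin (mtop M) N" "q \<in> N" "N \<subseteq> K" "K \<subseteq> V" "\<And>r. r \<in> N \<Longrightarrow> \<theta> r = 1"
proof -
  let ?n = "mdim M"
  note ch = coordinates_chart[OF V]
  have VW: "openin (mtop M) (V \<inter> W)" using W topological_chartD(1)[OF ch] by blast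
  define A where "A = x ` (V \<inter> W)"
  have A: "openin (Euclidean_space ?n) A" unfolding A_def by (rule chart_image_open[OF ch VW]) auto
  then obtain R where R: "R > 0" "cube ?n (x q) R \<subseteq> A"
    using openin_imp_cube_subset[of ?n A "x q"] q by (auto simp: A_def)
  \<comment> \<open>Half of \<open>R\<close>, so that the closed cube still lies in the chart
    image.\<close>
  define r where "r = R / 2"
  have r: "r > 0" "closed_cube ?n (x q) r \<subseteq> A" "r < R"
    using R closed_cube_subset_cube[of r R ?n "x q"] by (auto simp: r_def)
  define K where "K = inv_into V x ` closed_cube ?n (x q) r"
  define N where "N = {z \<in> V. x z \<in> cube ?n (x q) (r / 2)}"
  define \<theta> where "\<theta> z = (if z \<in> V then bump ?n (x q) r (x z) else 0)" for z
  have AV: "A \<subseteq> x ` V" by (auto simp: A_def)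
  have inv: "inv_into V x (x z) = z" if "z \<in> V" for z
    using topological_chartD(4)[OF ch] that by simp
  have xn: "\<forall>i\<ge>?n. x z i = 0" if "z \<in> V" for z
    using openin_Euclidean_subset[OF topological_chartD(3)[OF ch]] that by blast
  have K_iff: "z \<in> K \<longleftrightarrow> z \<in> V \<and> x z \<in> closed_cube ?n (x q) r" for z
  proof
    assume "z \<in> K"
    then obtain y where y: "y \<in> closed_cube ?n (x q) r" "z = inv_into V x y" by (auto simp: K_def)
    then have "y \<in> x ` V" using r(2) AV by auto
    then show "z \<in> V \<and> x z \<in> closed_cube ?n (x q) r"
      using y by (auto simp: f_inv_into_f inv_into_into)
  next
    assume "z \<in> V \<and> x z \<in> closed_cube ?n (x q) r"
    then show "z \<in> K" using inv[of z] unfolding K_def by force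
  qed
  have "compactin (mtop M) K"
  proof -
    have "compactin (subtopology (Euclidean_space ?n) (x ` V)) (closed_cube ?n (x q) r)"
      using compact_closed_cube r(2) AV subtopology_Euclidean_space[OF openin_subset[OF topological_chartD(3)[OF ch]]]
      by (simp add: compactin_subtopology)
    then have "compactin (subtopology (mtop M) V) K"
      unfolding K_def by (rule image_compactin[OF _ topological_chartD(6)[OF ch]])
    then show ?thesis by (simp add: compactin_subtopology)
  qed
  then have Kcl: "closedin (mtop M) K"
    using mfd compactin_imp_closedin by (auto simp: smooth_manifold_def)
  have \<theta>0: "\<theta> z = 0" if "z \<notin> K" for z
  proof (cases "z \<in> V")
    case True
    then have "x z \<notin> cube ?n (x q) r"
      using that K_iff cube_subset_closed_cube by blast
    then show ?thesis using bump_eq_0[OF r(1) xn[OF True]] True by (simp add: \<theta>_def)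
  qed (simp add: \<theta>_def)
  have "smooth_real_on ?n (x ` V) (\<theta> \<circ> inv_into V x)"
    by (rule smooth_real_on_cong_imp[OF topological_chartD(3)[OF ch] _ smooth_bump[OF topological_chartD(3)[OF ch] r(1)]])
      (auto simp: \<theta>_def inv)
  then have "smooth_fun_on M V \<theta>"
    by (intro smooth_fun_onI_coordinates[OF V topological_chartD(1)[OF ch]]) auto
  then have "smooth_fun M \<theta>"
    using \<theta>0 K_iff by (intro smooth_fun_extend[OF topological_chartD(1)[OF ch] Kcl]) auto
  moreover have "K \<subseteq> W"
  proof
    fix z assume "z \<in> K"
    then have "z \<in> V" "x z \<in> A" using r(2) K_iff by auto
    then obtain w where "w \<in> V" "w \<in> W" "x z = x w" by (auto simp: A_def)
    then show "z \<in> W" using inv \<open>z \<in> V\<close> by metis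
  qed
  moreover have "openin (mtop M) N"
    unfolding N_def by (rule chart_preimage_open[OF ch openin_cube])
  moreover have "q \<in> N" using q xn[OF q(1)] r(1) by (auto simp: N_def cube_def)
  moreover have "N \<subseteq> K"
  proof
    fix z assume "z \<in> N"
    then have "z \<in> V" "x z \<in> cube ?n (x q) (r / 2)" by (auto simp: N_def)
    then show "z \<in> K" using K_iff closed_cube_subset_cube cube_subset_closed_cube[of ?n "x q" r]
        cube_mono[of "r / 2" r ?n "x q"] r(1) by auto
  qed
  moreover have "\<theta> z = 1" if "z \<in> N" for z
    using that bump_eq_1[OF r(1)] by (auto simp: \<theta>_def N_def)
  ultimately show ?thesis
    using that[of \<theta> K N] Kcl \<theta>0 K_iff by blast
qed

end

subsection \<open>Sections and local trivializations\<close>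

lemma smooth_map_charts:
  assumes "smooth_map M N f" "(U, \<phi>) \<in> atlas M" "(V, \<psi>) \<in> atlas N" "j < mdim N"
  shows "smooth_real_on (mdim M) (\<phi> ` (U \<inter> f -` V)) (\<lambda>y. \<psi> (f (inv_into U \<phi> y)) j)"
proof -
  have *: "\<forall>(U, \<phi>) \<in> atlas M. \<forall>(V, \<psi>) \<in> atlas N.
      smooth_vec_on (mdim M) (mdim N) (\<phi> ` (U \<inter> f -` V)) (\<psi> \<circ> f \<circ> inv_into U \<phi>)"
    using assms(1) by (simp add: smooth_map_def)
  show ?thesis
    using bspec[OF * assms(2)] assms(3,4) by (auto simp: smooth_vec_on_def)
qed

lemma smooth_map_continuous: "smooth_map M N f \<Longrightarrow> continuous_map (mtop M) (mtop N) f"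
  by (simp add: smooth_map_def)

lemma open_submfd_simps:
  "mtop (open_submfd M W) = subtopology (mtop M) W" "mdim (open_submfd M W) = mdim M"
  "(U, \<phi>) \<in> atlas M \<Longrightarrow> (U \<inter> W, \<phi>) \<in> atlas (open_submfd M W)"
  by (auto simp: open_submfd_def)

text \<open>The form that the charts of \<open>prod_mfd\<close> take for a trivial bundle, where the
  fibre factor has the identity as its chart.\<close>

definition prod_chart :: "nat \<Rightarrow> ('m \<Rightarrow> nat \<Rightarrow> real) \<Rightarrow> 'm \<times> (nat \<Rightarrow> real) \<Rightarrow> nat \<Rightarrow> real" where
  "prod_chart n \<phi> = (\<lambda>(a, b) i. if i < n then \<phi> a i else b (i - n))"

abbreviation trivial_bundle :: "'m mfd \<Rightarrow> 'm set \<Rightarrow> nat \<Rightarrow> ('m \<times> (nat \<Rightarrow> real)) mfd" where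
  "trivial_bundle M U k \<equiv> prod_mfd (open_submfd M U) (euclidean_mfd k)"

lemma trivial_bundle_simps:
  "mtop (trivial_bundle M U k) = prod_topology (subtopology (mtop M) U) (Euclidean_space k)"
  "mdim (trivial_bundle M U k) = mdim M + k"
  "(A, \<phi>) \<in> atlas M \<Longrightarrow>
     ((A \<inter> U) \<times> topspace (Euclidean_space k), prod_chart (mdim M) \<phi>) \<in> atlas (trivial_bundle M U k)"
proof -
  show "mtop (trivial_bundle M U k) = prod_topology (subtopology (mtop M) U) (Euclidean_space k)"
    "mdim (trivial_bundle M U k) = mdim M + k"
    by (simp_all add: prod_mfd_def open_submfd_def euclidean_mfd_def)
  assume "(A, \<phi>) \<in> atlas M"
  then have "(A \<inter> U, \<phi>) \<in> atlas (open_submfd M U)" by (rule open_submfd_simps(3))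
  moreover have "(topspace (Euclidean_space k), \<lambda>x. x) \<in> atlas (euclidean_mfd k)"
    by (simp add: euclidean_mfd_def)
  moreover have "prod_chart (mdim M) \<phi> =
      (\<lambda>(a, b) i. if i < mdim (open_submfd M U) then \<phi> a i else (\<lambda>x. x) b (i - mdim (open_submfd M U)))"
    unfolding prod_chart_def open_submfd_simps(2) ..
  ultimately show "((A \<inter> U) \<times> topspace (Euclidean_space k), prod_chart (mdim M) \<phi>) \<in> atlas (trivial_bundle M U k)"
    unfolding prod_mfd_def mfd.simps mem_Collect_eq
    by (intro exI[of _ "A \<inter> U"] exI[of _ \<phi>] exI[of _ "topspace (Euclidean_space k)"]
        exI[of _ "\<lambda>x. x"] conjI) simp_all
qed

lemma chart_ge: "topological_chart M A \<phi> \<Longrightarrow> a \<in> A \<Longrightarrow> i \<ge> mdim M \<Longrightarrow> \<phi> a i = 0"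
  by (rule openin_Euclidean_subset[OF topological_chartD(3) imageI])

text \<open>The entries from \<open>mdim M\<close> on belong to \<open>b\<close>, but no information
  about \<open>a\<close> is lost there: \<open>\<phi> a\<close> vanishes from that index on.\<close>

lemma inj_on_prod_chart:
  assumes "topological_chart M A \<phi>"
  shows "inj_on (prod_chart (mdim M) \<phi>) (A \<times> T)"
proof (rule inj_onI, clarify)
  fix a b a' b' assume a: "a \<in> A" "a' \<in> A" and eq: "prod_chart (mdim M) \<phi> (a, b) = prod_chart (mdim M) \<phi> (a', b')"
  have "\<phi> a i = \<phi> a' i" for i
    using fun_cong[OF eq, of i] chart_ge[OF assms a(1), of i] chart_ge[OF assms a(2), of i]
    by (cases "i < mdim M") (auto simp: prod_chart_def)
  then have "\<phi> a = \<phi> a'" by (rule ext)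
  then have "a = a'" using topological_chartD(4)[OF assms] a by (auto simp: inj_on_def)
  moreover have "b i = b' i" for i
    using fun_cong[OF eq, of "mdim M + i"] by (simp add: prod_chart_def)
  ultimately show "a = a' \<and> b = b'" by auto
qed

text \<open>The chart has the continuous inverse \<open>\<iota>\<close>, which reads off the first
  \<open>mdim M\<close> and the next \<open>k\<close> coordinates; the image of \<open>Q\<close> is
  the preimage of \<open>Q\<close> under \<open>\<iota>\<close>.\<close>

lemma prod_chart_image_open:
  assumes ch: "topological_chart M A \<phi>"
    and Q: "openin (prod_topology (mtop M) (Euclidean_space k)) Q" "Q \<subseteq> A \<times> topspace (Euclidean_space k)"
  shows "openin (Euclidean_space (mdim M + k)) (prod_chart (mdim M) \<phi> ` Q)"
proof -
  let ?n = "mdim M" and ?X = "Euclidean_space (mdim M + k)"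
  define hd :: "(nat \<Rightarrow> real) \<Rightarrow> nat \<Rightarrow> real" where "hd z = (\<lambda>i. if i < ?n then z i else 0)" for z
  define tl :: "(nat \<Rightarrow> real) \<Rightarrow> nat \<Rightarrow> real" where "tl z = (\<lambda>i. if i < k then z (?n + i) else 0)" for z
  define S where "S = {z \<in> topspace ?X. hd z \<in> \<phi> ` A}"
  have coord: "continuous_map ?X euclideanreal (\<lambda>z. z i)" for i
    by (simp add: Euclidean_space_eq_top_of_set continuous_on_coordinate)
  have hd: "continuous_map ?X (Euclidean_space ?n) hd" and tl: "continuous_map ?X (Euclidean_space k) tl"
    unfolding hd_def tl_def continuous_map_componentwise_Euclidean_space using coord by auto
  have S: "openin ?X S"
    unfolding S_def by (rule openin_continuous_map_preimage[OF hd topological_chartD(3)[OF ch]])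
  define \<iota> where "\<iota> z = (inv_into A \<phi> (hd z), tl z)" for z
  have "continuous_map (subtopology ?X S) (subtopology (Euclidean_space ?n) (\<phi> ` A)) hd"
    using hd by (auto simp: continuous_map_in_subtopology S_def intro: continuous_map_from_subtopology)
  from continuous_map_compose[OF this topological_chartD(6)[OF ch]]
  have "continuous_map (subtopology ?X S) (mtop M) (\<lambda>z. inv_into A \<phi> (hd z))"
    by (simp add: comp_def continuous_map_in_subtopology)
  then have "continuous_map (subtopology ?X S) (prod_topology (mtop M) (Euclidean_space k)) \<iota>"
    unfolding \<iota>_def by (intro continuous_map_pairedI continuous_map_from_subtopology[OF tl])
  then have "openin (subtopology ?X S) {z \<in> topspace (subtopology ?X S). \<iota> z \<in> Q}"
    by (rule openin_continuous_map_preimage[OF _ Q(1)])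
  then have "openin ?X {z \<in> topspace (subtopology ?X S). \<iota> z \<in> Q}"
    using openin_trans_full S by blast
  moreover have "prod_chart ?n \<phi> ` Q = {z \<in> topspace (subtopology ?X S). \<iota> z \<in> Q}"
  proof (intro equalityI subsetI)
    fix z assume "z \<in> prod_chart ?n \<phi> ` Q"
    then obtain a b where ab: "(a, b) \<in> Q" "z = prod_chart ?n \<phi> (a, b)" by auto
    have a: "a \<in> A" and b: "\<forall>i\<ge>k. b i = 0"
      using ab(1) Q(2) by (auto simp: topspace_Euclidean_space)
    have "hd z = \<phi> a" using chart_ge[OF ch a] by (auto simp: hd_def ab(2) prod_chart_def fun_eq_iff)
    moreover have "tl z = b" using b by (auto simp: tl_def ab(2) prod_chart_def fun_eq_iff)
    moreover have "z \<in> topspace ?X"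
      using b by (auto simp: topspace_Euclidean_space ab(2) prod_chart_def)
    ultimately show "z \<in> {z \<in> topspace (subtopology ?X S). \<iota> z \<in> Q}"
      using ab(1) a topological_chartD(4)[OF ch] by (auto simp: S_def \<iota>_def)
  next
    fix z assume z: "z \<in> {z \<in> topspace (subtopology ?X S). \<iota> z \<in> Q}"
    then have zS: "hd z \<in> \<phi> ` A" "z \<in> topspace ?X" and zQ: "\<iota> z \<in> Q" by (auto simp: S_def)
    have "prod_chart ?n \<phi> (\<iota> z) i = z i" for i
    proof -
      have "\<phi> (inv_into A \<phi> (hd z)) = hd z" using zS(1) by (rule f_inv_into_f)
      then show ?thesis
        using zS(2) by (auto simp: prod_chart_def \<iota>_def hd_def tl_def topspace_Euclidean_space)
    qed
    then show "z \<in> prod_chart ?n \<phi> ` Q" using zQ by (metis ext image_eqI)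
  qed
  ultimately show ?thesis by simp
qed

section \<open>Sections and their components in a trivialization\<close>

locale smooth_bundle = smooth_mfd M for M :: "'m mfd" +
  fixes k :: nat and E :: "('e, 'm) vbundle"
  assumes vbundle: "smooth_vector_bundle M k E"
begin

abbreviation "P \<equiv> points M"
abbreviation "Rk \<equiv> topspace (Euclidean_space k)"
abbreviation "triv \<equiv> local_trivialization M k E"

sublocale total: smooth_mfd "total E"
  using vbundle by unfold_locales (simp add: smooth_vector_bundle_def)

lemma proj_continuous: "continuous_map (mtop (total E)) (mtop M) (proj E)"
  using vbundle by (auto simp: smooth_vector_bundle_def intro: smooth_map_continuous)

lemma triv_exists:
  assumes "q \<in> P" obtains U \<Phi> where "q \<in> U" "triv U \<Phi>"
  using vbundle assms unfolding smooth_vector_bundle_def by blast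

lemma fibre_iff: "e \<in> fibre E q \<longleftrightarrow> e \<in> points (total E) \<and> proj E e = q"
  by (simp add: preimage_def)

lemma trivD:
  assumes "triv U \<Phi>"
  shows "openin (mtop M) U" "U \<subseteq> P"
    "bij_betw (\<lambda>e. (proj E e, \<Phi> e)) (preimage E U) (U \<times> Rk)"
    "smooth_map (open_submfd (total E) (preimage E U)) (trivial_bundle M U k)
       (\<lambda>e. (proj E e, \<Phi> e))"
    "smooth_map (trivial_bundle M U k) (open_submfd (total E) (preimage E U))
       (inv_into (preimage E U) (\<lambda>e. (proj E e, \<Phi> e)))"
    "\<And>q e e'. q \<in> U \<Longrightarrow> e \<in> fibre E q \<Longrightarrow> e' \<in> fibre E q \<Longrightarrow> \<Phi> (vadd E e e') i = \<Phi> e i + \<Phi> e' i"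
    "\<And>q c e. q \<in> U \<Longrightarrow> e \<in> fibre E q \<Longrightarrow> \<Phi> (vscale E c e) i = c * \<Phi> e i"
proof -
  show U: "openin (mtop M) U" using assms by (simp add: local_trivialization_def)
  then show UP: "U \<subseteq> P" by (rule openin_subset)
  have pE: "points (open_submfd (total E) (preimage E U)) = preimage E U"
    by (auto simp: open_submfd_simps preimage_def)
  have "points (trivial_bundle M U k) = U \<times> Rk"
    using UP by (auto simp: trivial_bundle_simps)
  with pE show "bij_betw (\<lambda>e. (proj E e, \<Phi> e)) (preimage E U) (U \<times> Rk)"
    "smooth_map (open_submfd (total E) (preimage E U)) (trivial_bundle M U k)
       (\<lambda>e. (proj E e, \<Phi> e))"
    "smooth_map (trivial_bundle M U k) (open_submfd (total E) (preimage E U))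
       (inv_into (preimage E U) (\<lambda>e. (proj E e, \<Phi> e)))"
    using assms by (simp_all add: local_trivialization_def diffeomorphism_def)
  show "\<Phi> (vadd E e e') i = \<Phi> e i + \<Phi> e' i" if "q \<in> U" "e \<in> fibre E q" "e' \<in> fibre E q" for q e e'
    using assms that by (simp add: local_trivialization_def)
  show "\<Phi> (vscale E c e) i = c * \<Phi> e i" if "q \<in> U" "e \<in> fibre E q" for q c e
    using assms that by (simp add: local_trivialization_def)
qed

text \<open>Components from index \<open>k\<close> on vanish, since a trivialization takes its
  values in k-space. Equations between vectors of a fibre are thereby reduced to equations between
  real numbers.\<close>

lemma triv_inj:
  assumes "triv U \<Phi>" "q \<in> U" "e \<in> fibre E q" "e' \<in> fibre E q" "\<And>a. a < k \<Longrightarrow> \<Phi> e a = \<Phi> e' a"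
  shows "e = e'"
proof -
  have e: "e \<in> preimage E U" "e' \<in> preimage E U" "proj E e = q" "proj E e' = q"
    using assms(2-4) by (auto simp: preimage_def)
  have "\<Phi> e \<in> Rk" "\<Phi> e' \<in> Rk"
    using bij_betw_apply[OF trivD(3)[OF assms(1)] e(1)] bij_betw_apply[OF trivD(3)[OF assms(1)] e(2)] by auto
  then have "\<Phi> e a = \<Phi> e' a" for a
    using assms(5) by (cases "a < k") (auto simp: topspace_Euclidean_space)
  then have "(proj E e, \<Phi> e) = (proj E e', \<Phi> e')" using e by auto
  then show ?thesis
    using bij_betw_imp_inj_on[OF trivD(3)[OF assms(1)]] e(1,2) by (auto simp: inj_on_def)
qed

lemma smooth_section_continuous: "smooth_section M E P s \<Longrightarrow> continuous_map (mtop M) (mtop (total E)) s"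
  by (simp add: smooth_section_def smooth_map_def open_submfd_simps)

lemma smooth_section_fibre: "smooth_section M E P s \<Longrightarrow> q \<in> P \<Longrightarrow> s q \<in> fibre E q"
  by (simp add: smooth_section_def)

text \<open>In charts the component is a coordinate of the trivialization after the section, a
  composition of two smooth expressions through a chart of the total space.\<close>

lemma section_component_smooth:
  assumes s: "smooth_section M E P s" and tr: "triv U \<Phi>" and a: "a < k"
  shows "smooth_fun_on M U (\<lambda>q. \<Phi> (s q) a)"
  unfolding smooth_fun_on_def
proof clarify
  fix A \<phi> assume A: "(A, \<phi>) \<in> atlas M"
  let ?n = "mdim M" and ?N = "mdim (total E)" and ?F = "\<lambda>e. (proj E e, \<Phi> e)"
  note chA = atlas_chart[OF A]
  have AP: "A \<inter> P = A" using topological_chartD(2)[OF chA] by auto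
  show "smooth_real_on ?n (\<phi> ` (A \<inter> U)) ((\<lambda>q. \<Phi> (s q) a) \<circ> inv_into A \<phi>)"
  proof (rule smooth_real_on_local[OF chart_Int_open[OF A trivD(1)[OF tr]]])
    fix y assume "y \<in> \<phi> ` (A \<inter> U)"
    then obtain q where q: "q \<in> A" "q \<in> U" "y = \<phi> q" by auto
    then have qP: "q \<in> P" using trivD(2)[OF tr] by auto
    note sq = smooth_section_fibre[OF s qP]
    obtain B \<beta> where B: "(B, \<beta>) \<in> atlas (total E)" "s q \<in> B"
      using sq total.atlas_cover by (auto simp: fibre_iff)
    note chB = total.atlas_chart[OF B(1)]
    \<comment> \<open>The part of the chart domain that lies over \<open>A \<inter> U\<close>. As
      \<open>proj E (s r) = r\<close>, membership of \<open>s r\<close> in \<open>B'\<close> puts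
      \<open>r\<close> into \<open>A \<inter> U\<close>.\<close>
    define B' where "B' = B \<inter> {e \<in> points (total E). proj E e \<in> A \<inter> U}"
    have B': "openin (mtop (total E)) B'"
      unfolding B'_def
      by (intro openin_Int topological_chartD(1)[OF chB] openin_continuous_map_preimage[OF proj_continuous]
          topological_chartD(1)[OF chA] trivD(1)[OF tr])
    define W where "W = {r \<in> P. s r \<in> B'}"
    have W: "openin (mtop M) W"
      unfolding W_def by (rule openin_continuous_map_preimage[OF smooth_section_continuous[OF s] B'])
    have pr: "proj E (s r) = r" if "r \<in> P" for r
      using smooth_section_fibre[OF s that] by (simp add: fibre_iff)
    have WA: "W \<subseteq> A \<inter> U" using pr by (auto simp: W_def B'_def)
    \<comment> \<open>In the product chart the fibre component \<open>a\<close> has index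
      \<open>mdim M + a\<close>.\<close>
    have smF: "smooth_real_on ?N (\<beta> ` B') (\<lambda>z. prod_chart ?n \<phi> (?F (inv_into (B \<inter> preimage E U) \<beta> z)) (?n + a))"
    proof -
      have "smooth_real_on ?N (\<beta> ` (B \<inter> preimage E U \<inter> ?F -` ((A \<inter> U) \<times> Rk)))
          (\<lambda>z. prod_chart ?n \<phi> (?F (inv_into (B \<inter> preimage E U) \<beta> z)) (?n + a))"
        using smooth_map_charts[OF trivD(4)[OF tr] open_submfd_simps(3)[OF B(1)] trivial_bundle_simps(3)[OF A],
            where j="?n + a"] a
        by (simp add: open_submfd_simps trivial_bundle_simps)
      moreover have "B \<inter> preimage E U \<inter> ?F -` ((A \<inter> U) \<times> Rk) = B'"
        using bij_betw_apply[OF trivD(3)[OF tr]] topological_chartD(2)[OF chB]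
        by (auto simp: B'_def preimage_def)
      ultimately show ?thesis by simp
    qed
    have oW: "openin (Euclidean_space ?n) (\<phi> ` W)"
      using chart_image_open[OF chA W] WA by auto
    have oB: "openin (Euclidean_space ?N) (\<beta> ` B')"
      using chart_image_open[OF chB B'] by (auto simp: B'_def)
    have inv: "inv_into A \<phi> (\<phi> r) = r" if "r \<in> W" for r
      using topological_chartD(4)[OF chA] that WA by auto
    have invB: "inv_into (B \<inter> preimage E U) \<beta> (\<beta> e) = e" if "e \<in> B'" for e
    proof -
      have "inj_on \<beta> (B \<inter> preimage E U)"
        using topological_chartD(4)[OF chB] by (rule inj_on_subset) auto
      moreover have "e \<in> B \<inter> preimage E U" using that by (auto simp: B'_def preimage_def)
      ultimately show ?thesis by simp
    qed
    have "smooth_real_on ?n (\<phi> ` W) (\<lambda>y. prod_chart ?n \<phi> (?F (inv_into (B \<inter> preimage E U) \<beta>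
        (\<beta> (s (inv_into A \<phi> y))))) (?n + a))"
    proof (rule smooth_real_on_compose[OF oB oW smF])
      show "smooth_real_on ?n (\<phi> ` W) (\<lambda>y. \<beta> (s (inv_into A \<phi> y)) j)" if "j < ?N" for j
      proof (rule smooth_real_on_subset)
        have "smooth_map (open_submfd M P) (total E) s" using s by (simp add: smooth_section_def)
        from smooth_map_charts[OF this open_submfd_simps(3)[OF A] B(1) that]
        show "smooth_real_on ?n (\<phi> ` (A \<inter> s -` B)) (\<lambda>y. \<beta> (s (inv_into A \<phi> y)) j)"
          by (simp add: open_submfd_simps AP)
      qed (use WA in \<open>auto simp: W_def B'_def\<close>)
    qed (auto simp: inv W_def)
    then have "smooth_real_on ?n (\<phi> ` W) ((\<lambda>q. \<Phi> (s q) a) \<circ> inv_into A \<phi>)"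
      by (rule smooth_real_on_cong_imp[OF oW, rotated])
        (auto simp: inv invB W_def prod_chart_def)
    then have "smooth_real_on ?n (\<phi> ` (A \<inter> U) \<inter> \<phi> ` W) ((\<lambda>q. \<Phi> (s q) a) \<circ> inv_into A \<phi>)"
      by (rule smooth_real_on_subset[rotated]) auto
    moreover have "q \<in> W" using q B(2) qP sq by (auto simp: W_def B'_def preimage_def)
    ultimately show "\<exists>T. openin (Euclidean_space ?n) T \<and> y \<in> T \<and>
        smooth_real_on ?n (\<phi> ` (A \<inter> U) \<inter> T) ((\<lambda>q. \<Phi> (s q) a) \<circ> inv_into A \<phi>)"
      using oW q(3) by blast
  qed
qed

lemma triv_inverse:
  assumes "triv U \<Phi>" "r \<in> U" "e \<in> fibre E r"
  shows "inv_into (preimage E U) (\<lambda>e. (proj E e, \<Phi> e)) (r, \<Phi> e) = e" "\<Phi> e \<in> Rk"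
proof -
  have e: "e \<in> preimage E U" "proj E e = r" using assms(2,3) by (auto simp: preimage_def)
  show "inv_into (preimage E U) (\<lambda>e. (proj E e, \<Phi> e)) (r, \<Phi> e) = e"
    using inv_into_f_f[OF bij_betw_imp_inj_on[OF trivD(3)[OF assms(1)]] e(1)] e(2) by simp
  show "\<Phi> e \<in> Rk" using bij_betw_apply[OF trivD(3)[OF assms(1)] e(1)] by auto
qed

text \<open>The section is the inverse trivialization applied to \<open>(r, \<Phi> (s r))\<close>.
  Continuity is established before smoothness, because the sets on which chart expressions are
  tested have to be open.\<close>

lemma continuous_map_from_components:
  assumes tr: "triv U \<Phi>" and W: "openin (mtop M) W" "W \<subseteq> U"
    and s: "\<And>r. r \<in> W \<Longrightarrow> s r \<in> fibre E r"
    and sm: "\<And>a. a < k \<Longrightarrow> smooth_fun_on M W (\<lambda>r. \<Phi> (s r) a)"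
  shows "continuous_map (subtopology (mtop M) W) (mtop (total E)) s"
proof -
  let ?X = "subtopology (mtop M) W" and ?\<Psi> = "inv_into (preimage E U) (\<lambda>e. (proj E e, \<Phi> e))"
  have inv: "?\<Psi> (r, \<Phi> (s r)) = s r" "\<Phi> (s r) \<in> Rk" if "r \<in> W" for r
    using triv_inverse[OF tr _ s[OF that]] that W(2) by blast+
  have "continuous_map ?X (Euclidean_space k) (\<lambda>r i. if i < k then \<Phi> (s r) i else 0)"
    unfolding continuous_map_componentwise_Euclidean_space
    using smooth_fun_on_imp_continuous_map[OF W(1) sm] by blast
  then have "continuous_map ?X (Euclidean_space k) (\<lambda>r. \<Phi> (s r))"
    by (rule continuous_map_eq) (use inv(2) in \<open>fastforce simp: topspace_Euclidean_space fun_eq_iff\<close>)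
  moreover have "continuous_map ?X (subtopology (mtop M) U) (\<lambda>r. r)"
    using W(2) by (auto simp: continuous_map_in_subtopology)
  ultimately have "continuous_map ?X (prod_topology (subtopology (mtop M) U) (Euclidean_space k)) (\<lambda>r. (r, \<Phi> (s r)))"
    by (rule continuous_map_pairedI[rotated])
  moreover have "continuous_map (prod_topology (subtopology (mtop M) U) (Euclidean_space k)) (mtop (total E)) ?\<Psi>"
    using smooth_map_continuous[OF trivD(5)[OF tr]]
    by (simp add: trivial_bundle_simps open_submfd_simps continuous_map_in_subtopology)
  ultimately have "continuous_map ?X (mtop (total E)) (?\<Psi> \<circ> (\<lambda>r. (r, \<Phi> (s r))))"
    by (rule continuous_map_compose)
  then show ?thesis
    by (rule continuous_map_eq) (use inv(1) in auto)
qed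

text \<open>The criterion by which the sections constructed below are recognised as smooth. The
  trivialization may change from point to point, so a section given by different formulas in
  different regions is covered.\<close>

lemma smooth_sectionI:
  assumes fib: "\<And>q. q \<in> P \<Longrightarrow> s q \<in> fibre E q"
    and loc: "\<And>q. q \<in> P \<Longrightarrow> \<exists>U \<Phi> W. triv U \<Phi> \<and> openin (mtop M) W \<and> q \<in> W \<and> W \<subseteq> U \<and>
      (\<forall>a<k. smooth_fun_on M W (\<lambda>r. \<Phi> (s r) a))"
  shows "smooth_section M E P s"
proof -
  let ?n = "mdim M" and ?N = "mdim (total E)"
  have cont: "continuous_map (mtop M) (mtop (total E)) s"
  proof (rule continuous_map_local)
    fix q assume "q \<in> P"
    then obtain U \<Phi> W where W: "triv U \<Phi>" "openin (mtop M) W" "q \<in> W" "W \<subseteq> U"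
        "\<And>a. a < k \<Longrightarrow> smooth_fun_on M W (\<lambda>r. \<Phi> (s r) a)"
      using loc by blast
    have "continuous_map (subtopology (mtop M) W) (mtop (total E)) s"
      using W(2) openin_subset by (intro continuous_map_from_components[OF W(1,2,4) fib W(5)]) auto
    then show "\<exists>W. openin (mtop M) W \<and> q \<in> W \<and> continuous_map (subtopology (mtop M) W) (mtop (total E)) s"
      using W by blast
  qed
  have smooth: "smooth_real_on ?n (\<phi> ` (A \<inter> s -` B)) (\<lambda>y. \<beta> (s (inv_into A \<phi> y)) j)"
    if A: "(A, \<phi>) \<in> atlas M" and B: "(B, \<beta>) \<in> atlas (total E)" and j: "j < ?N" for A \<phi> B \<beta> j
  proof -
    note chA = atlas_chart[OF A] and chB = total.atlas_chart[OF B]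
    have AP: "A \<subseteq> P" using topological_chartD(2)[OF chA] .
    have AsB: "openin (mtop M) (A \<inter> s -` B)"
    proof -
      have "openin (mtop M) {r \<in> P. s r \<in> B}"
        by (rule openin_continuous_map_preimage[OF cont topological_chartD(1)[OF chB]])
      then have "openin (mtop M) (A \<inter> {r \<in> P. s r \<in> B})"
        using topological_chartD(1)[OF chA] by (rule openin_Int[rotated])
      moreover have "A \<inter> {r \<in> P. s r \<in> B} = A \<inter> s -` B" using AP by auto
      ultimately show ?thesis by simp
    qed
    have oA: "openin (Euclidean_space ?n) (\<phi> ` W)" if "openin (mtop M) W" "W \<subseteq> A" for W
      using chart_image_open[OF chA that] .
    show ?thesis
    proof (rule smooth_real_on_local[OF oA[OF AsB Int_lower1]])
      fix y assume "y \<in> \<phi> ` (A \<inter> s -` B)"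
      then obtain q where q: "q \<in> A" "s q \<in> B" "y = \<phi> q" by auto
      then have "q \<in> P" using AP by auto
      then obtain U \<Phi> W where W: "triv U \<Phi>" "openin (mtop M) W" "q \<in> W" "W \<subseteq> U"
          "\<And>a. a < k \<Longrightarrow> smooth_fun_on M W (\<lambda>r. \<Phi> (s r) a)"
        using loc by blast
      let ?\<Psi> = "inv_into (preimage E U) (\<lambda>e. (proj E e, \<Phi> e))" and ?\<theta> = "prod_chart ?n \<phi>"
      define W' where "W' = (A \<inter> s -` B) \<inter> W"
      have oW': "openin (Euclidean_space ?n) (\<phi> ` W')"
        using oA[of W'] AsB W(2) by (auto simp: W'_def)
      have W'P: "r \<in> U" "r \<in> P" if "r \<in> W'" for r
        using that AP W(4) by (auto simp: W'_def)
      have inv: "?\<Psi> (r, \<Phi> (s r)) = s r" "\<Phi> (s r) \<in> Rk" if "r \<in> W'" for r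
        using triv_inverse[OF W(1) W'P(1)[OF that] fib[OF W'P(2)[OF that]]] by auto
      have invA: "inv_into A \<phi> (\<phi> r) = r" if "r \<in> W'" for r
        using topological_chartD(4)[OF chA] that by (auto simp: W'_def)
      \<comment> \<open>The points of the product chart that the inverse trivialization sends into
        \<open>B\<close>: the domain on which its expression in charts is known to be
        smooth.\<close>
      define Q where "Q = (A \<inter> U) \<times> Rk \<inter> ?\<Psi> -` (B \<inter> preimage E U)"
      have oQ: "openin (Euclidean_space (?n + k)) (?\<theta> ` Q)"
      proof (rule prod_chart_image_open[OF chA])
        let ?Z = "prod_topology (subtopology (mtop M) U) (Euclidean_space k)"
        have "continuous_map ?Z (mtop (total E)) ?\<Psi>" "?\<Psi> \<in> topspace ?Z \<rightarrow> preimage E U"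
          using smooth_map_continuous[OF trivD(5)[OF W(1)]]
          by (auto simp: trivial_bundle_simps open_submfd_simps continuous_map_in_subtopology)
        then have "openin ?Z {z \<in> topspace ?Z. ?\<Psi> z \<in> B}"
          using openin_continuous_map_preimage topological_chartD(1)[OF chB] by blast
        moreover have "openin ?Z ((A \<inter> U) \<times> Rk)"
          using topological_chartD(1)[OF chA] trivD(1)[OF W(1)]
          by (auto simp: openin_prod_Times_iff openin_subtopology)
        ultimately have "openin ?Z ((A \<inter> U) \<times> Rk \<inter> {z \<in> topspace ?Z. ?\<Psi> z \<in> B})"
          by (rule openin_Int[rotated])
        moreover have "(A \<inter> U) \<times> Rk \<inter> {z \<in> topspace ?Z. ?\<Psi> z \<in> B} = Q"
          using AP \<open>?\<Psi> \<in> topspace ?Z \<rightarrow> preimage E U\<close> by (auto simp: Q_def)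
        ultimately have "openin ?Z Q" by simp
        moreover have "?Z = subtopology (prod_topology (mtop M) (Euclidean_space k)) (U \<times> Rk)"
          by (simp add: subtopology_Times)
        moreover have "openin (prod_topology (mtop M) (Euclidean_space k)) (U \<times> Rk)"
          using trivD(1)[OF W(1)] by (simp add: openin_prod_Times_iff)
        ultimately show "openin (prod_topology (mtop M) (Euclidean_space k)) Q"
          using openin_trans_full by metis
      qed (auto simp: Q_def)
      have smQ: "smooth_real_on (?n + k) (?\<theta> ` Q) (\<lambda>z. \<beta> (?\<Psi> (inv_into ((A \<inter> U) \<times> Rk) ?\<theta> z)) j)"
        using smooth_map_charts[OF trivD(5)[OF W(1)] trivial_bundle_simps(3)[OF A] open_submfd_simps(3)[OF B], where j=j] j
        by (simp add: open_submfd_simps trivial_bundle_simps Q_def)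
      have \<kappa>Q: "(r, \<Phi> (s r)) \<in> Q" if "r \<in> W'" for r
        using that inv[OF that] W'P[OF that] fib[OF W'P(2)[OF that]]
        by (auto simp: Q_def W'_def preimage_def)
      have "smooth_real_on ?n (\<phi> ` W') (\<lambda>y. \<beta> (?\<Psi> (inv_into ((A \<inter> U) \<times> Rk) ?\<theta>
          (?\<theta> (inv_into A \<phi> y, \<Phi> (s (inv_into A \<phi> y)))))) j)"
      proof (rule smooth_real_on_compose[OF oQ oW' smQ])
        show "smooth_real_on ?n (\<phi> ` W') (\<lambda>y. ?\<theta> (inv_into A \<phi> y, \<Phi> (s (inv_into A \<phi> y))) i)"
          if "i < ?n + k" for i
        proof (cases "i < ?n")
          case True
          show ?thesis
            by (rule smooth_real_on_cong_imp[OF oW' _ smooth_real_on_coordinate[OF oW', of i]])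
              (use True invA in \<open>auto simp: prod_chart_def\<close>)
        next
          case False
          then have "i - ?n < k" using that by auto
          then have "smooth_real_on ?n (\<phi> ` (A \<inter> W)) ((\<lambda>r. \<Phi> (s r) (i - ?n)) \<circ> inv_into A \<phi>)"
            using smooth_fun_onD[OF W(5) A] by blast
          then show ?thesis
            using False
            by (auto simp: prod_chart_def comp_def W'_def elim: smooth_real_on_subset[rotated])
        qed
        show "?\<theta> (inv_into A \<phi> y, \<Phi> (s (inv_into A \<phi> y))) \<in> ?\<theta> ` Q" if "y \<in> \<phi> ` W'" for y
          using that invA \<kappa>Q by auto
      qed
      moreover have "inv_into ((A \<inter> U) \<times> Rk) ?\<theta> (?\<theta> (r, \<Phi> (s r))) = (r, \<Phi> (s r))" if "r \<in> W'" for r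
      proof (rule inv_into_f_f)
        show "inj_on ?\<theta> ((A \<inter> U) \<times> Rk)"
          using inj_on_prod_chart[OF chA, of Rk] by (rule inj_on_subset) auto
        show "(r, \<Phi> (s r)) \<in> (A \<inter> U) \<times> Rk" using \<kappa>Q[OF that] by (auto simp: Q_def)
      qed
      ultimately have "smooth_real_on ?n (\<phi> ` W') (\<lambda>y. \<beta> (s (inv_into A \<phi> y)) j)"
        by (elim smooth_real_on_cong_imp[OF oW', rotated]) (auto simp: inv invA)
      then have "smooth_real_on ?n (\<phi> ` (A \<inter> s -` B) \<inter> \<phi> ` W') (\<lambda>y. \<beta> (s (inv_into A \<phi> y)) j)"
        by (rule smooth_real_on_subset[rotated]) auto
      moreover have "y \<in> \<phi> ` W'" using q W(3) by (auto simp: W'_def)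
      ultimately show "\<exists>T. openin (Euclidean_space ?n) T \<and> y \<in> T \<and>
          smooth_real_on ?n (\<phi> ` (A \<inter> s -` B) \<inter> T) (\<lambda>y. \<beta> (s (inv_into A \<phi> y)) j)"
        using oW' by blast
    qed
  qed
  have "smooth_map (open_submfd M P) (total E) s"
    unfolding smooth_map_def
  proof (intro conjI ballI, simp_all only: open_submfd_simps subtopology_topspace cont, clarify)
    fix A' \<phi> B \<beta> assume A': "(A', \<phi>) \<in> atlas (open_submfd M P)" and B: "(B, \<beta>) \<in> atlas (total E)"
    then obtain A where A: "(A, \<phi>) \<in> atlas M" "A' = A \<inter> P" by (auto simp: open_submfd_def)
    moreover have "A \<inter> P = A" using topological_chartD(2)[OF atlas_chart[OF A(1)]] by auto
    ultimately show "smooth_vec_on ?n ?N (\<phi> ` (A' \<inter> s -` B)) (\<beta> \<circ> s \<circ> inv_into A' \<phi>)"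
      using smooth[OF A(1) B] by (simp add: smooth_vec_on_def)
  qed
  then show ?thesis using fib by (simp add: smooth_section_def)
qed

text \<open>The charts of the open submanifold have smaller domains, so their
  \<open>inv_into\<close> is formally another function; on the image the two inverses agree.\<close>

lemma smooth_section_restrict:
  assumes s: "smooth_section M E P s" and U: "openin (mtop M) U"
  shows "smooth_section M E U s"
  unfolding smooth_section_def
proof
  let ?n = "mdim M" and ?N = "mdim (total E)"
  have UP: "U \<subseteq> P" using openin_subset[OF U] .
  show "\<forall>q\<in>U. s q \<in> fibre E q" using smooth_section_fibre[OF s] UP by blast
  have sm: "smooth_map (open_submfd M P) (total E) s" using s by (simp add: smooth_section_def)
  note cont = smooth_section_continuous[OF s]
  show "smooth_map (open_submfd M U) (total E) s"
    unfolding smooth_map_def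
  proof (intro conjI ballI, simp_all only: open_submfd_simps continuous_map_from_subtopology[OF cont], clarify)
    fix A' \<phi> B \<beta> assume A': "(A', \<phi>) \<in> atlas (open_submfd M U)" and B: "(B, \<beta>) \<in> atlas (total E)"
    then obtain A where A: "(A, \<phi>) \<in> atlas M" "A' = A \<inter> U" by (auto simp: open_submfd_def)
    note chA = atlas_chart[OF A(1)] and chB = total.atlas_chart[OF B]
    have AP: "A \<inter> P = A" using topological_chartD(2)[OF chA] by auto
    have "openin (mtop M) ((A \<inter> U) \<inter> {r \<in> P. s r \<in> B})"
      by (intro openin_Int topological_chartD(1)[OF chA] U
          openin_continuous_map_preimage[OF cont topological_chartD(1)[OF chB]])
    moreover have "(A \<inter> U) \<inter> {r \<in> P. s r \<in> B} = A' \<inter> s -` B" using A(2) UP by auto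
    ultimately have op: "openin (Euclidean_space ?n) (\<phi> ` (A' \<inter> s -` B))"
      using chart_image_open[OF chA] A(2) by auto
    have inj: "inj_on \<phi> A'" "inj_on \<phi> A"
      using topological_chartD(4)[OF chA] A(2) by (auto intro: inj_on_subset)
    have "smooth_real_on ?n (\<phi> ` (A' \<inter> s -` B)) (\<lambda>y. \<beta> (s (inv_into A' \<phi> y)) j)" if "j < ?N" for j
    proof -
      have "smooth_real_on ?n (\<phi> ` (A \<inter> s -` B)) (\<lambda>y. \<beta> (s (inv_into A \<phi> y)) j)"
        using smooth_map_charts[OF sm open_submfd_simps(3)[OF A(1)] B that] AP by (simp add: open_submfd_simps)
      then have "smooth_real_on ?n (\<phi> ` (A' \<inter> s -` B)) (\<lambda>y. \<beta> (s (inv_into A \<phi> y)) j)"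
        by (rule smooth_real_on_subset[rotated]) (use A(2) in auto)
      then show ?thesis
        by (rule smooth_real_on_cong_imp[OF op, rotated]) (use inj A(2) in auto)
    qed
    then show "smooth_vec_on ?n ?N (\<phi> ` (A' \<inter> s -` B)) (\<beta> \<circ> s \<circ> inv_into A' \<phi>)"
      by (simp add: smooth_vec_on_def)
  qed
qed

end

subsection \<open>Vector fields and the module of sections\<close>

context smooth_mfd
begin

lemma tangent_space_scale:
  assumes "v \<in> tangent_space M q"
  shows "(\<lambda>f. c * v f) \<in> tangent_space M q"
  using assms unfolding tangent_space_def by (auto simp: algebra_simps)

lemma tangent_space_add:
  assumes "v \<in> tangent_space M q" "w \<in> tangent_space M q"
  shows "(\<lambda>f. v f + w f) \<in> tangent_space M q"
  using assms unfolding tangent_space_def by (simp add: algebra_simps) metis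

lemma smooth_vector_field_zero: "smooth_vector_field M (\<lambda>r f. 0)"
  unfolding smooth_vector_field_def tangent_space_def by (auto intro: smooth_fun_const)

lemma smooth_vector_field_add:
  "smooth_vector_field M X \<Longrightarrow> smooth_vector_field M Y \<Longrightarrow> smooth_vector_field M (\<lambda>r f. X r f + Y r f)"
  unfolding smooth_vector_field_def by (auto intro: tangent_space_add smooth_fun_add)

lemma smooth_vector_field_scale:
  "smooth_fun M h \<Longrightarrow> smooth_vector_field M X \<Longrightarrow> smooth_vector_field M (\<lambda>r f. h r * X r f)"
  unfolding smooth_vector_field_def by (auto intro: tangent_space_scale smooth_fun_mult)

lemma smooth_fun_in_coordinates:
  assumes "smooth_coordinates M V x" "smooth_fun M f"
  shows "smooth_real_on (mdim M) (x ` V) (f \<circ> inv_into V x)"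
  using smooth_fun_on_coordinates[OF assms(1) openin_points assms(2)]
    topological_chartD(2)[OF coordinates_chart[OF assms(1)]] by (simp add: Int_absorb2)

text \<open>The clauses of \<open>tangent_space\<close> become the rules of calculus for the
  derivative along one slice; functions equal on \<open>M\<close> have equal coordinate expressions
  on the open image of \<open>V\<close>.\<close>

lemma coord_vfield_tangent:
  assumes V: "smooth_coordinates M V x" and q: "q \<in> V" and j: "j < mdim M"
  shows "coord_vfield M V x j q \<in> tangent_space M q"
proof -
  note ch = coordinates_chart[OF V]
  note oV = topological_chartD(3)[OF ch]
  have xq: "x q \<in> x ` V" using q by blast
  have inv: "inv_into V x (x q) = q" using topological_chartD(4)[OF ch] q by simp
  have D: "((\<lambda>t. (f \<circ> inv_into V x) ((x q)(j := t))) has_real_derivative partial j (f \<circ> inv_into V x) (x q)) (at (x q j))"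
    if "smooth_fun M f" for f
    using smooth_imp_DERIV[OF oV smooth_fun_in_coordinates[OF V that] j xq] .
  have "partial j (f \<circ> inv_into V x) (x q) = partial j (g \<circ> inv_into V x) (x q)"
    if "\<forall>r\<in>points M. f r = g r" for f g
    by (rule partial_cong[OF oV xq j])
      (use that topological_chartD(2)[OF ch] in \<open>auto simp: inv_into_into subset_iff\<close>)
  moreover have "partial j ((\<lambda>r. f r + g r) \<circ> inv_into V x) (x q) =
      partial j (f \<circ> inv_into V x) (x q) + partial j (g \<circ> inv_into V x) (x q)"
    if "smooth_fun M f" "smooth_fun M g" for f g
    unfolding comp_def by (rule DERIV_imp_partial(2)[OF DERIV_add[OF D[OF that(1), unfolded comp_def] D[OF that(2), unfolded comp_def]]])
  moreover have "partial j ((\<lambda>r. c * f r) \<circ> inv_into V x) (x q) = c * partial j (f \<circ> inv_into V x) (x q)"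
    if "smooth_fun M f" for c f
    unfolding comp_def by (rule DERIV_imp_partial(2)[OF DERIV_cmult[OF D[OF that, unfolded comp_def]]])
  moreover have "partial j ((\<lambda>r. f r * g r) \<circ> inv_into V x) (x q) =
      f q * partial j (g \<circ> inv_into V x) (x q) + partial j (f \<circ> inv_into V x) (x q) * g q"
    if "smooth_fun M f" "smooth_fun M g" for f g
    using DERIV_imp_partial(2)[OF DERIV_mult[OF D[OF that(1), unfolded comp_def] D[OF that(2), unfolded comp_def]]]
    by (simp add: comp_def inv algebra_simps)
  ultimately show ?thesis
    unfolding tangent_space_def coord_vfield_def
    using smooth_fun_add smooth_fun_mult smooth_fun_mult[OF smooth_fun_const] by auto
qed

text \<open>Makes a coordinate field a legitimate argument of the connection, which accepts global
  fields only. Continuation by zero is smooth because \<open>\<theta>\<close> vanishes off a closed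
  subset of \<open>V\<close>.\<close>

lemma cutoff_coord_vfield:
  assumes V: "smooth_coordinates M V x" and j: "j < mdim M"
    and \<theta>: "smooth_fun M \<theta>" "closedin (mtop M) K" "K \<subseteq> V" "\<And>r. r \<notin> K \<Longrightarrow> \<theta> r = 0"
  shows "smooth_vector_field M (\<lambda>r f. if r \<in> V then \<theta> r * coord_vfield M V x j r f else 0)"
  unfolding smooth_vector_field_def
proof (intro conjI ballI allI impI)
  note ch = coordinates_chart[OF V]
  note oV = topological_chartD(3)[OF ch]
  show "(\<lambda>f. if r \<in> V then \<theta> r * coord_vfield M V x j r f else 0) \<in> tangent_space M r" for r
  proof (cases "r \<in> V")
    case True
    then show ?thesis using tangent_space_scale[OF coord_vfield_tangent[OF V True j]] by simp
  next
    case False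
    then show ?thesis by (simp add: tangent_space_def)
  qed
  fix f assume f: "smooth_fun M f"
  have "smooth_real_on (mdim M) (x ` V) ((\<lambda>r. coord_vfield M V x j r f) \<circ> inv_into V x)"
    by (rule smooth_real_on_cong_imp[OF oV _ smooth_real_on_partial[OF smooth_fun_in_coordinates[OF V f] j]])
      (use f in \<open>simp add: coord_vfield_def f_inv_into_f\<close>)
  then have "smooth_fun_on M V (\<lambda>r. coord_vfield M V x j r f)"
    by (rule smooth_fun_onI_coordinates[OF V topological_chartD(1)[OF ch] subset_refl])
  then have "smooth_fun_on M V (\<lambda>r. \<theta> r * coord_vfield M V x j r f)"
    using smooth_fun_on_subset[OF \<theta>(1)] topological_chartD(1,2)[OF ch] by (intro smooth_fun_on_mult) auto
  then have "smooth_fun_on M V (\<lambda>r. if r \<in> V then \<theta> r * coord_vfield M V x j r f else 0)"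
    by (rule smooth_fun_on_cong_imp[OF _ _ topological_chartD(1)[OF ch] mfd]) simp
  then show "smooth_fun M (\<lambda>r. if r \<in> V then \<theta> r * coord_vfield M V x j r f else 0)"
    by (rule smooth_fun_extend[OF topological_chartD(1)[OF ch] \<theta>(2,3)]) (simp add: \<theta>(4))
qed

lemma cutoff_smooth_fun:
  assumes A: "openin (mtop M) A" and f: "smooth_fun_on M A f"
    and \<theta>: "smooth_fun M \<theta>" "closedin (mtop M) K" "K \<subseteq> A" "\<And>r. r \<notin> K \<Longrightarrow> \<theta> r = 0"
  shows "smooth_fun M (\<lambda>r. \<theta> r * f r)"
proof (rule smooth_fun_extend[OF A \<theta>(2,3)])
  show "smooth_fun_on M A (\<lambda>r. \<theta> r * f r)"
    using smooth_fun_on_subset[OF \<theta>(1) openin_subset[OF A]] f by (intro smooth_fun_on_mult A)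
qed (simp add: \<theta>(4))

end

text \<open>The combination of the \<open>e a\<close> with coefficients \<open>g a\<close>. It is a
  recursion because \<open>vadd\<close> is a field of the record and an addition only within a
  fibre, so \<open>sum\<close> does not apply.\<close>

primrec frame_sum :: "('e, 'm) vbundle \<Rightarrow> (nat \<Rightarrow> 'm \<Rightarrow> real) \<Rightarrow> (nat \<Rightarrow> 'm \<Rightarrow> 'e) \<Rightarrow> nat \<Rightarrow> 'm \<Rightarrow> 'e" where
  "frame_sum E g e 0 = vzero E"
| "frame_sum E g e (Suc m) = (\<lambda>r. vadd E (frame_sum E g e m r) (vscale E (g m r) (e m r)))"

context smooth_bundle
begin

abbreviation "sec \<equiv> smooth_section M E P"
abbreviation "vf \<equiv> smooth_vector_field M"

lemma fibre_vector_space: "q \<in> P \<Longrightarrow> real_vector_space_on (fibre E q) (vadd E) (vscale E) (vzero E q)"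
  using vbundle by (simp add: smooth_vector_bundle_def)

lemma fibre_closed:
  assumes "q \<in> P"
  shows "vzero E q \<in> fibre E q"
    "\<And>u v. u \<in> fibre E q \<Longrightarrow> v \<in> fibre E q \<Longrightarrow> vadd E u v \<in> fibre E q"
    "\<And>c u. u \<in> fibre E q \<Longrightarrow> vscale E c u \<in> fibre E q"
    "vadd E (vzero E q) (vzero E q) = vzero E q"
  using fibre_vector_space[OF assms] unfolding real_vector_space_on_def by simp_all

text \<open>Additivity of \<open>\<Phi>\<close> on the fibre, applied to zero plus zero.\<close>

lemma triv_vzero:
  assumes "triv U \<Phi>" "q \<in> U"
  shows "\<Phi> (vzero E q) a = 0"
proof -
  have q: "q \<in> P" using assms trivD(2) by blast
  show ?thesis
    using trivD(6)[OF assms(1,2) fibre_closed(1)[OF q] fibre_closed(1)[OF q], of a] fibre_closed(4)[OF q] by simp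
qed

lemma sec_zero: "sec (vzero E)"
proof (rule smooth_sectionI)
  fix q assume q: "q \<in> P"
  show "vzero E q \<in> fibre E q" by (rule fibre_closed(1)[OF q])
  obtain U \<Phi> where U: "q \<in> U" "triv U \<Phi>" using triv_exists[OF q] .
  have "smooth_fun_on M U (\<lambda>r. \<Phi> (vzero E r) a)" for a
    by (rule smooth_fun_on_cong_imp[OF smooth_fun_on_const[OF trivD(1)[OF U(2)], of 0] _ trivD(1)[OF U(2)] mfd])
      (simp add: triv_vzero[OF U(2)])
  then show "\<exists>U \<Phi> W. triv U \<Phi> \<and> openin (mtop M) W \<and> q \<in> W \<and> W \<subseteq> U \<and>
      (\<forall>a<k. smooth_fun_on M W (\<lambda>r. \<Phi> (vzero E r) a))"
    using U trivD(1) by blast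
qed

lemma sec_add:
  assumes s: "sec s" and t: "sec t"
  shows "sec (\<lambda>r. vadd E (s r) (t r))"
proof (rule smooth_sectionI)
  fix q assume q: "q \<in> P"
  show "vadd E (s q) (t q) \<in> fibre E q"
    using fibre_closed(2)[OF q] smooth_section_fibre s t q by blast
  obtain U \<Phi> where U: "q \<in> U" "triv U \<Phi>" using triv_exists[OF q] .
  note oU = trivD(1)[OF U(2)]
  have "smooth_fun_on M U (\<lambda>r. \<Phi> (vadd E (s r) (t r)) a)" if "a < k" for a
    by (rule smooth_fun_on_cong_imp[OF smooth_fun_on_add[OF oU section_component_smooth[OF s U(2) that]
            section_component_smooth[OF t U(2) that]] _ oU mfd])
      (use trivD(2,6)[OF U(2)] smooth_section_fibre[OF s] smooth_section_fibre[OF t] in \<open>simp add: subset_iff\<close>)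
  then show "\<exists>U \<Phi> W. triv U \<Phi> \<and> openin (mtop M) W \<and> q \<in> W \<and> W \<subseteq> U \<and>
      (\<forall>a<k. smooth_fun_on M W (\<lambda>r. \<Phi> (vadd E (s r) (t r)) a))"
    using U oU by blast
qed

lemma sec_scale:
  assumes h: "smooth_fun M h" and s: "sec s"
  shows "sec (\<lambda>r. vscale E (h r) (s r))"
proof (rule smooth_sectionI)
  fix q assume q: "q \<in> P"
  show "vscale E (h q) (s q) \<in> fibre E q"
    using fibre_closed(3)[OF q] smooth_section_fibre s q by blast
  obtain U \<Phi> where U: "q \<in> U" "triv U \<Phi>" using triv_exists[OF q] .
  note oU = trivD(1)[OF U(2)]
  have "smooth_fun_on M U (\<lambda>r. \<Phi> (vscale E (h r) (s r)) a)" if "a < k" for a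
    by (rule smooth_fun_on_cong_imp[OF smooth_fun_on_mult[OF oU smooth_fun_on_subset[OF h trivD(2)[OF U(2)]]
            section_component_smooth[OF s U(2) that]] _ oU mfd])
      (use trivD(2,7)[OF U(2)] smooth_section_fibre[OF s] in \<open>simp add: subset_iff\<close>)
  then show "\<exists>U \<Phi> W. triv U \<Phi> \<and> openin (mtop M) W \<and> q \<in> W \<and> W \<subseteq> U \<and>
      (\<forall>a<k. smooth_fun_on M W (\<lambda>r. \<Phi> (vscale E (h r) (s r)) a))"
    using U oU by blast
qed

lemma vscale_0:
  assumes q: "q \<in> P" and u: "u \<in> fibre E q"
  shows "vscale E 0 u = vzero E q"
proof -
  obtain U \<Phi> where U: "q \<in> U" "triv U \<Phi>" using triv_exists[OF q] .
  show ?thesis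
    by (rule triv_inj[OF U(2,1)])
      (use fibre_closed[OF q] u trivD(7)[OF U(2,1) u] triv_vzero[OF U(2,1)] in auto)
qed

text \<open>The \<open>a\<close>-th vector of the frame given by \<open>\<Phi>\<close>, multiplied
  by \<open>\<theta>\<close> and continued by zero. At points outside \<open>U\<close> smoothness is
  read off in another trivialization, away from \<open>K\<close>, where the section is zero.\<close>

lemma cutoff_frame:
  assumes tr: "triv U \<Phi>" and a: "a < k"
    and \<theta>: "smooth_fun M \<theta>" "closedin (mtop M) K" "K \<subseteq> U" "\<And>r. r \<notin> K \<Longrightarrow> \<theta> r = 0"
  obtains s where "sec s" "\<And>r b. r \<in> U \<Longrightarrow> \<Phi> (s r) b = (if b = a then \<theta> r else 0)"
proof -
  let ?F = "\<lambda>e. (proj E e, \<Phi> e)"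
  define w where "w r = (\<lambda>b. if b = a then \<theta> r else 0)" for r
  define s where "s r = (if r \<in> U then inv_into (preimage E U) ?F (r, w r) else vzero E r)" for r
  have sU: "s r \<in> fibre E r" "\<Phi> (s r) = w r" if "r \<in> U" for r
  proof -
    have "w r \<in> Rk" using a by (auto simp: w_def topspace_Euclidean_space)
    then have "(r, w r) \<in> ?F ` preimage E U"
      using bij_betw_imp_surj_on[OF trivD(3)[OF tr]] that by auto
    from f_inv_into_f[OF this] inv_into_into[OF this]
    show "s r \<in> fibre E r" "\<Phi> (s r) = w r"
      using that by (auto simp: s_def preimage_def)
  qed
  have "sec s"
  proof (rule smooth_sectionI)
    fix q assume q: "q \<in> P"
    show fib: "s q \<in> fibre E q" if "q \<in> P" for q
      using sU(1)[of q] fibre_closed(1)[OF that] by (cases "q \<in> U") (auto simp: s_def)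
    show "\<exists>U \<Phi> W. triv U \<Phi> \<and> openin (mtop M) W \<and> q \<in> W \<and> W \<subseteq> U \<and>
        (\<forall>a<k. smooth_fun_on M W (\<lambda>r. \<Phi> (s r) a))"
    proof (cases "q \<in> U")
      case True
      have "smooth_fun_on M U (\<lambda>r. \<Phi> (s r) b)" for b
      proof (rule smooth_fun_on_cong_imp[OF _ _ trivD(1)[OF tr] mfd])
        show "smooth_fun_on M U (\<lambda>r. if b = a then \<theta> r else 0)"
          using smooth_fun_on_subset[OF \<theta>(1) trivD(2)[OF tr]] smooth_fun_on_const[OF trivD(1)[OF tr]]
          by (cases "b = a") simp_all
      qed (simp add: sU(2) w_def)
      then show ?thesis using tr True trivD(1) by blast
    next
      case False
      then have "q \<notin> K" using \<theta>(3) by blast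
      obtain U' \<Phi>' where U': "q \<in> U'" "triv U' \<Phi>'" using triv_exists[OF q] .
      define W where "W = U' \<inter> (P - K)"
      have W: "openin (mtop M) W"
        unfolding W_def using trivD(1)[OF U'(2)] \<theta>(2) by (intro openin_Int) auto
      \<comment> \<open>Points of \<open>W\<close> may still lie in \<open>U\<close>; there the
        section vanishes because \<open>\<theta>\<close> does.\<close>
      have "s r = vzero E r" if "r \<in> W" for r
      proof (cases "r \<in> U")
        case True
        have "\<theta> r = 0" using that \<theta>(4) by (simp add: W_def)
        then show ?thesis
          using True sU(2)[OF True] triv_vzero[OF tr True] that
          by (intro triv_inj[OF tr True fib fibre_closed(1)]) (auto simp: W_def w_def)
      qed (simp add: s_def)
      then have "smooth_fun_on M W (\<lambda>r. \<Phi>' (s r) b)" for b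
        by (intro smooth_fun_on_cong_imp[OF smooth_fun_on_const[OF W, of 0] _ W mfd])
          (auto simp: triv_vzero[OF U'(2)] W_def)
      then show ?thesis
        using U' W q \<open>q \<notin> K\<close> by (intro exI[of _ U'] exI[of _ \<Phi>'] exI[of _ W]) (auto simp: W_def)
    qed
  qed
  then show ?thesis using that sU(2) by (simp add: w_def)
qed

lemma frame_sum_sec:
  assumes "\<And>a. a < m \<Longrightarrow> smooth_fun M (g a)" "\<And>a. a < m \<Longrightarrow> sec (e a)"
  shows "sec (frame_sum E g e m)"
  using assms by (induction m) (auto intro!: sec_zero sec_add sec_scale)

lemma frame_sum_component:
  assumes "triv U \<Phi>" "r \<in> U" "\<And>a. a < m \<Longrightarrow> smooth_fun M (g a)" "\<And>a. a < m \<Longrightarrow> sec (e a)"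
  shows "\<Phi> (frame_sum E g e m r) b = (\<Sum>a<m. g a r * \<Phi> (e a r) b)"
  using assms(3,4)
proof (induction m)
  case 0
  then show ?case by (simp add: triv_vzero[OF assms(1,2)])
next
  case (Suc m)
  have r: "r \<in> P" using assms(1,2) trivD(2) by blast
  have "frame_sum E g e m r \<in> fibre E r" "e m r \<in> fibre E r"
    using smooth_section_fibre[OF frame_sum_sec r] smooth_section_fibre[OF _ r] Suc.prems by auto
  then show ?case
    using Suc trivD(6,7)[OF assms(1,2)] fibre_closed(3)[OF r] by simp
qed

end

subsection \<open>Connections are local\<close>

locale smooth_connection = smooth_bundle M k E for M :: "'m mfd" and k and E :: "('e, 'm) vbundle" +
  fixes D :: "'m vfield \<Rightarrow> ('m \<Rightarrow> 'e) \<Rightarrow> 'm \<Rightarrow> 'e"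
  assumes connection: "connection M E D"
begin

lemma connD:
  shows "vf X \<Longrightarrow> sec s \<Longrightarrow> sec (D X s)"
    and "vf X \<Longrightarrow> vf Y \<Longrightarrow> sec s \<Longrightarrow> sec t \<Longrightarrow> (\<And>q. q \<in> P \<Longrightarrow> X q = Y q) \<Longrightarrow> (\<And>q. q \<in> P \<Longrightarrow> s q = t q) \<Longrightarrow>
      q \<in> P \<Longrightarrow> D X s q = D Y t q"
    and "vf X \<Longrightarrow> vf Y \<Longrightarrow> sec s \<Longrightarrow> q \<in> P \<Longrightarrow> D (\<lambda>r f. X r f + Y r f) s q = vadd E (D X s q) (D Y s q)"
    and "smooth_fun M h \<Longrightarrow> vf X \<Longrightarrow> sec s \<Longrightarrow> q \<in> P \<Longrightarrow> D (\<lambda>r f. h r * X r f) s q = vscale E (h q) (D X s q)"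
    and "vf X \<Longrightarrow> sec s \<Longrightarrow> sec t \<Longrightarrow> q \<in> P \<Longrightarrow> D X (\<lambda>r. vadd E (s r) (t r)) q = vadd E (D X s q) (D X t q)"
    and "smooth_fun M h \<Longrightarrow> vf X \<Longrightarrow> sec s \<Longrightarrow> q \<in> P \<Longrightarrow>
      D X (\<lambda>r. vscale E (h r) (s r)) q = vadd E (vscale E (X q h) (s q)) (vscale E (h q) (D X s q))"
proof -
  note c = connection[unfolded connection_def Let_def]
  note c1 = c[THEN conjunct1, rule_format]
  note c = c[THEN conjunct2]
  note c2 = c[THEN conjunct1, rule_format]
  note c = c[THEN conjunct2]
  note c3 = c[THEN conjunct1, rule_format]
  note c = c[THEN conjunct2]
  note c4 = c[THEN conjunct1, rule_format]
  note c = c[THEN conjunct2]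
  note c5 = c[THEN conjunct1, rule_format]
  note c7 = c[THEN conjunct2, THEN conjunct2, rule_format]
  show "sec (D X s)" if "vf X" "sec s" by (rule c1) (use that in simp)
  show "D X s q = D Y t q" if "vf X" "vf Y" "sec s" "sec t" "\<And>q. q \<in> P \<Longrightarrow> X q = Y q"
    "\<And>q. q \<in> P \<Longrightarrow> s q = t q" "q \<in> P"
    by (rule c2) (use that in simp_all)
  show "D (\<lambda>r f. X r f + Y r f) s q = vadd E (D X s q) (D Y s q)" if "vf X" "vf Y" "sec s" "q \<in> P"
    by (rule c3) (use that in simp_all)
  show "D (\<lambda>r f. h r * X r f) s q = vscale E (h q) (D X s q)" if "smooth_fun M h" "vf X" "sec s" "q \<in> P"
    by (rule c4) (use that in simp_all)
  show "D X (\<lambda>r. vadd E (s r) (t r)) q = vadd E (D X s q) (D X t q)" if "vf X" "sec s" "sec t" "q \<in> P"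
    by (rule c5) (use that in simp_all)
  show "D X (\<lambda>r. vscale E (h r) (s r)) q = vadd E (vscale E (X q h) (s q)) (vscale E (h q) (D X s q))"
    if "smooth_fun M h" "vf X" "sec s" "q \<in> P"
    by (rule c7) (use that in simp_all)
qed

lemma D_fibre: "vf X \<Longrightarrow> sec s \<Longrightarrow> q \<in> P \<Longrightarrow> D X s q \<in> fibre E q"
  using connD(1) smooth_section_fibre by blast

text \<open>Multiplying by a function that is \<open>1\<close> at \<open>q\<close> and vanishes off \<open>W\<close> makes the arguments agree
  globally; the extra terms that this produces depend only on the values of the sections at \<open>q\<close>.\<close>

lemma connection_local:
  assumes X: "vf X" "vf Y" and s: "sec s" "sec t" and W: "openin (mtop M) W" "q \<in> W"
    and eq: "\<And>r. r \<in> W \<Longrightarrow> X r = Y r" "\<And>r. r \<in> W \<Longrightarrow> s r = t r"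
  shows "D X s q = D Y t q"
proof -
  have q: "q \<in> P" using W openin_subset by blast
  obtain A \<phi> where A: "(A, \<phi>) \<in> atlas M" "q \<in> A" using atlas_cover[OF q] .
  obtain \<theta> K N where \<theta>: "smooth_fun M \<theta>" "K \<subseteq> W" "\<And>r. r \<notin> K \<Longrightarrow> \<theta> r = 0" "q \<in> N" "\<And>r. r \<in> N \<Longrightarrow> \<theta> r = 1"
    using cutoff[OF atlas_coordinates[OF A(1)] W(1) A(2) W(2)] by metis
  have \<theta>q: "\<theta> q = 1" using \<theta>(4,5) by blast
  obtain U \<Phi> where U: "q \<in> U" "triv U \<Phi>" using triv_exists[OF q] .
  have eqX: "(\<lambda>r f. \<theta> r * X r f) = (\<lambda>r f. \<theta> r * Y r f)"
  proof (intro ext)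
    show "\<theta> r * X r f = \<theta> r * Y r f" for r f
      using eq(1)[of r] \<theta>(2,3) by (cases "r \<in> W") auto
  qed
  have "vscale E (\<theta> q) (D X s q) = vscale E (\<theta> q) (D Y s q)"
    using connD(4)[OF \<theta>(1) X(1) s(1) q] connD(4)[OF \<theta>(1) X(2) s(1) q] eqX by simp
  then have 1: "\<Phi> (D X s q) a = \<Phi> (D Y s q) a" for a
    using trivD(7)[OF U(2,1) D_fibre[OF X(1) s(1) q], of "\<theta> q" a]
      trivD(7)[OF U(2,1) D_fibre[OF X(2) s(1) q], of "\<theta> q" a] by (simp add: \<theta>q)
  have "vscale E (\<theta> r) (s r) = vscale E (\<theta> r) (t r)" if "r \<in> P" for r
  proof (cases "r \<in> W")
    case False
    then have "\<theta> r = 0" using \<theta>(2,3) by blast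
    then show ?thesis using vscale_0[OF that] smooth_section_fibre[OF s(1) that] smooth_section_fibre[OF s(2) that] by simp
  qed (simp add: eq(2))
  then have "D Y (\<lambda>r. vscale E (\<theta> r) (s r)) q = D Y (\<lambda>r. vscale E (\<theta> r) (t r)) q"
    using connD(2)[OF X(2,2) sec_scale[OF \<theta>(1) s(1)] sec_scale[OF \<theta>(1) s(2)] refl _ q] by blast
  then have 2: "\<Phi> (vadd E (vscale E (Y q \<theta>) (s q)) (vscale E (\<theta> q) (D Y s q))) a =
      \<Phi> (vadd E (vscale E (Y q \<theta>) (t q)) (vscale E (\<theta> q) (D Y t q))) a" for a
    by (simp add: connD(6)[OF \<theta>(1) X(2) s(1) q] connD(6)[OF \<theta>(1) X(2) s(2) q])
  have 3: "\<Phi> (vadd E (vscale E c (u q)) (vscale E d (D Y u q))) a = c * \<Phi> (u q) a + d * \<Phi> (D Y u q) a"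
    if "sec u" for u c d a
    using smooth_section_fibre[OF that q] D_fibre[OF X(2) that q] fibre_closed(3)[OF q]
      trivD(6,7)[OF U(2,1)] by simp
  have "\<Phi> (D Y s q) a = \<Phi> (D Y t q) a" for a
    using 2[of a] unfolding 3[OF s(1)] 3[OF s(2)] by (simp add: \<theta>q eq(2)[OF W(2)])
  with 1 show ?thesis
    by (intro triv_inj[OF U(2,1) D_fibre[OF X(1) s(1) q] D_fibre[OF X(2) s(2) q]]) simp
qed

text \<open>Linearity over functions in the field. Smoothness of the sum is proved along with the
  formula, since the induction step applies additivity to the shorter sum. For the empty sum, the
  zero field is written as \<open>0\<close> times itself.\<close>

lemma connection_field_sum:
  fixes m :: nat
  assumes tr: "triv U \<Phi>" "q \<in> U" and h: "\<And>j. j < m \<Longrightarrow> smooth_fun M (h j)" "\<And>j. j < m \<Longrightarrow> vf (Y j)"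
    and s: "sec s"
  shows "vf (\<lambda>r f. \<Sum>j<m. h j r * Y j r f) \<and>
    \<Phi> (D (\<lambda>r f. \<Sum>j<m. h j r * Y j r f) s q) b = (\<Sum>j<m. h j q * \<Phi> (D (Y j) s q) b)"
  using h
proof (induction m)
  case 0
  have q: "q \<in> P" using tr trivD(2) by blast
  have "D (\<lambda>r f. 0) s q = vscale E 0 (D (\<lambda>r f. 0) s q)"
    using connD(4)[OF smooth_fun_const[of 0] smooth_vector_field_zero s q] by simp
  then have "\<Phi> (D (\<lambda>r f. 0) s q) b = 0"
    using trivD(7)[OF tr D_fibre[OF smooth_vector_field_zero s q], of 0 b] by simp
  then show ?case by (simp add: smooth_vector_field_zero)
next
  case (Suc m)
  have q: "q \<in> P" using tr trivD(2) by blast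
  let ?X = "\<lambda>r f. \<Sum>j<m. h j r * Y j r f" and ?Z = "\<lambda>r f. h m r * Y m r f"
  have X: "vf ?X" "\<Phi> (D ?X s q) b = (\<Sum>j<m. h j q * \<Phi> (D (Y j) s q) b)" using Suc by auto
  have Z: "vf ?Z" using Suc.prems by (intro smooth_vector_field_scale) auto
  have "D ?Z s q = vscale E (h m q) (D (Y m) s q)"
    using connD(4)[OF _ _ s q] Suc.prems by blast
  then have "\<Phi> (D ?Z s q) b = h m q * \<Phi> (D (Y m) s q) b"
    using trivD(7)[OF tr D_fibre[OF _ s q], of "Y m"] Suc.prems by simp
  moreover have "\<Phi> (D (\<lambda>r f. ?X r f + ?Z r f) s q) b = \<Phi> (D ?X s q) b + \<Phi> (D ?Z s q) b"
    using connD(3)[OF X(1) Z s q] trivD(6)[OF tr D_fibre[OF X(1) s q] D_fibre[OF Z s q]] by simp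
  ultimately show ?case
    using X smooth_vector_field_add[OF X(1) Z] by simp
qed

text \<open>The Leibniz rule for function coefficients, the source of the terms
  \<open>\<partial>_j f\<close> and \<open>\<Gamma>_j f\<close> in the local equation. For the empty
  sum, the zero section is written as \<open>0\<close> times itself.\<close>

lemma connection_frame_sum:
  assumes tr: "triv U \<Phi>" "q \<in> U" and g: "\<And>a. a < m \<Longrightarrow> smooth_fun M (g a)" "\<And>a. a < m \<Longrightarrow> sec (e a)"
    and X: "vf X"
  shows "\<Phi> (D X (frame_sum E g e m) q) b = (\<Sum>a<m. X q (g a) * \<Phi> (e a q) b + g a q * \<Phi> (D X (e a) q) b)"
  using g
proof (induction m)
  case 0
  have q: "q \<in> P" using tr trivD(2) by blast
  have "D X (vzero E) q = D X (\<lambda>r. vscale E 0 (vzero E r)) q"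
    using sec_zero sec_scale[OF smooth_fun_const[of 0] sec_zero] vscale_0 fibre_closed(1)
    by (intro connD(2)[OF X X _ _ _ _ q]) auto
  also have "\<dots> = vadd E (vscale E (X q (\<lambda>r. 0)) (vzero E q)) (vscale E 0 (D X (vzero E) q))"
    by (rule connD(6)[OF smooth_fun_const X sec_zero q])
  finally have "\<Phi> (D X (vzero E) q) b = \<Phi> (vadd E (vscale E (X q (\<lambda>r. 0)) (vzero E q)) (vscale E 0 (D X (vzero E) q))) b"
    by simp
  also have "\<dots> = 0"
    using trivD(6,7)[OF tr] fibre_closed(1,3)[OF q] D_fibre[OF X sec_zero q] triv_vzero[OF tr] by simp
  finally show ?case by simp
next
  case (Suc m)
  have q: "q \<in> P" using tr trivD(2) by blast
  let ?s = "frame_sum E g e m" and ?t = "\<lambda>r. vscale E (g m r) (e m r)"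
  have s: "sec ?s" using frame_sum_sec Suc.prems by simp
  have g: "smooth_fun M (g m)" and e: "sec (e m)" using Suc.prems by auto
  have t: "sec ?t" by (rule sec_scale[OF g e])
  have "D X (\<lambda>r. vadd E (?s r) (?t r)) q = vadd E (D X ?s q) (D X ?t q)"
    by (rule connD(5)[OF X s t q])
  then have "\<Phi> (D X (\<lambda>r. vadd E (?s r) (?t r)) q) b = \<Phi> (D X ?s q) b + \<Phi> (D X ?t q) b"
    using trivD(6)[OF tr D_fibre[OF X s q] D_fibre[OF X t q]] by simp
  moreover have "D X ?t q = vadd E (vscale E (X q (g m)) (e m q)) (vscale E (g m q) (D X (e m) q))"
    by (rule connD(6)[OF g X e q])
  then have "\<Phi> (D X ?t q) b = X q (g m) * \<Phi> (e m q) b + g m q * \<Phi> (D X (e m) q) b"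
    using trivD(6,7)[OF tr] smooth_section_fibre[OF e q] D_fibre[OF X e q] fibre_closed(3)[OF q] by simp
  ultimately show ?case using Suc by simp
qed

text \<open>Locality of the connection makes all candidates for the definite description equal, so
  any one global extension computes it.\<close>

lemma local_covariant_derivative_eq:
  assumes "vf Y" "sec t" "openin (mtop M) U" "q \<in> U" "\<And>r. r \<in> U \<Longrightarrow> Y r = X r" "\<And>r. r \<in> U \<Longrightarrow> t r = s r"
  shows "local_covariant_derivative M E D U X s q = D Y t q"
  unfolding local_covariant_derivative_def
proof (rule the_equality)
  show "\<exists>Y' t' W. vf Y' \<and> sec t' \<and> openin (mtop M) W \<and> q \<in> W \<and> W \<subseteq> U \<and>
      (\<forall>r\<in>W. Y' r = X r \<and> t' r = s r) \<and> D Y t q = D Y' t' q"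
    using assms by blast
  fix v assume "\<exists>Y' t' W. vf Y' \<and> sec t' \<and> openin (mtop M) W \<and> q \<in> W \<and> W \<subseteq> U \<and>
      (\<forall>r\<in>W. Y' r = X r \<and> t' r = s r) \<and> v = D Y' t' q"
  then obtain Y' t' W where *: "vf Y'" "sec t'" "openin (mtop M) W" "q \<in> W" "W \<subseteq> U"
      "\<And>r. r \<in> W \<Longrightarrow> Y' r = X r" "\<And>r. r \<in> W \<Longrightarrow> t' r = s r" "v = D Y' t' q" by blast
  have "D Y' t' q = D Y t q"
    by (rule connection_local[OF *(1) assms(1) *(2) assms(2) *(3,4)]) (use * assms(5,6) in auto)
  then show "v = D Y t q" using *(8) by simp
qed

end

subsection \<open>Radially parallel sections\<close>

context smooth_connection
begin

text \<open>The components of \<open>\<xi>p\<close> in a trivialization around \<open>p\<close> are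
  the initial values of the radial equation. Its solution supplies the coefficients of a combination
  of cut-off frame sections, and all cut-offs equal \<open>1\<close> on the final neighbourhood
  \<open>U\<close>.\<close>

lemma radially_parallel_section:
  assumes V: "smooth_coordinates M V x" and p: "p \<in> V" and x0: "\<forall>j<mdim M. x p j = 0"
    and \<xi>p: "\<xi>p \<in> fibre E p"
  shows "\<exists>U \<xi>. openin (mtop M) U \<and> p \<in> U \<and> U \<subseteq> V \<and> smooth_section M E U \<xi> \<and> \<xi> p = \<xi>p \<and>
           (\<forall>q\<in>U. local_covariant_derivative M E D U (radial_vfield M V x) \<xi> q = vzero E q)"
proof -
  let ?n = "mdim M"
  note ch = coordinates_chart[OF V]
  have inv: "inv_into V x (x z) = z" if "z \<in> V" for z
    using topological_chartD(4)[OF ch] that by simp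
  have pP: "p \<in> P" using p topological_chartD(2)[OF ch] by blast
  have xp: "x p = (\<lambda>_. 0)"
    using x0 chart_ge[OF ch p] by (metis ext not_le)
  obtain U0 \<Phi> where U0: "p \<in> U0" and tr: "triv U0 \<Phi>" using triv_exists[OF pP] .
  \<comment> \<open>This cut-off comes before the coefficients, which are formed from global
    sections and fields. \<open>K \<subseteq> U0\<close> serves the frame,
    \<open>K \<subseteq> V\<close> the coordinate fields.\<close>
  obtain \<theta> K N where \<theta>: "smooth_fun M \<theta>" "closedin (mtop M) K" "K \<subseteq> U0" "\<And>r. r \<notin> K \<Longrightarrow> \<theta> r = 0"
      and N: "openin (mtop M) N" "p \<in> N" "N \<subseteq> K" and KV: "K \<subseteq> V" and \<theta>N: "\<And>r. r \<in> N \<Longrightarrow> \<theta> r = 1"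
    using cutoff[OF V trivD(1)[OF tr] p U0] by metis
  define Y where "Y j = (\<lambda>r f. if r \<in> V then \<theta> r * coord_vfield M V x j r f else 0)" for j
  have Y: "vf (Y j)" if "j < ?n" for j
    unfolding Y_def by (rule cutoff_coord_vfield[OF V that \<theta>(1,2) KV \<theta>(4)])
  have "\<forall>a. \<exists>s. a < k \<longrightarrow> sec s \<and> (\<forall>r b. r \<in> U0 \<longrightarrow> \<Phi> (s r) b = (if b = a then \<theta> r else 0))"
    using cutoff_frame[OF tr _ \<theta>] by metis
  then obtain e where e: "\<And>a. a < k \<Longrightarrow> sec (e a)"
      "\<And>a r b. a < k \<Longrightarrow> r \<in> U0 \<Longrightarrow> \<Phi> (e a r) b = (if b = a then \<theta> r else 0)" by metis
  \<comment> \<open>Over \<open>N\<close>, where \<open>\<theta> = 1\<close>, these are the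
    Christoffel symbols of the frame in the given coordinates.\<close>
  define \<Gamma> where "\<Gamma> = (\<lambda>j a b y. \<Phi> (D (Y j) (e a) (inv_into V x y)) b)"
  have NV: "N \<subseteq> V" "N \<subseteq> U0" using N(3) KV \<theta>(3) by auto
  have oN: "openin (Euclidean_space ?n) (x ` N)" by (rule chart_image_open[OF ch N(1) NV(1)])
  have "(\<lambda>_. 0) \<in> x ` N" using N(2) xp by (metis imageI)
  \<comment> \<open>The equation is solved over \<open>N\<close> only, where \<open>\<Gamma>\<close>
    has its geometric meaning.\<close>
  then obtain R where R: "R > 0" "cube0 ?n R \<subseteq> x ` N"
    using openin_imp_cube_subset[OF oN] by blast
  have \<Gamma>: "smooth_real_on ?n (cube0 ?n R) (\<Gamma> j a b)" if "j < ?n" "a < k" "b < k" for j a b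
  proof -
    have "smooth_fun_on M U0 (\<lambda>r. \<Phi> (D (Y j) (e a) r) b)"
      using section_component_smooth[OF connD(1)[OF Y e(1)] tr] that by blast
    from smooth_fun_on_coordinates[OF V trivD(1)[OF tr] this]
    have "smooth_real_on ?n (x ` (V \<inter> U0)) (\<Gamma> j a b)" by (simp add: comp_def \<Gamma>_def)
    then show ?thesis
      by (rule smooth_real_on_subset[rotated]) (use R(2) NV in blast)
  qed
  have "\<exists>r f. 0 < r \<and> r \<le> R \<and> (\<forall>b<k. smooth_real_on ?n (cube0 ?n r) (f b)) \<and>
    (\<forall>b<k. f b (\<lambda>_. 0) = \<Phi> \<xi>p b) \<and>
    (\<forall>b<k. \<forall>y\<in>cube0 ?n r.
       (\<Sum>j<?n. y j * partial j (f b) y) + (\<Sum>j<?n. \<Sum>a<k. y j * (\<Gamma> j a b y * f a y)) = 0)"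
    by (rule radial_ode[OF R(1)]) (rule \<Gamma>)
  then obtain r f where r: "0 < r" "r \<le> R"
    and f_all: "\<forall>b<k. smooth_real_on ?n (cube0 ?n r) (f b)" "\<forall>b<k. f b (\<lambda>_. 0) = \<Phi> \<xi>p b"
      "\<forall>b<k. \<forall>y\<in>cube0 ?n r.
       (\<Sum>j<?n. y j * partial j (f b) y) + (\<Sum>j<?n. \<Sum>a<k. y j * (\<Gamma> j a b y * f a y)) = 0"
    by (elim exE conjE) (rule that)
  note f = f_all[rule_format]
  define W where "W = {z \<in> V. x z \<in> cube0 ?n r}"
  have W: "openin (mtop M) W" unfolding W_def by (rule chart_preimage_open[OF ch openin_cube])
  have pW: "p \<in> W" using p xp r(1) by (simp add: W_def cube_def)
  have WN: "W \<subseteq> N"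
  proof
    fix z assume "z \<in> W"
    then have z: "z \<in> V" "x z \<in> cube0 ?n r" by (auto simp: W_def)
    then obtain w where "w \<in> N" "x z = x w"
      using subsetD[OF R(2) subsetD[OF cube_mono[OF r(2)] z(2)]] by blast
    then show "z \<in> N" using inv z(1) NV(1) by (metis subsetD)
  qed
  \<comment> \<open>The second cut-off: \<open>f\<close> is known to be smooth and to solve the
    equation over \<open>W\<close> only, and the coordinates are smooth over \<open>V\<close>; both
    have to become global functions to serve as coefficients.\<close>
  obtain \<theta>' K' U where \<theta>': "smooth_fun M \<theta>'" "closedin (mtop M) K'" "K' \<subseteq> W" "\<And>r. r \<notin> K' \<Longrightarrow> \<theta>' r = 0"
      and U: "openin (mtop M) U" "p \<in> U" "U \<subseteq> K'" and \<theta>'U: "\<And>r. r \<in> U \<Longrightarrow> \<theta>' r = 1"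
    using cutoff[OF V W p pW] by metis
  have UW: "U \<subseteq> W" "U \<subseteq> N" "U \<subseteq> V" "U \<subseteq> U0" using U(3) \<theta>'(3) WN NV by auto
  define g where "g a z = \<theta>' z * f a (x z)" for a z
  define h where "h j z = \<theta>' z * x z j" for j z
  have oW: "openin (Euclidean_space ?n) (x ` W)"
    using chart_image_open[OF ch W] UW by (auto simp: W_def)
  have g: "smooth_fun M (g a)" if "a < k" for a
    unfolding g_def
  proof (rule cutoff_smooth_fun[OF W _ \<theta>'])
    have "smooth_real_on ?n (x ` W) (f a)"
      by (rule smooth_real_on_subset[OF _ f(1)[OF that]]) (auto simp: W_def)
    then have "smooth_real_on ?n (x ` W) ((\<lambda>z. f a (x z)) \<circ> inv_into V x)"
      by (rule smooth_real_on_cong_imp[OF oW, rotated]) (auto simp: inv W_def)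
    then show "smooth_fun_on M W (\<lambda>z. f a (x z))"
      by (rule smooth_fun_onI_coordinates[OF V W, rotated]) (auto simp: W_def)
  qed
  have h: "smooth_fun M (h j)" for j
    unfolding h_def
  proof (rule cutoff_smooth_fun[OF W _ \<theta>'])
    have "smooth_real_on ?n (x ` W) ((\<lambda>z. x z j) \<circ> inv_into V x)"
      by (rule smooth_real_on_cong_imp[OF oW _ smooth_real_on_coordinate[OF oW, of j]]) (auto simp: inv W_def)
    then show "smooth_fun_on M W (\<lambda>z. x z j)"
      by (rule smooth_fun_onI_coordinates[OF V W, rotated]) (auto simp: W_def)
  qed
  define \<xi> where "\<xi> = frame_sum E g e k"
  define X where "X = (\<lambda>r f. \<Sum>j<?n. h j r * Y j r f)"
  have \<xi>: "sec \<xi>" unfolding \<xi>_def by (rule frame_sum_sec[OF g e(1)])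
  have \<xi>_comp: "\<Phi> (\<xi> q) b = f b (x q)" if "q \<in> U" "b < k" for q b
  proof -
    have "\<Phi> (\<xi> q) b = (\<Sum>a<k. g a q * \<Phi> (e a q) b)"
      unfolding \<xi>_def using that UW by (intro frame_sum_component[OF tr] g e(1)) auto
    also have "\<dots> = (\<Sum>a<k. if b = a then g a q else 0)"
      by (rule sum.cong) (use that UW \<theta>N in \<open>auto simp: e(2) subset_iff\<close>)
    also have "\<dots> = f b (x q)" using that by (simp add: g_def \<theta>'U)
    finally show ?thesis .
  qed
  \<comment> \<open>On \<open>U\<close> both cut-offs are \<open>1\<close>, so nothing remains of
    them in the field.\<close>
  have X_radial: "X q = radial_vfield M V x q" if "q \<in> U" for q
    using that UW \<theta>N by (auto simp: X_def radial_vfield_def h_def Y_def \<theta>'U subset_iff)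
  have X: "vf X"
    unfolding X_def
    \<comment> \<open>Only smoothness of the field is wanted here, so any component \<open>b\<close>
      will do.\<close>
    by (rule conjunct1[OF connection_field_sum[OF tr U0 _ _ \<xi>, where h=h and Y=Y and b=0]]) (use h Y in auto)
  have parallel: "D X \<xi> q = vzero E q" if q: "q \<in> U" for q
  proof -
    have q0: "q \<in> U0" "q \<in> P" "q \<in> V" "q \<in> N" "q \<in> W" using q UW trivD(2)[OF tr] by auto
    have xq: "x q \<in> cube0 ?n r" using q UW by (auto simp: W_def)
    have oU: "openin (Euclidean_space ?n) (x ` U)" by (rule chart_image_open[OF ch U(1) UW(3)])
    \<comment> \<open>\<open>\<theta>'\<close> is \<open>1\<close> on all of \<open>U\<close>, not
      merely at \<open>q\<close>, and therefore leaves no trace in the derivative.\<close>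
    have Yg: "Y j q (g a) = partial j (f a) (x q)" if "j < ?n" "a < k" for j a
    proof -
      have "Y j q (g a) = partial j (g a \<circ> inv_into V x) (x q)"
        using q0 g[OF that(2)] by (simp add: Y_def coord_vfield_def \<theta>N)
      also have "\<dots> = partial j (f a) (x q)"
        by (rule partial_cong[OF oU _ that(1)]) (use q UW in \<open>auto simp: inv g_def \<theta>'U subset_iff\<close>)
      finally show ?thesis .
    qed
    have De: "\<Phi> (D (Y j) \<xi> q) b = partial j (f b) (x q) + (\<Sum>a<k. \<Gamma> j a b (x q) * f a (x q))"
      if "j < ?n" "b < k" for j b
    proof -
      have "\<Phi> (D (Y j) \<xi> q) b = (\<Sum>a<k. Y j q (g a) * \<Phi> (e a q) b + g a q * \<Phi> (D (Y j) (e a) q) b)"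
        unfolding \<xi>_def by (rule connection_frame_sum[OF tr q0(1) g e(1) Y[OF that(1)]])
      also have "\<dots> = (\<Sum>a<k. (if b = a then partial j (f a) (x q) else 0) + \<Gamma> j a b (x q) * f a (x q))"
        by (rule sum.cong)
          (use q0 that q in \<open>auto simp: e(2) Yg \<theta>N g_def \<theta>'U \<Gamma>_def inv\<close>)
      also have "\<dots> = partial j (f b) (x q) + (\<Sum>a<k. \<Gamma> j a b (x q) * f a (x q))"
        using that(2) by (simp add: sum.distrib)
      finally show ?thesis .
    qed
    have "\<Phi> (D X \<xi> q) b = 0" if "b < k" for b
    proof -
      have "\<Phi> (D X \<xi> q) b = (\<Sum>j<?n. h j q * \<Phi> (D (Y j) \<xi> q) b)"
        unfolding X_def
        by (rule conjunct2[OF connection_field_sum[OF tr q0(1) _ _ \<xi>, where h=h and Y=Y]]) (use h Y in auto)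
      \<comment> \<open>With \<open>h j q = x q j\<close> the components assemble into the left-hand
        side of the radial equation at \<open>x q\<close>.\<close>
      also have "\<dots> = (\<Sum>j<?n. x q j * partial j (f b) (x q)) +
          (\<Sum>j<?n. \<Sum>a<k. x q j * (\<Gamma> j a b (x q) * f a (x q)))"
        using that q by (simp add: De h_def \<theta>'U distrib_left sum.distrib sum_distrib_left)
      also have "\<dots> = 0" by (rule f(3)[OF that xq])
      finally show ?thesis .
    qed
    then show ?thesis
      by (intro triv_inj[OF tr q0(1) D_fibre[OF X \<xi> q0(2)] fibre_closed(1)[OF q0(2)]])
        (simp add: triv_vzero[OF tr q0(1)])
  qed
  show ?thesis
  proof (intro exI conjI ballI)
    show "openin (mtop M) U" "p \<in> U" "U \<subseteq> V" using U UW by auto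
    show "smooth_section M E U \<xi>" by (rule smooth_section_restrict[OF \<xi> U(1)])
    show "\<xi> p = \<xi>p"
      by (rule triv_inj[OF tr U0 smooth_section_fibre[OF \<xi> pP] \<xi>p]) (simp add: \<xi>_comp[OF U(2)] xp f(2))
    show "local_covariant_derivative M E D U (radial_vfield M V x) \<xi> q = vzero E q" if "q \<in> U" for q
      using local_covariant_derivative_eq[OF X \<xi> U(1) that X_radial refl] parallel[OF that] by simp
  qed
qed

end

theorem proposition1p1:
  fixes M :: "'m mfd" and E :: "('e, 'm) vbundle" and n k :: nat
    and D :: "'m vfield \<Rightarrow> ('m \<Rightarrow> 'e) \<Rightarrow> 'm \<Rightarrow> 'e"
    and V :: "'m set" and x :: "'m \<Rightarrow> nat \<Rightarrow> real" and p :: 'm and \<xi>p :: 'e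
  assumes "smooth_manifold M" and "mdim M = n"
    and "smooth_vector_bundle M k E"
    and "connection M E D"
    and "smooth_coordinates M V x"
    and "p \<in> V" and "\<forall>j<n. x p j = 0"
    and "\<xi>p \<in> fibre E p"
  shows "\<exists>U \<xi>. openin (mtop M) U \<and> p \<in> U \<and> U \<subseteq> V \<and>
           smooth_section M E U \<xi> \<and> \<xi> p = \<xi>p \<and>
           (\<forall>q\<in>U. local_covariant_derivative M E D U (radial_vfield M V x) \<xi> q = vzero E q)"
proof -
  interpret smooth_connection M k E D
    by unfold_locales (use assms in auto)
  show ?thesis
    using radially_parallel_section[OF assms(5,6) _ assms(8)] assms(2,7) by blast
qed

end
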